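(* Let $X$ be an irreducible toral variety over $k$. Then the automorphism group $\mathrm{Aut}(X)$ is a Jordan group.
   Context: $k$ is an algebraically closed field of characteristic zero; variety means algebraic variety over $k$. A variety is called toral if it is isomorphic to a closed subvariety of a linear algebraic torus, i.e. of $(\mathbf{G}_m)^n$ for some $n$. A group $G$ is called a Jordan group if there exists a positive integer $J_G$, depending only on $G$, such that every finite subgroup $K$ of $G$ contains a normal (in $K$) abelian subgroup whose index in $K$ is at most $J_G$. *)

theory Defs
  imports
    "HOL-Analysis.Abstract_Topology"
    "HOL-Computational_Algebra.Polynomial"
    "HOL-Algebra.Bij"
    "HOL-Algebra.Coset"
begin

section \<open>Spaces with functions\<close>

text \<open>
  Varieties are treated in the classical (Serre, Borel) way: a variety is a topological space with
  a sheaf of \<open>'k\<close>-valued functions. A regular function on \<open>U\<close> is represented by a function that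
  is extensional on \<open>U\<close>, so that equality in \<open>regular X U\<close> is equality of functions on \<open>U\<close>.
  Only the values of \<open>regular X\<close> at open sets matter.
\<close>

record ('a, 'k) fun_space =
  space_top :: "'a topology"
  regular :: "'a set \<Rightarrow> ('a \<Rightarrow> 'k) set"

abbreviation points :: "('a, 'k, 'z) fun_space_scheme \<Rightarrow> 'a set" where
  "points X \<equiv> topspace (space_top X)"

definition space_with_functions :: "('a, 'k :: field) fun_space \<Rightarrow> bool" where
  "space_with_functions X \<longleftrightarrow>
     (\<forall>U. openin (space_top X) U \<longrightarrow>
        regular X U \<subseteq> extensional U \<and>
        (\<forall>c. (\<lambda>x\<in>U. c) \<in> regular X U) \<and>
        (\<forall>f \<in> regular X U. \<forall>g \<in> regular X U.
           (\<lambda>x\<in>U. f x + g x) \<in> regular X U \<and> (\<lambda>x\<in>U. f x * g x) \<in> regular X U)) \<and>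
     (\<forall>U V f. openin (space_top X) U \<and> openin (space_top X) V \<and> V \<subseteq> U \<and> f \<in> regular X U \<longrightarrow>
        restrict f V \<in> regular X V) \<and>
     (\<forall>\<U> f. (\<forall>U\<in>\<U>. openin (space_top X) U \<and> restrict f U \<in> regular X U) \<and>
        f \<in> extensional (\<Union>\<U>) \<longrightarrow> f \<in> regular X (\<Union>\<U>))"

definition morphism :: "('a, 'k) fun_space \<Rightarrow> ('b, 'k) fun_space \<Rightarrow> ('a \<Rightarrow> 'b) \<Rightarrow> bool" where
  "morphism X Y \<phi> \<longleftrightarrow>
     continuous_map (space_top X) (space_top Y) \<phi> \<and>
     (\<forall>V f. openin (space_top Y) V \<and> f \<in> regular Y V \<longrightarrow>
        restrict (f \<circ> \<phi>) {x \<in> points X. \<phi> x \<in> V} \<in> regular X {x \<in> points X. \<phi> x \<in> V})"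

definition isomorphism :: "('a, 'k) fun_space \<Rightarrow> ('b, 'k) fun_space \<Rightarrow> ('a \<Rightarrow> 'b) \<Rightarrow> bool" where
  "isomorphism X Y \<phi> \<longleftrightarrow> morphism X Y \<phi> \<and>
     (\<exists>\<psi>. morphism Y X \<psi> \<and> (\<forall>x \<in> points X. \<psi> (\<phi> x) = x) \<and> (\<forall>y \<in> points Y. \<phi> (\<psi> y) = y))"

definition isomorphic :: "('a, 'k) fun_space \<Rightarrow> ('b, 'k) fun_space \<Rightarrow> bool" where
  "isomorphic X Y \<longleftrightarrow> (\<exists>\<phi>. isomorphism X Y \<phi>)"

text \<open>
  The structure induced on a subset \<open>Y\<close>: regular functions are those that locally extend to regular
  functions on open sets of \<open>X\<close>. For open \<open>Y\<close> this is the restriction of the sheaf, for closed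
  \<open>Y\<close> it is the (reduced) closed subvariety.
\<close>

definition subspace_on :: "('a, 'k) fun_space \<Rightarrow> 'a set \<Rightarrow> ('a, 'k) fun_space" where
  "subspace_on X Y =
     \<lparr>space_top = subtopology (space_top X) Y,
      regular = (\<lambda>U. {f \<in> extensional U. \<forall>x\<in>U. \<exists>W g.
        openin (space_top X) W \<and> x \<in> W \<and> W \<inter> Y \<subseteq> U \<and> g \<in> regular X W \<and>
        (\<forall>y \<in> W \<inter> Y. f y = g y)})\<rparr>"


section \<open>Affine space\<close>

text \<open>
  A point of affine \<open>n\<close>-space is a function on \<open>{..<n}\<close>, extended by \<open>undefined\<close>.
\<close>

definition affine_points :: "nat \<Rightarrow> (nat \<Rightarrow> 'k) set" where
  "affine_points n = ({..<n} \<rightarrow>\<^sub>E UNIV)"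

inductive_set poly_funs :: "nat \<Rightarrow> ((nat \<Rightarrow> 'k :: field) \<Rightarrow> 'k) set" for n :: nat where
  const: "(\<lambda>_. c) \<in> poly_funs n"
| coord: "i < n \<Longrightarrow> (\<lambda>x. x i) \<in> poly_funs n"
| add: "p \<in> poly_funs n \<Longrightarrow> q \<in> poly_funs n \<Longrightarrow> (\<lambda>x. p x + q x) \<in> poly_funs n"
| mult: "p \<in> poly_funs n \<Longrightarrow> q \<in> poly_funs n \<Longrightarrow> (\<lambda>x. p x * q x) \<in> poly_funs n"

definition zero_set :: "nat \<Rightarrow> ((nat \<Rightarrow> 'k :: field) \<Rightarrow> 'k) set \<Rightarrow> (nat \<Rightarrow> 'k) set" where
  "zero_set n S = {x \<in> affine_points n. \<forall>p\<in>S. p x = 0}"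

definition zariski :: "nat \<Rightarrow> (nat \<Rightarrow> 'k :: field) topology" where
  "zariski n = topology (\<lambda>U. \<exists>S \<subseteq> poly_funs n. U = affine_points n - zero_set n S)"

lemma openin_zariski:
  fixes U :: "(nat \<Rightarrow> 'k :: field) set"
  shows
  "openin (zariski n) U \<longleftrightarrow> (\<exists>S \<subseteq> poly_funs n. U = affine_points n - zero_set n S)"
proof -
  let ?P = "\<lambda>U :: (nat \<Rightarrow> 'k) set. \<exists>S \<subseteq> poly_funs n. U = affine_points n - zero_set n S"
  have "istopology ?P"
    unfolding istopology_def
  proof (intro conjI allI impI)
    fix U V :: "(nat \<Rightarrow> 'k) set" assume "?P U" "?P V"
    then obtain S T where S: "S \<subseteq> poly_funs n" "U = affine_points n - zero_set n S"
      and T: "T \<subseteq> poly_funs n" "V = affine_points n - zero_set n T"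
      by blast
    define R where "R = (\<lambda>(p, q) x. p x * q x) ` (S \<times> T)"
    have "R \<subseteq> poly_funs n"
      using S(1) T(1) by (force simp: R_def intro: poly_funs.mult)
    moreover have "x \<in> zero_set n R \<longleftrightarrow> x \<in> zero_set n S \<union> zero_set n T" for x
      unfolding R_def zero_set_def by auto
    then have "U \<inter> V = affine_points n - zero_set n R"
      unfolding S(2) T(2) by blast
    ultimately show "?P (U \<inter> V)" by blast
  next
    fix \<K> :: "(nat \<Rightarrow> 'k) set set" assume "\<forall>K\<in>\<K>. ?P K"
    then obtain S where S: "\<And>K. K \<in> \<K> \<Longrightarrow> S K \<subseteq> poly_funs n"
        "\<And>K. K \<in> \<K> \<Longrightarrow> affine_points n - zero_set n (S K) = K"
      by metis
    have "\<Union>\<K> = (\<Union>K\<in>\<K>. affine_points n - zero_set n (S K))"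
      using S(2) by simp
    also have "\<dots> = affine_points n - zero_set n (\<Union>K\<in>\<K>. S K)"
      unfolding zero_set_def by blast
    finally have "\<Union>\<K> = affine_points n - zero_set n (\<Union>K\<in>\<K>. S K)" .
    moreover have "(\<Union>K\<in>\<K>. S K) \<subseteq> poly_funs n" using S(1) by blast
    ultimately show "?P (\<Union>\<K>)" by blast
  qed
  then show ?thesis
    by (simp add: zariski_def topology_inverse')
qed

definition affine_space :: "nat \<Rightarrow> (nat \<Rightarrow> 'k, 'k :: field) fun_space" where
  "affine_space n =
     \<lparr>space_top = zariski n,
      regular = (\<lambda>U. {f \<in> extensional U. \<forall>x\<in>U. \<exists>W p q.
        openin (zariski n) W \<and> x \<in> W \<and> W \<subseteq> U \<and> p \<in> poly_funs n \<and> q \<in> poly_funs n \<and>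
        (\<forall>y\<in>W. q y \<noteq> 0 \<and> f y = p y / q y)})\<rparr>"


section \<open>Varieties\<close>

definition affine_variety :: "('a, 'k :: field) fun_space \<Rightarrow> bool" where
  "affine_variety X \<longleftrightarrow>
     (\<exists>n Z. closedin (zariski n) Z \<and> isomorphic X (subspace_on (affine_space n) Z))"

definition prevariety :: "('a, 'k :: field) fun_space \<Rightarrow> bool" where
  "prevariety X \<longleftrightarrow> space_with_functions X \<and>
     (\<exists>\<U>. finite \<U> \<and> \<Union>\<U> = points X \<and>
        (\<forall>U\<in>\<U>. openin (space_top X) U \<and> affine_variety (subspace_on X U)))"

text \<open>
  The topology of the product variety \<open>X \<times> X\<close> (not the product topology). For affine open \<open>U\<close> and
  \<open>V\<close> the coordinate ring of \<open>U \<times> V\<close> is generated by the functions \<open>f x * g y\<close>, so the sets below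
  with \<open>U\<close> and \<open>V\<close> fixed are the basic open sets of \<open>U \<times> V\<close>.
\<close>

definition square_topology :: "('a, 'k :: field) fun_space \<Rightarrow> ('a \<times> 'a) topology" where
  "square_topology X = topology_generated_by
     {{(x, y) \<in> U \<times> V. (\<Sum>i<m. f i x * g i y) \<noteq> 0} | U V (m :: nat) f g.
        openin (space_top X) U \<and> openin (space_top X) V \<and>
        (\<forall>i<m. f i \<in> regular X U \<and> g i \<in> regular X V)}"

definition variety :: "('a, 'k :: field) fun_space \<Rightarrow> bool" where
  "variety X \<longleftrightarrow> prevariety X \<and> closedin (square_topology X) {(x, x) | x. x \<in> points X}"

definition irreducible_variety :: "('a, 'k :: field) fun_space \<Rightarrow> bool" where
  "irreducible_variety X \<longleftrightarrow> variety X \<and> points X \<noteq> {} \<and>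
     (\<forall>C D. closedin (space_top X) C \<and> closedin (space_top X) D \<and> C \<union> D = points X \<longrightarrow>
        C = points X \<or> D = points X)"

definition torus :: "nat \<Rightarrow> (nat \<Rightarrow> 'k, 'k :: field) fun_space" where
  "torus n = subspace_on (affine_space n) {x \<in> affine_points n. \<forall>i<n. x i \<noteq> 0}"

definition toral :: "('a, 'k :: field) fun_space \<Rightarrow> bool" where
  "toral X \<longleftrightarrow> variety X \<and>
     (\<exists>n Y. closedin (space_top (torus n)) Y \<and> isomorphic X (subspace_on (torus n) Y))"

definition Aut :: "('a, 'k) fun_space \<Rightarrow> ('a \<Rightarrow> 'a) monoid" where
  "Aut X = BijGroup (points X) \<lparr>carrier := {\<phi> \<in> Bij (points X). isomorphism X X \<phi>}\<rparr>"


section \<open>Jordan groups\<close>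

definition Jordan_group :: "('g, 'm) monoid_scheme \<Rightarrow> bool" where
  "Jordan_group G \<longleftrightarrow> group G \<and>
     (\<exists>J :: nat. J > 0 \<and>
       (\<forall>K. subgroup K G \<and> finite K \<longrightarrow>
         (\<exists>A. A \<lhd> (G\<lparr>carrier := K\<rparr>) \<and> comm_group (G\<lparr>carrier := A\<rparr>) \<and>
            card (rcosets\<^bsub>G\<lparr>carrier := K\<rparr>\<^esub> A) \<le> J)))"

end

theory Submission
  imports Defs "HOL-Computational_Algebra.Formal_Laurent_Series" "Jordan_Normal_Form.Char_Poly"
    "HOL-Library.Function_Algebras"
begin

hide_const (open) Module.smult Coset.order

text \<open>Embed \<open>X\<close> as a closed subset \<open>V\<close> of a torus. The units of \<open>V\<close> modulo constants form a lattice of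
  finite rank (unit theorem). A finite group \<open>K\<close> of automorphisms permutes the translates of the coordinate
  functions, which are units, and so acts on the lattice that they generate modulo constants. By Minkowski's
  argument the kernel of reduction modulo 3 acts trivially, hence the elements of \<open>K\<close> that act trivially form a
  normal subgroup of index at most \<open>3 ^ (r * r)\<close>. These elements multiply each coordinate by a constant, so
  they commute.

  For the unit theorem, the function field of \<open>V\<close> is a finite extension of the rational functions in a
  transcendence basis of coordinates, and its elements act on it by matrices. These are restricted to a line and
  expanded at the places of the line; Puiseux's theorem provides common eigenvectors, and the subdegrees
  of the eigenvalues serve as valuations. A unit whose valuations all vanish has a constant characteristic polynomial
  along the line.\<close>

text \<open>The units to which the lattice argument is applied are translates of coordinates under
  \<open>K\<close>, so they change with \<open>K\<close>, while the index may not. Hence the unit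
  theorem is needed with a rank bound fixed before the units, and every estimate behind it uses only
  data of \<open>V\<close>: the number \<open>n\<close> of coordinates, the size \<open>s\<close> of
  a basis of the function field, and a degree bound for the denominators of the coordinates and
  their inverses. Classically the valuations would come from the boundary divisors of a normal
  completion of \<open>V\<close>. Lines in the space of the independent coordinates take its place,
  since their places are explicit, and eigenvectors spare the extension of these places to the
  function field. The price is that the line varies: the valuations have to be bounded uniformly
  before a line is chosen.

  Modulus 3 is the smallest that works in Minkowski's argument, because -1 is congruent to 1 modulo
  2. Irreducibility of \<open>V\<close> makes the units modulo constants torsion-free, so that they
  can be treated as a lattice at all.\<close>

section \<open>Polynomials that split into linear factors\<close>

definition splits :: "'r :: comm_ring_1 poly \<Rightarrow> bool" where
  "splits p \<longleftrightarrow> (\<exists>u as. p = smult u (\<Prod>a\<leftarrow>as. [:-a, 1:]))"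

lemma splits_linear: "splits [:-a, 1:]"
  unfolding splits_def by (rule exI[of _ 1], rule exI[of _ "[a]"]) simp

lemma splits_mult: "splits p \<Longrightarrow> splits q \<Longrightarrow> splits (p * q)"
proof -
  assume "splits p" "splits q"
  then obtain u as v bs where "p = smult u (\<Prod>a\<leftarrow>as. [:-a, 1:])" "q = smult v (\<Prod>a\<leftarrow>bs. [:-a, 1:])"
    unfolding splits_def by blast
  then have "p * q = smult (u * v) (\<Prod>a\<leftarrow>as @ bs. [:-a, 1:])" by (simp add: mult.commute)
  then show ?thesis unfolding splits_def by blast
qed

lemma splits_smult: "splits p \<Longrightarrow> splits (smult c p)"
  unfolding splits_def by (metis smult_smult)

text \<open>Affine substitutions occur twice in Newton's method: as the shift that removes the
  second coefficient, and as the scaling by a power of the series variable.\<close>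

lemma splits_pcompose_linear:
  fixes p :: "'r :: field poly"
  assumes "splits p" and "c \<noteq> 0"
  shows "splits (pcompose p [:b, c:])"
proof -
  obtain u as where p: "p = smult u (\<Prod>a\<leftarrow>as. [:-a, 1:])"
    using assms(1) unfolding splits_def by blast
  have "splits (pcompose (\<Prod>a\<leftarrow>as. [:-a, 1:]) [:b, c:])"
  proof (induction as)
    case Nil
    then show ?case unfolding splits_def
      by (intro exI[of _ 1] exI[of _ "[]"]) (simp add: one_pCons pcompose_const)
  next
    case (Cons a as)
    have "pcompose [:-a, 1:] [:b, c:] = smult c [:- ((a - b) / c), 1:]"
      using assms(2) by (simp add: pcompose_pCons field_simps)
    then have "splits (pcompose [:-a, 1:] [:b, c:])"
      using splits_smult[OF splits_linear] by metis
    from splits_mult[OF this Cons] show ?case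
      by (simp only: list.map prod_list.Cons pcompose_mult)
  qed
  then show ?thesis by (simp add: p pcompose_smult splits_smult)
qed

lemma splits_pcompose_linear_iff:
  fixes p :: "'r :: field poly"
  assumes "c \<noteq> 0"
  shows "splits (pcompose p [:b, c:]) \<longleftrightarrow> splits p"
proof
  assume "splits (pcompose p [:b, c:])"
  then have "splits (pcompose (pcompose p [:b, c:]) [:- b / c, 1 / c:])"
    by (rule splits_pcompose_linear) (use assms in auto)
  also have "pcompose (pcompose p [:b, c:]) [:- b / c, 1 / c:] = pcompose p [:0, 1:]"
    using assms by (simp add: pcompose_assoc[symmetric] pcompose_pCons)
  finally show "splits p" by simp
qed (use assms splits_pcompose_linear in auto)

subsection \<open>Hensel lifting\<close>

text \<open>Modulo \<open>[:-c, 1:]\<close> the polynomial \<open>B\<close> is the nonzero constant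
  \<open>poly B c\<close>, hence a unit; induction on \<open>m\<close> passes to the power.\<close>

lemma bezout_linear_power:
  fixes B :: "'k :: field poly"
  assumes "poly B c \<noteq> 0"
  shows "\<exists>u v. u * [:-c, 1:] ^ m + v * B = 1"
proof (induction m)
  case 0
  then show ?case by (intro exI[of _ 1] exI[of _ 0]) simp
next
  case (Suc m)
  then obtain u v where uv: "u * [:-c, 1:] ^ m + v * B = 1" by blast
  let ?b = "poly B c"
  have "[:-c, 1:] dvd B - [:?b:]" by (simp add: poly_eq_0_iff_dvd[symmetric])
  then obtain Q where Q: "B - [:?b:] = [:-c, 1:] * Q" by (elim dvdE)
  define i where "i = [:inverse ?b:]"
  have i: "i * [:?b:] = 1" using assms by (simp add: i_def one_pCons)
  have e: "i * (B - [:-c, 1:] * Q) = 1" using i unfolding Q[symmetric] by simp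
  have id: "(u * A) * (i * (B - L * Q)) + v * B = (- u * Q * i) * (L * A) + (u * A * i + v) * B" for A L
    by (simp add: algebra_simps)
  \<comment> \<open>The first summand is multiplied by 1, written as
    \<open>i * (B - [:-c, 1:] * Q)\<close>: the part with \<open>Q\<close> raises the power, the
    part with \<open>B\<close> joins the cofactor of \<open>B\<close>.\<close>
  have "1 = (u * [:-c, 1:] ^ m) * (i * (B - [:-c, 1:] * Q)) + v * B"
    using uv e by simp
  also have "\<dots> = (- u * Q * i) * [:-c, 1:] ^ Suc m + (u * [:-c, 1:] ^ m * i + v) * B"
    unfolding power_Suc by (rule id)
  finally show ?case by metis
qed

text \<open>This finds the correction in one Hensel step. Only one cofactor is reduced, modulo
  \<open>A\<close>; comparing degrees in \<open>A * h = C - g * B\<close> then bounds the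
  other.\<close>

lemma bezout_degree:
  fixes A B C :: "'k :: field poly"
  assumes "u * A + v * B = 1" "0 < degree A" "0 < degree B" "degree C < degree A + degree B"
  shows "\<exists>g h. A * h + g * B = C \<and> degree g < degree A \<and> degree h < degree B"
proof -
  define g q where "g = (v * C) mod A" and "q = (v * C) div A"
  define h where "h = u * C + q * B"
  have vC: "v * C = q * A + g" by (simp add: g_def q_def)
  have eq: "A * h + g * B = C"
  proof -
    have "A * h + g * B = A * u * C + (q * A + g) * B" by (simp add: h_def algebra_simps)
    also have "\<dots> = (u * A + v * B) * C" by (simp only: vC[symmetric]) (simp add: algebra_simps)
    finally show ?thesis using assms(1) by simp
  qed
  have "A \<noteq> 0" "B \<noteq> 0" using assms by auto
  have dg: "degree g < degree A"
    using degree_mod_less[OF \<open>A \<noteq> 0\<close>, of "v * C"] assms(2) by (auto simp: g_def)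
  have "degree h < degree B"
  proof (cases "h = 0")
    case False
    have "degree (g * B) < degree A + degree B"
      using dg degree_mult_le[of g B] by linarith
    then have "degree (C - g * B) < degree A + degree B"
      using degree_diff_less assms(4) by blast
    moreover have "A * h = C - g * B" using eq by (simp add: algebra_simps)
    ultimately show ?thesis using False \<open>A \<noteq> 0\<close> by (metis degree_mult_eq nat_add_left_cancel_less)
  qed (use assms in auto)
  with eq dg show ?thesis by blast
qed

lemma fps_to_fls_sum: "fps_to_fls (sum f A) = (\<Sum>a\<in>A. fps_to_fls (f a))"
  by (induction A rule: infinite_finite_induct) simp_all

text \<open>\<open>G\<close> and \<open>H\<close> are found coefficient by coefficient in the series
  variable. At each order the unknowns satisfy a linear equation with coefficients \<open>A\<close>
  and \<open>B\<close> whose right-hand side is known from lower orders; coprimality solves it, and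
  corrections of smaller degree than \<open>A\<close> and \<open>B\<close> leave the degrees of the
  factors unchanged.\<close>

lemma hensel_fls:
  fixes F :: "'k :: field fls poly"
  assumes F: "lead_coeff F = 1" "\<And>i. 0 \<le> fls_subdegree (coeff F i)"
    and F0: "\<And>i. fls_nth (coeff F i) 0 = coeff (A * B) i"
    and monic: "lead_coeff A = 1" "lead_coeff B = 1" and bez: "u * A + v * B = 1"
    and deg: "0 < degree A" "0 < degree B" "degree F = degree A + degree B"
  shows "\<exists>G H. F = G * H \<and> degree G = degree A \<and> degree H = degree B"
proof -
  \<comment> \<open>\<open>Fn n\<close> collects the coefficients of the \<open>n\<close>-th power
    of the series variable. As \<open>F\<close> is monic, its leading coefficient contributes to
    \<open>Fn 0\<close> only, whence the degree drop \<open>degFn\<close>.\<close>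
  define Fn where "Fn n = map_poly (\<lambda>f. fls_nth f (int n)) F" for n
  have coeff_Fn: "coeff (Fn n) i = fls_nth (coeff F i) (int n)" for n i
    unfolding Fn_def by (simp add: coeff_map_poly)
  have degFn: "degree (Fn n) < degree A + degree B" if "n > 0" for n
  proof -
    have "coeff (Fn n) i = 0" if "i \<ge> degree F" for i
    proof (cases "i = degree F")
      case True
      then show ?thesis using F(1) \<open>n > 0\<close> by (simp add: coeff_Fn)
    next
      case False
      then show ?thesis using that by (simp add: coeff_Fn coeff_eq_0)
    qed
    then have "degree (Fn n) \<le> degree F - 1" by (intro degree_le) auto
    then show ?thesis using deg by simp
  qed
  \<comment> \<open>Course-of-values recursion: the sum over \<open>{1..<n}\<close> leaves out the
    two end terms, which contain the unknown pair at \<open>n\<close>, so it refers to earlier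
    values only.\<close>
  define P where "P = (\<lambda>(f :: nat \<Rightarrow> 'k poly \<times> 'k poly) n r. if n = 0 then r = (A, B) else
     degree (fst r) < degree A \<and> degree (snd r) < degree B \<and>
     A * snd r + fst r * B + (\<Sum>i\<in>{1..<n}. fst (f i) * snd (f (n - i))) = Fn n)"
  have "\<exists>f. \<forall>n. P f n (f n)"
  proof (rule dependent_wellorder_choice[where P = P])
    fix r and f g :: "nat \<Rightarrow> 'k poly \<times> 'k poly" and n :: nat
    assume "\<And>y. y < n \<Longrightarrow> f y = g y"
    then have "(\<Sum>i\<in>{1..<n}. fst (f i) * snd (f (n - i))) = (\<Sum>i\<in>{1..<n}. fst (g i) * snd (g (n - i)))"
      by (intro sum.cong) auto
    then show "P f n r = P g n r" unfolding P_def by simp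
  next
    fix n :: nat and f :: "nat \<Rightarrow> 'k poly \<times> 'k poly"
    assume IH: "\<And>y. y < n \<Longrightarrow> P f y (f y)"
    show "\<exists>r. P f n r"
    proof (cases "n = 0")
      case True
      then show ?thesis by (simp add: P_def)
    next
      case False
      have "degree (\<Sum>i\<in>{1..<n}. fst (f i) * snd (f (n - i))) < degree A + degree B"
      proof (rule degree_sum_less)
        fix i assume i: "i \<in> {1..<n}"
        then have "P f i (f i)" "P f (n - i) (f (n - i))" using IH by auto
        then have "degree (fst (f i)) < degree A" "degree (snd (f (n - i))) < degree B"
          using i by (auto simp: P_def)
        then show "degree (fst (f i) * snd (f (n - i))) < degree A + degree B"
          using degree_mult_le[of "fst (f i)" "snd (f (n - i))"] by linarith
      qed (use deg in auto)
      then have "degree (Fn n - (\<Sum>i\<in>{1..<n}. fst (f i) * snd (f (n - i)))) < degree A + degree B"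
        using degFn False by (intro degree_diff_less) auto
      from bezout_degree[OF bez deg(1,2) this] False show ?thesis
        unfolding P_def by (auto simp: algebra_simps)
    qed
  qed
  then obtain f where f: "\<And>n. P f n (f n)" by blast
  define g h where "g n = fst (f n)" and "h n = snd (f n)" for n
  have g0: "g 0 = A" "h 0 = B" using f[of 0] by (auto simp: P_def g_def h_def)
  have dg: "degree (g n) < degree A" "degree (h n) < degree B" if "n > 0" for n
    using f[of n] that by (auto simp: P_def g_def h_def)
  have conv: "(\<Sum>i=0..n. g i * h (n - i)) = Fn n" for n
  proof (cases "n = 0")
    case True
    then show ?thesis using F0 by (intro poly_eqI) (auto simp: coeff_Fn g0)
  next
    case False
    then have "{0..n} = insert 0 (insert n {1..<n})" by auto
    then have "(\<Sum>i=0..n. g i * h (n - i)) = g 0 * h n + (g n * h 0 + (\<Sum>i\<in>{1..<n}. g i * h (n - i)))"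
      using False by simp
    then show ?thesis using f[of n] False by (simp add: P_def g_def h_def g0[unfolded g_def h_def] add.assoc)
  qed
  have dg': "degree (g n) \<le> degree A" "degree (h n) \<le> degree B" for n
  proof -
    show "degree (g n) \<le> degree A" using dg(1)[of n] g0(1) by (cases "n = 0") (simp_all add: less_imp_le)
    show "degree (h n) \<le> degree B" using dg(2)[of n] g0(2) by (cases "n = 0") (simp_all add: less_imp_le)
  qed
  \<comment> \<open>Transposition: a sequence of polynomials of bounded degree becomes a polynomial
    with power series coefficients.\<close>
  define lift where "lift = (\<lambda>(g :: nat \<Rightarrow> 'k poly) d.
     (\<Sum>i\<le>d. monom (fps_to_fls (Abs_fps (\<lambda>n. coeff (g n) i))) i))"
  have coeff_lift: "coeff (lift g d) i = fps_to_fls (Abs_fps (\<lambda>n. coeff (g n) i))"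
    if "\<And>n. degree (g n) \<le> d" for g d i
  proof (cases "i \<le> d")
    case True
    then show ?thesis unfolding lift_def by (simp add: coeff_sum)
  next
    case False
    then have "coeff (g n) i = 0" for n using that[of n] by (intro coeff_eq_0) auto
    then have "Abs_fps (\<lambda>n. coeff (g n) i) = 0" by (simp add: fps_eq_iff)
    then show ?thesis using False unfolding lift_def by (simp add: coeff_sum)
  qed
  define G H where "G = lift g (degree A)" and "H = lift h (degree B)"
  have cG: "coeff G i = fps_to_fls (Abs_fps (\<lambda>n. coeff (g n) i))" for i
    unfolding G_def by (rule coeff_lift) (rule dg')
  have cH: "coeff H i = fps_to_fls (Abs_fps (\<lambda>n. coeff (h n) i))" for i
    unfolding H_def by (rule coeff_lift) (rule dg')
  have FGH: "F = G * H"
  proof (rule poly_eqI)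
    fix i
    have "coeff (G * H) i =
        fps_to_fls (\<Sum>a\<le>i. Abs_fps (\<lambda>n. coeff (g n) a) * Abs_fps (\<lambda>n. coeff (h n) (i - a)))"
      by (simp add: coeff_mult cG cH fls_times_fps_to_fls fps_to_fls_sum)
    also have "(\<Sum>a\<le>i. Abs_fps (\<lambda>n. coeff (g n) a) * Abs_fps (\<lambda>n. coeff (h n) (i - a)))
        = Abs_fps (\<lambda>n. coeff (Fn n) i)"
    proof (rule fps_ext)
      fix n
      have "fps_nth (\<Sum>a\<le>i. Abs_fps (\<lambda>n. coeff (g n) a) * Abs_fps (\<lambda>n. coeff (h n) (i - a))) n
          = (\<Sum>a\<le>i. \<Sum>b=0..n. coeff (g b) a * coeff (h (n - b)) (i - a))"
        by (simp add: fps_sum_nth fps_mult_nth)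
      also have "\<dots> = (\<Sum>b=0..n. coeff (g b * h (n - b)) i)"
        by (subst sum.swap) (simp add: coeff_mult)
      also have "\<dots> = coeff (Fn n) i" by (simp flip: conv add: coeff_sum)
      finally show "fps_nth (\<Sum>a\<le>i. Abs_fps (\<lambda>n. coeff (g n) a) * Abs_fps (\<lambda>n. coeff (h n) (i - a))) n
          = fps_nth (Abs_fps (\<lambda>n. coeff (Fn n) i)) n" by simp
    qed
    also have "fps_to_fls (Abs_fps (\<lambda>n. coeff (Fn n) i)) = coeff F i"
      using F(2)[of i] by (intro fls_eqI) (auto simp: coeff_Fn)
    finally show "coeff F i = coeff (G * H) i" by simp
  qed
  have deg_lift: "degree (lift g d) \<le> d" for g d
    unfolding lift_def by (rule degree_sum_le) (auto intro: order.trans[OF degree_monom_le])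
  have "degree G \<le> degree A" "degree H \<le> degree B"
    unfolding G_def H_def by (rule deg_lift)+
  moreover have "degree F = degree G + degree H"
    using F(1) FGH by (metis degree_mult_eq leading_coeff_0_iff mult_zero_left mult_zero_right zero_neq_one)
  ultimately show ?thesis using FGH deg by (intro exI[of _ G] exI[of _ H]) auto
qed

subsection \<open>Newton-Puiseux\<close>

text \<open>Replaces the series variable of the coefficients by its \<open>E\<close>-th power.
  Puiseux series with exponents in multiples of \<open>1 / E\<close> are modelled by Laurent series
  after this substitution.\<close>

abbreviation fls_cp :: "nat \<Rightarrow> 'k :: idom fls poly \<Rightarrow> 'k fls poly" where
  "fls_cp E \<equiv> map_poly (\<lambda>f. fls_compose_power f E)"

lemma comm_ring_hom_compose_power:
  "E > 0 \<Longrightarrow> comm_ring_hom (\<lambda>f :: 'k :: idom fls. fls_compose_power f E)"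
  by unfold_locales auto

lemma fls_cp_mult: "E > 0 \<Longrightarrow> fls_cp E (p * q) = fls_cp E p * fls_cp E q"
proof -
  assume "E > 0"
  then interpret comm_ring_hom "\<lambda>f :: 'a fls. fls_compose_power f E"
    by (rule comm_ring_hom_compose_power)
  show ?thesis by (intro poly_eqI) (simp add: coeff_map_poly coeff_mult hom_sum)
qed

lemma fls_cp_smult: "E > 0 \<Longrightarrow> fls_cp E (smult c q) = smult (fls_compose_power c E) (fls_cp E q)"
  by (intro poly_eqI) (simp add: coeff_map_poly)

lemma fls_cp_linear: "E > 0 \<Longrightarrow> fls_cp E [:b, c:] = [:fls_compose_power b E, fls_compose_power c E:]"
  by (intro poly_eqI) (auto simp: coeff_map_poly coeff_pCons split: nat.splits)

lemma fls_cp_pcompose: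
  assumes "E > 0"
  shows "fls_cp E (pcompose p q) = pcompose (fls_cp E p) (fls_cp E q)"
proof -
  interpret comm_ring_hom "\<lambda>f :: 'a fls. fls_compose_power f E"
    using assms by (rule comm_ring_hom_compose_power)
  show ?thesis by (simp add: map_poly_pcompose)
qed

lemma fls_compose_power_compose:
  "a > 0 \<Longrightarrow> b > 0 \<Longrightarrow> fls_compose_power (fls_compose_power f a) b = fls_compose_power f (a * b)"
proof (rule fls_eqI)
  fix n assume ab: "a > 0" "b > 0"
  show "fls_nth (fls_compose_power (fls_compose_power f a) b) n = fls_nth (fls_compose_power f (a * b)) n"
  proof (cases "int b dvd n")
    case True
    then obtain m where n: "n = int b * m" by blast
    have "int a * int b dvd int b * m \<longleftrightarrow> int a dvd m" using ab by (simp add: mult.commute)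
    moreover have "int b * m div (int a * int b) = m div int a" using ab
      by (simp add: mult.commute[of "int a"])
    ultimately show ?thesis using ab n by (simp add: fls_nth_compose_power)
  next
    case False
    then have "\<not> int (a * b) dvd n" by (metis dvd_mult_right of_nat_mult)
    with False show ?thesis using ab by (simp add: fls_nth_compose_power)
  qed
qed

lemma fls_cp_compose: "a > 0 \<Longrightarrow> b > 0 \<Longrightarrow> fls_cp b (fls_cp a p) = fls_cp (a * b) p"
  by (intro poly_eqI) (simp add: coeff_map_poly fls_compose_power_compose)

lemma splits_fls_cp: 
  assumes "E > 0" "splits p" shows "splits (fls_cp E p)"
proof -
  obtain u as where p: "p = smult u (\<Prod>a\<leftarrow>as. [:-a, 1:])"
    using assms(2) unfolding splits_def by blast
  have "fls_cp E (\<Prod>a\<leftarrow>as. [:-a, 1:]) = (\<Prod>a\<leftarrow>map (\<lambda>a. fls_compose_power a E) as. [:-a, 1:])"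
  proof (induction as)
    case Nil
    then show ?case using assms(1)
      by (intro poly_eqI) (auto simp: coeff_map_poly one_pCons coeff_pCons split: nat.splits)
  next
    case (Cons a as)
    have "fls_cp E (\<Prod>a\<leftarrow>a # as. [:-a, 1:]) = fls_cp E [:-a, 1:] * fls_cp E (\<Prod>a\<leftarrow>as. [:-a, 1:])"
      by (simp only: list.map prod_list.Cons fls_cp_mult[OF assms(1)])
    then show ?case using Cons assms(1) by (simp only: fls_cp_linear) simp
  qed
  then show ?thesis using assms(1) unfolding splits_def p by (metis fls_cp_smult)
qed

text \<open>The index \<open>q\<close> ends the first edge of the Newton polygon; the comparison of slopes is cross-multiplied.\<close>

lemma newton_slope:
  fixes F :: "'k :: field fls poly"
  assumes "\<exists>i\<in>{1..s}. coeff F (s - i) \<noteq> 0"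
  obtains q where "q \<in> {1..s}" "coeff F (s - q) \<noteq> 0"
    "\<And>i. i \<in> {1..s} \<Longrightarrow> coeff F (s - i) \<noteq> 0 \<Longrightarrow>
       fls_subdegree (coeff F (s - q)) * int i \<le> fls_subdegree (coeff F (s - i)) * int q"
proof -
  let ?I = "{i\<in>{1..s}. coeff F (s - i) \<noteq> 0}"
  let ?m = "\<lambda>i. of_int (fls_subdegree (coeff F (s - i))) / of_nat i :: rat"
  define q where "q = arg_min_on ?m ?I"
  have I: "finite ?I" "?I \<noteq> {}" using assms by auto
  have q: "q \<in> ?I" unfolding q_def by (rule arg_min_if_finite(1)[OF I])
  show ?thesis
  proof (rule that)
    fix i assume i: "i \<in> {1..s}" "coeff F (s - i) \<noteq> 0"
    then have "?m q \<le> ?m i"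
      using arg_min_least[OF I, of i ?m] by (simp add: q_def)
    then have "of_int (fls_subdegree (coeff F (s - q)) * int i) \<le>
        (of_int (fls_subdegree (coeff F (s - i)) * int q) :: rat)"
      using i q by (simp add: field_simps)
    then show "fls_subdegree (coeff F (s - q)) * int i \<le> fls_subdegree (coeff F (s - i)) * int q"
      by (simp only: of_int_le_iff)
  qed (use q in auto)
qed

lemma fls_subdegree_compose_power:
  fixes f :: "'k :: zero fls"
  assumes "d > 0" shows "fls_subdegree (fls_compose_power f d) = int d * fls_subdegree f"
proof (cases "f = 0")
  case False
  show ?thesis
  proof (rule fls_subdegree_eqI)
    show "fls_nth (fls_compose_power f d) (int d * fls_subdegree f) \<noteq> 0"
      using False assms by (simp add: fls_nth_compose_power)
    fix k assume k: "k < int d * fls_subdegree f"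
    show "fls_nth (fls_compose_power f d) k = 0"
    proof (cases "int d dvd k")
      case True
      then obtain m where m: "k = int d * m" by blast
      then show ?thesis using k assms by (simp add: fls_nth_compose_power)
    qed (use assms in \<open>simp add: fls_nth_compose_power\<close>)
  qed
qed simp

lemma fls_compose_power_eq_0_iff:
  fixes f :: "'k :: zero fls"
  assumes "d > 0" shows "fls_compose_power f d = 0 \<longleftrightarrow> f = 0"
proof
  assume z: "fls_compose_power f d = 0"
  have "fls_nth f n = 0" for n
    using fls_nth_compose_power[OF assms, of f "int d * n"] assms by (simp add: z)
  then show "f = 0" by (simp add: fls_eq_iff)
qed simp

text \<open>Rescaling makes the first edge of the Newton polygon horizontal. The residue polynomial
  \<open>F0\<close> is then monic without a term of degree \<open>s - 1\<close>, but with some other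
  lower term. In characteristic zero it is therefore not a power of a single linear factor, so it
  has a coprime factorization, which lifts by Hensel.\<close>

lemma newton_step:
  fixes F :: "'k :: {alg_closed_field, field_char_0} fls poly"
  assumes F: "degree F = s" "lead_coeff F = 1" "coeff F (s - 1) = 0" "s \<ge> 2"
    and "\<exists>i\<in>{1..s}. coeff F (s - i) \<noteq> 0"
  obtains q c u G H where "q \<in> {1..s}" "c \<noteq> 0" "u \<noteq> 0" "pcompose (fls_cp q F) [:0, c:] = smult u (G * H)"
    "degree G < s" "degree H < s" "G * H \<noteq> 0"
proof -
  obtain q where q: "q \<in> {1..s}" "coeff F (s - q) \<noteq> 0"
    "\<And>i. i \<in> {1..s} \<Longrightarrow> coeff F (s - i) \<noteq> 0 \<Longrightarrow>
       fls_subdegree (coeff F (s - q)) * int i \<le> fls_subdegree (coeff F (s - i)) * int q"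
    using newton_slope[OF assms(5)] by blast
  \<comment> \<open>The slope of the edge is \<open>e / q\<close>; the substitution
    \<open>fls_cp q\<close> turns it into the integer \<open>e\<close>.\<close>
  define e where "e = fls_subdegree (coeff F (s - q))"
  define X :: "int \<Rightarrow> 'k fls" where "X = fls_X_intpow"
  have X0: "X m \<noteq> 0" and Xsub: "fls_subdegree (X m) = m" for m by (auto simp: X_def)
  have Xpow: "X m ^ i = X (int i * m)" for m i by (simp add: X_def fls_X_intpow_power mult.commute)
  have Xmult: "X m * X m' = X (m + m')" for m m' by (simp add: X_def fls_X_intpow_times_fls_X_intpow)
  have X00: "X 0 = 1" by (simp add: X_def)
  define F' where "F' = smult (X (- int s * e)) (pcompose (fls_cp q F) [:0, X e:])"
  have cF': "coeff F' i = X ((int i - int s) * e) * fls_compose_power (coeff F i) q" for i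
    using q(1) by (simp add: F'_def coeff_pcompose_linear coeff_map_poly Xpow Xmult algebra_simps
        flip: mult.assoc)
  have lead: "coeff F' s = 1" using F q by (simp add: cF' X00)
  have degF': "degree F' = s"
  proof (rule antisym)
    show "degree F' \<le> s" using F(1) by (intro degree_le) (auto simp: cF' coeff_eq_0)
    show "s \<le> degree F'" using lead by (intro le_degree) auto
  qed
  have sub: "fls_subdegree (coeff F' i) = (int i - int s) * e + int q * fls_subdegree (coeff F i)"
    if "coeff F i \<noteq> 0" for i
  proof -
    have "fls_compose_power (coeff F i) q \<noteq> 0"
      using that q(1) by (simp add: fls_compose_power_eq_0_iff)
    then show ?thesis using q(1) by (simp add: cF' X0 Xsub fls_subdegree_compose_power)
  qed
  have nonneg: "0 \<le> fls_subdegree (coeff F' i)" for i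
  proof (cases "coeff F i = 0 \<or> i = s")
    case True
    then show ?thesis using lead by (auto simp: cF')
  next
    case False
    then have "i < s" using F(1) le_degree[of F i] by auto
    then have "e * int (s - i) \<le> fls_subdegree (coeff F i) * int q"
      using q(3)[of "s - i"] False by (simp add: e_def)
    then show ?thesis using sub[of i] False \<open>i < s\<close> by (simp add: of_nat_diff algebra_simps)
  qed
  define F0 where "F0 = map_poly (\<lambda>f. fls_nth f 0) F'"
  have cF0: "coeff F0 i = fls_nth (coeff F' i) 0" for i by (simp add: F0_def coeff_map_poly)
  have F0s: "coeff F0 s = 1" "coeff F0 (s - 1) = 0" using lead F(3) by (auto simp: cF0 cF')
  have degF0: "degree F0 = s"
  proof (rule antisym)
    show "degree F0 \<le> s" using degF' by (intro degree_le) (auto simp: cF0 coeff_eq_0)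
    show "s \<le> degree F0" using F0s by (intro le_degree) auto
  qed
  \<comment> \<open>The end of the edge has subdegree exactly 0 after rescaling, so it survives in
    the residue.\<close>
  have F0q: "coeff F0 (s - q) \<noteq> 0"
  proof -
    have "fls_subdegree (coeff F' (s - q)) = 0"
      using sub[OF q(2)] q(1) by (simp add: e_def of_nat_diff algebra_simps)
    moreover have "coeff F' (s - q) \<noteq> 0" unfolding cF' using q(1,2) X0
      by (simp add: fls_compose_power_eq_0_iff)
    ultimately show ?thesis unfolding cF0 by (metis nth_fls_subdegree_nonzero)
  qed
  have "degree F0 > 0" using degF0 F(4) by simp
  then obtain c where c: "poly F0 c = 0" using alg_closed_imp_poly_has_root by blast
  define m where "m = order c F0"
  have "F0 \<noteq> 0" using degF0 F(4) by auto
  then obtain B where B: "F0 = [:-c, 1:] ^ m * B" "\<not> [:-c, 1:] dvd B"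
    using order_decomp m_def by blast
  have "m > 0" using c \<open>F0 \<noteq> 0\<close> by (simp add: m_def order_gt_0_iff)
  have lead_coeff_linear_power: "lead_coeff ([:-c, 1:] ^ m) = 1" by (simp add: lead_coeff_power)
  have Bc: "poly B c \<noteq> 0" using B(2) by (simp add: poly_eq_0_iff_dvd)
  have "B \<noteq> 0" using B(1) \<open>F0 \<noteq> 0\<close> by auto
  have degs: "s = m + degree B"
    using degF0 \<open>B \<noteq> 0\<close> by (simp add: B(1) degree_mult_eq degree_power_eq)
  have leadB: "lead_coeff B = 1"
    using F0s(1) degF0 unfolding B(1) by (metis lead_coeff_linear_power lead_coeff_mult mult_1)
  \<comment> \<open>If \<open>F0\<close> were \<open>[:-c, 1:] ^ s\<close>, its vanishing
    coefficient at \<open>s - 1\<close> would be \<open>- s * c\<close>. Characteristic zero gives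
    \<open>c = 0\<close>, and a pure power contradicts \<open>F0q\<close>.\<close>
  have "m \<noteq> s"
  proof
    assume "m = s"
    then have "B = 1" using degs leadB by (metis add_cancel_left_right degree_0_id one_pCons)
    then have F0: "F0 = [:-c, 1:] ^ s" using B(1) \<open>m = s\<close> by simp
    obtain s' where s': "s = Suc s'" using F(4) by (cases s) auto
    have "coeff ([:-c, 1:] ^ s) (s - 1) = - of_nat s * c"
      unfolding s' by (simp add: coeff_linear_poly_power algebra_simps del: power_Suc)
    then have "c = 0" using F0s(2) F0 F(4) by auto
    then have "F0 = monom 1 s" using F0 by (simp add: monom_altdef)
    then show False using F0q q(1) by (auto simp: coeff_monom split: if_splits)
  qed
  then have "degree B > 0" "m < s" using degs by auto
  obtain u v where uv: "u * [:-c, 1:] ^ m + v * B = 1" using bezout_linear_power[OF Bc] by blast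
  have dA: "degree ([:-c, 1:] ^ m) = m" by (simp add: degree_power_eq)
  have "\<exists>G H. F' = G * H \<and> degree G = degree ([:-c, 1:] ^ m) \<and> degree H = degree B"
  proof (rule hensel_fls[OF _ nonneg _ lead_coeff_linear_power leadB uv])
    show "lead_coeff F' = 1" using lead degF' by simp
    show "fls_nth (coeff F' i) 0 = coeff ([:-c, 1:] ^ m * B) i" for i
      by (simp only: cF0[symmetric] B(1)[symmetric])
    show "0 < degree ([:-c, 1:] ^ m)" using dA \<open>m > 0\<close> by simp
    show "0 < degree B" by fact
    show "degree F' = degree ([:-c, 1:] ^ m) + degree B" using dA degF' degs by simp
  qed
  then obtain G H where GH: "F' = G * H" "degree G = m" "degree H = degree B" using dA by auto
  have "pcompose (fls_cp q F) [:0, X e:] = smult (X (int s * e)) F'"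
    by (simp add: F'_def Xmult X00)
  moreover have "degree G < s" "degree H < s" using GH degs \<open>m > 0\<close> \<open>m < s\<close> by auto
  moreover have "G * H \<noteq> 0" using lead GH(1) by auto
  ultimately show ?thesis
    using that[OF q(1) X0[of e] X0[of "int s * e"], of G H] GH(1) by simp
qed

text \<open>One \<open>E\<close> serves all polynomials of degree at most \<open>s\<close>, so that
  a single field of series can be fixed for all matrices, lines and places to come.\<close>

theorem newton_puiseux:
  "\<exists>E>0. \<forall>F :: 'k :: {alg_closed_field, field_char_0} fls poly. F \<noteq> 0 \<and> degree F \<le> s \<longrightarrow> splits (fls_cp E F)"
proof (induction s)
  case 0
  have "splits (fls_cp 1 F)" if "degree F \<le> 0" for F :: "'k fls poly"
  proof -
    obtain a where "F = [:a:]" using \<open>degree F \<le> 0\<close> degree_eq_zeroE by auto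
    then have "fls_cp 1 F = smult (fls_compose_power a 1) (\<Prod>a\<leftarrow>[]. [:-a, 1:])"
      by (cases "a = 0") (simp_all add: map_poly_pCons)
    then show ?thesis unfolding splits_def by blast
  qed
  then show ?case by (intro exI[of _ 1]) auto
next
  case (Suc s)
  then obtain E' where E': "E' > 0"
    "\<And>F :: 'k fls poly. F \<noteq> 0 \<Longrightarrow> degree F \<le> s \<Longrightarrow> splits (fls_cp E' F)" by blast
  \<comment> \<open>The index \<open>q\<close> of a Newton step is at most \<open>Suc s\<close> and
    so divides the factorial; the two factors of smaller degree need \<open>E'\<close>. Thus
    \<open>q * E'\<close> divides \<open>E\<close> whichever \<open>q\<close> occurs.\<close>
  define E where "E = fact (Suc s) * E'"
  have E: "E > 0" using E'(1) by (simp add: E_def)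
  have up: "splits (fls_cp E F)" if *: "splits (fls_cp a F)" "a dvd E" for a and F :: "'k fls poly"
  proof -
    obtain d where d: "E = a * d" using *(2) by blast
    then have "a > 0" "d > 0" using E by auto
    then show ?thesis using splits_fls_cp[OF \<open>d > 0\<close> *(1)] by (simp add: fls_cp_compose d)
  qed
  have "splits (fls_cp E F)" if F: "F \<noteq> 0" "degree F \<le> Suc s" for F :: "'k fls poly"
  proof (cases "degree F \<le> s")
    case True
    then show ?thesis using up[OF E'(2)] F by (simp add: E_def)
  next
    case False
    then have dF: "degree F = Suc s" using F by simp
    define l where "l = lead_coeff F"
    have l: "l \<noteq> 0" using F l_def by simp
    define F1 where "F1 = smult (1 / l) F"
    have F1: "degree F1 = Suc s" "lead_coeff F1 = 1" using l dF by (auto simp: F1_def l_def)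
    \<comment> \<open>The shift by \<open>b\<close> removes the second coefficient, as
      \<open>newton_step\<close> requires; the division by \<open>Suc s\<close> uses characteristic
      zero.\<close>
    define b where "b = coeff F1 s / of_nat (Suc s)"
    define F2 where "F2 = pcompose F1 [:- b, 1:]"
    have dF2: "degree F2 = Suc s" using F1 by (simp add: F2_def degree_pcompose)
    have lF2: "lead_coeff F2 = 1" using F1 unfolding F2_def by (subst lead_coeff_comp) auto
    have cF2: "coeff F2 s = 0"
    proof -
      have pcompose_power: "pcompose (p ^ n) q = pcompose p q ^ n" for p q :: "'k fls poly" and n
        by (induction n) (simp_all add: pcompose_mult pcompose_1)
      have F1': "F1 = monom 1 (Suc s) + (monom (coeff F1 s) s + (\<Sum>i<s. monom (coeff F1 i) i))"
        using F1 by (subst poly_as_sum_of_monoms[symmetric]) (simp add: lessThan_Suc_atMost[symmetric] add_ac)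
      have a: "coeff (pcompose (monom a i) [:-b, 1:]) s = a * coeff ([:-b, 1:] ^ i) s" for a i
        by (simp add: monom_altdef pcompose_smult pcompose_power pcompose_pCons)
      have "coeff ([:-b, 1:] ^ Suc s) s = - of_nat (Suc s) * b"
        by (simp add: coeff_linear_poly_power algebra_simps del: power_Suc)
      moreover have "coeff ([:-b, 1:] ^ s) s = 1" by (simp add: coeff_linear_poly_power)
      moreover have "coeff ([:-b, 1:] ^ i) s = 0" if "i < s" for i
        using that by (intro coeff_eq_0) (simp add: degree_power_eq)
      ultimately have "coeff F2 s = - of_nat (Suc s) * b + coeff F1 s"
        unfolding F2_def by (subst F1') (simp add: pcompose_add pcompose_sum coeff_sum a del: of_nat_Suc)
      moreover have "of_nat (Suc s) \<noteq> (0 :: 'k fls)"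
        by (metis fls_const_0 fls_const_nonzero fls_of_nat of_nat_neq_0)
      ultimately show ?thesis unfolding b_def by (simp del: of_nat_Suc)
    qed
    have "splits (fls_cp E F2)"
    proof (cases "\<exists>i\<in>{1..Suc s}. coeff F2 (Suc s - i) \<noteq> 0")
      case False
      have "F2 = monom 1 (Suc s)"
      proof (rule poly_eqI)
        fix i
        show "coeff F2 i = coeff (monom 1 (Suc s)) i"
        proof (cases "i < Suc s")
          case True
          then have "Suc s - i \<in> {1..Suc s}" "Suc s - (Suc s - i) = i" by auto
          then have "coeff F2 i = 0" using False by (metis (lifting))
          with True show ?thesis by simp
        next
          case False
          then show ?thesis using lF2 dF2 by (cases "i = Suc s") (auto simp: coeff_eq_0)
        qed
      qed
      also have "\<dots> = (\<Prod>a\<leftarrow>replicate (Suc s) 0. [:-a, 1:])"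
        by (simp add: monom_altdef prod_list_replicate)
      finally have "splits F2" unfolding splits_def by (metis smult_1_left)
      then show ?thesis using splits_fls_cp[OF E] by blast
    next
      case True
      have "s \<noteq> 0"
      proof
        assume "s = 0"
        then have "coeff F2 (Suc s - i) = 0" if "i \<in> {1..Suc s}" for i using that cF2 by auto
        then show False using True by blast
      qed
      obtain q c u G H where q: "q \<in> {1..Suc s}" "c \<noteq> 0" "u \<noteq> 0"
        "pcompose (fls_cp q F2) [:0, c:] = smult u (G * H)"
        "degree G < Suc s" "degree H < Suc s" "G * H \<noteq> 0"
        by (rule newton_step[OF dF2 lF2 _ _ True]) (use cF2 \<open>s \<noteq> 0\<close> in auto)
      have "splits (fls_cp E' G)" "splits (fls_cp E' H)" using E'(2) q by auto
      then have "splits (fls_cp E' (smult u (G * H)))"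
        using E'(1) by (simp add: fls_cp_smult fls_cp_mult splits_mult splits_smult)
      then have "splits (pcompose (fls_cp E' (fls_cp q F2)) [:0, fls_compose_power c E':])"
        using E'(1) by (simp flip: q(4) add: fls_cp_pcompose fls_cp_linear)
      moreover have "fls_compose_power c E' \<noteq> 0" using q(2) E'(1)
        by (simp add: fls_compose_power_eq_0_iff)
      ultimately have "splits (fls_cp E' (fls_cp q F2))" using splits_pcompose_linear_iff by blast
      then have "splits (fls_cp (q * E') F2)" using E'(1) q(1) by (simp add: fls_cp_compose)
      moreover have "q * E' dvd E" unfolding E_def
        using q(1) by (intro mult_dvd_mono dvd_fact) auto
      ultimately show ?thesis by (rule up)
    qed
    then have "splits (pcompose (fls_cp E F1) [:- fls_compose_power b E, 1:])"
      unfolding F2_def using E by (simp add: fls_cp_pcompose fls_cp_linear)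
    then have "splits (fls_cp E F1)" by (simp only: splits_pcompose_linear_iff[OF one_neq_zero] not_False_eq_True)
    moreover have "F = smult l F1" using l by (simp add: F1_def)
    ultimately show ?thesis using E by (simp add: fls_cp_smult splits_smult)
  qed
  with E show ?case by blast
qed

section \<open>Linear dependence without division\<close>

text \<open>Gaussian elimination by cross-multiplication. The coefficients range over a subset
  \<open>C\<close> because the intended instance \<open>pf T\<close> is a domain inside the ring of
  all functions, which has zero divisors. The element \<open>e\<close> is the nontrivial coefficient
  at the start of the induction.\<close>

lemma linear_dependence:
  fixes v :: "'i \<Rightarrow> nat \<Rightarrow> 'r :: comm_ring"
  assumes C: "0 \<in> C" "\<And>x y. x \<in> C \<Longrightarrow> y \<in> C \<Longrightarrow> x + y \<in> C" "\<And>x y. x \<in> C \<Longrightarrow> y \<in> C \<Longrightarrow> x * y \<in> C"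
      "\<And>x. x \<in> C \<Longrightarrow> - x \<in> C" "\<And>x y. x \<in> C \<Longrightarrow> y \<in> C \<Longrightarrow> x * y = 0 \<Longrightarrow> x = 0 \<or> y = 0"
      "e \<in> C" "e \<noteq> 0"
    and "finite I" "card I > s" "\<And>i j. i \<in> I \<Longrightarrow> j < s \<Longrightarrow> v i j \<in> C"
  shows "\<exists>c. (\<forall>i\<in>I. c i \<in> C) \<and> (\<exists>i\<in>I. c i \<noteq> 0) \<and> (\<forall>j<s. (\<Sum>i\<in>I. c i * v i j) = 0)"
  using assms(8-)
proof (induction s arbitrary: I v)
  case 0
  then have "I \<noteq> {}" by auto
  with C(6,7) show ?case by (intro exI[of _ "\<lambda>_. e"]) auto
next
  case (Suc s)
  show ?case
  proof (cases "\<exists>p\<in>I. v p s \<noteq> 0")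
    case False
    have "\<exists>c. (\<forall>i\<in>I. c i \<in> C) \<and> (\<exists>i\<in>I. c i \<noteq> 0) \<and> (\<forall>j<s. (\<Sum>i\<in>I. c i * v i j) = 0)"
      using Suc.prems by (intro Suc.IH) auto
    then obtain c where "\<forall>i\<in>I. c i \<in> C" "\<exists>i\<in>I. c i \<noteq> 0" "\<forall>j<s. (\<Sum>i\<in>I. c i * v i j) = 0" by blast
    moreover have "(\<Sum>i\<in>I. c i * v i s) = 0" using False by (intro sum.neutral) auto
    ultimately show ?thesis by (metis less_SucE)
  next
    case True
    then obtain p where p: "p \<in> I" "v p s \<noteq> 0" by blast
    \<comment> \<open>The pivot \<open>p\<close> clears the last coordinate.\<close>
    define w where "w i j = v p s * v i j - v i s * v p j" for i j
    have vC: "v i j \<in> C" if "i \<in> I" "j < Suc s" for i j using Suc.prems that by auto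
    have Cd: "x - y \<in> C" if "x \<in> C" "y \<in> C" for x y using C(2)[OF that(1) C(4)[OF that(2)]] by simp
    have "\<exists>c. (\<forall>i\<in>I - {p}. c i \<in> C) \<and> (\<exists>i\<in>I - {p}. c i \<noteq> 0) \<and> (\<forall>j<s. (\<Sum>i\<in>I - {p}. c i * w i j) = 0)"
      using Suc.prems p by (intro Suc.IH) (auto simp: w_def intro!: Cd C(3) vC)
    then obtain c where c: "\<And>i. i \<in> I - {p} \<Longrightarrow> c i \<in> C" "\<exists>i\<in>I - {p}. c i \<noteq> 0"
      "\<And>j. j < s \<Longrightarrow> (\<Sum>i\<in>I - {p}. c i * w i j) = 0" by blast
    \<comment> \<open>The coefficient at \<open>p\<close> is such that the combination of the
      \<open>v i\<close> equals the combination of the \<open>w i\<close> with coefficients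
      \<open>c\<close>.\<close>
    define d where "d i = (if i = p then - (\<Sum>i\<in>I - {p}. c i * v i s) else v p s * c i)" for i
    have sumC: "(\<Sum>i\<in>A. f i) \<in> C" if "\<And>i. i \<in> A \<Longrightarrow> f i \<in> C" for A :: "'i set" and f
      using that by (induction A rule: infinite_finite_induct) (auto intro: C)
    have dC: "\<forall>i\<in>I. d i \<in> C"
      using c(1) p vC by (auto simp: d_def intro!: C(3,4) sumC)
    have nz: "\<exists>i\<in>I. d i \<noteq> 0"
    proof -
      obtain i where i: "i \<in> I - {p}" "c i \<noteq> 0" using c(2) by blast
      then have "v p s * c i \<noteq> 0" using C(5)[OF vC c(1)] p by blast
      then show ?thesis using i by (intro bexI[of _ i]) (auto simp: d_def)
    qed
    have sum_d: "(\<Sum>i\<in>I. d i * v i j) = (\<Sum>i\<in>I - {p}. c i * w i j)" for j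
    proof -
      have "(\<Sum>i\<in>I. d i * v i j) = d p * v p j + (\<Sum>i\<in>I - {p}. d i * v i j)"
        using Suc.prems(1) p(1) by (simp add: sum.remove)
      also have "(\<Sum>i\<in>I - {p}. d i * v i j) = (\<Sum>i\<in>I - {p}. v p s * c i * v i j)"
        by (intro sum.cong) (auto simp: d_def)
      also have "d p * v p j = (\<Sum>i\<in>I - {p}. - (c i * v i s * v p j))"
        by (simp add: d_def sum_distrib_right sum_negf)
      finally show ?thesis unfolding w_def
        by (simp add: sum.distrib[symmetric] algebra_simps)
    qed
    have "(\<Sum>i\<in>I. d i * v i j) = 0" if "j < Suc s" for j
    proof (cases "j = s")
      case True
      then show ?thesis unfolding sum_d by (intro sum.neutral) (simp add: w_def mult.commute)
    qed (use that c(3) sum_d in auto)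
    with dC nz show ?thesis by blast
  qed
qed

lemma linear_dependence_idom:
  fixes v :: "'i \<Rightarrow> nat \<Rightarrow> 'r :: idom"
  assumes "finite I" "card I > s"
  shows "\<exists>c. (\<exists>i\<in>I. c i \<noteq> 0) \<and> (\<forall>j<s. (\<Sum>i\<in>I. c i * v i j) = 0)"
  using linear_dependence[of UNIV 1 I s v] assms by auto

subsection \<open>Common eigenvectors\<close>

text \<open>The value 0 from \<open>s\<close> on makes equality of vectors an equality of functions
  and lets iterates be written with \<open>^^\<close>.\<close>

definition mat_app :: "nat \<Rightarrow> (nat \<Rightarrow> nat \<Rightarrow> 'f :: comm_ring_1) \<Rightarrow> (nat \<Rightarrow> 'f) \<Rightarrow> nat \<Rightarrow> 'f" where
  "mat_app s A v = (\<lambda>i. if i < s then \<Sum>j<s. A i j * v j else 0)"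

lemma mat_app_lincomb: "mat_app s A (\<lambda>i. u i - c * v i) = (\<lambda>i. mat_app s A u i - c * mat_app s A v i)"
  by (auto simp: mat_app_def fun_eq_iff sum_subtractf sum_distrib_left algebra_simps)

lemma mat_app_smult: "mat_app s A (\<lambda>i. c * v i) = (\<lambda>i. c * mat_app s A v i)"
  by (auto simp: mat_app_def fun_eq_iff sum_distrib_left mult.left_commute)

lemma mat_app_sum: "mat_app s A (\<lambda>i. \<Sum>n\<in>N. c n * v n i) = (\<lambda>i. \<Sum>n\<in>N. c n * mat_app s A (v n) i)"
proof
  fix i
  show "mat_app s A (\<lambda>i. \<Sum>n\<in>N. c n * v n i) i = (\<Sum>n\<in>N. c n * mat_app s A (v n) i)"
  proof (cases "i < s")
    case True
    have "(\<Sum>j<s. A i j * (\<Sum>n\<in>N. c n * v n j)) = (\<Sum>n\<in>N. \<Sum>j<s. A i j * (c n * v n j))"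
      unfolding sum_distrib_left by (rule sum.swap)
    with True show ?thesis by (simp add: mat_app_def sum_distrib_left mult.left_commute)
  qed (simp add: mat_app_def)
qed

lemma mat_app_pow_lincomb:
  "(mat_app s A ^^ n) (\<lambda>i. u i - c * v i) = (\<lambda>i. (mat_app s A ^^ n) u i - c * (mat_app s A ^^ n) v i)"
  by (induction n) (simp_all add: mat_app_lincomb)

lemma mat_app_pow_zero: "(mat_app s A ^^ n) (\<lambda>i. 0) = (\<lambda>i. 0)"
  by (induction n) (auto simp: mat_app_def fun_eq_iff)

text \<open>Comparing coefficients in \<open>(x 1 - A) adj (x 1 - A) = \<chi>(x) 1\<close> makes the sum telescope.\<close>

lemma cayley_hamilton_app:
  fixes A :: "nat \<Rightarrow> nat \<Rightarrow> 'f :: comm_ring_1"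
  assumes w: "\<And>i. i \<ge> s \<Longrightarrow> w i = 0"
  defines "\<chi> \<equiv> char_poly (mat s s (\<lambda>(i, j). A i j))"
  shows "(\<Sum>n\<le>degree \<chi>. coeff \<chi> n * (mat_app s A ^^ n) w i) = 0"
proof -
  let ?M = "mat s s (\<lambda>(i, j). A i j)"
  let ?P = "char_poly_matrix ?M"
  let ?L = "mat_app s A"
  have P: "?P \<in> carrier_mat s s" by (rule char_poly_matrix_closed) simp
  define B where "B i j = adj_mat ?P $$ (i, j)" for i j
  have adj: "adj_mat ?P \<in> carrier_mat s s" "?P * adj_mat ?P = det ?P \<cdot>\<^sub>m 1\<^sub>m s"
    using adj_mat[OF P] by auto
  have PB: "[:0, 1:] * B i j - (\<Sum>k<s. [:A i k:] * B k j) = (if i = j then \<chi> else 0)"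
    if "i < s" "j < s" for i j
  proof -
    have "(?P * adj_mat ?P) $$ (i, j) = (\<Sum>k<s. ?P $$ (i, k) * B k j)"
      using that carrier_matD[OF P] carrier_matD[OF adj(1)]
      by (simp add: scalar_prod_def B_def atLeast0LessThan del: char_poly_matrix_closed)
    also have "\<dots> = (\<Sum>k<s. (if i = k then [:0, 1:] * B k j else 0) - [:A i k:] * B k j)"
      using that by (intro sum.cong) (auto simp: char_poly_matrix_def algebra_simps)
    also have "\<dots> = [:0, 1:] * B i j - (\<Sum>k<s. [:A i k:] * B k j)"
      using that by (simp add: sum_subtractf)
    also have "(?P * adj_mat ?P) $$ (i, j) = (if i = j then \<chi> else 0)"
      using that by (simp add: adj(2) \<chi>_def char_poly_def)
    finally show ?thesis by simp
  qed
  \<comment> \<open>\<open>b n\<close> is the coefficient of degree \<open>n\<close> of the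
    adjugate, applied to \<open>w\<close>.\<close>
  define b where "b n i = (if i < s then \<Sum>j<s. coeff (B i j) n * w j else 0)" for n i
  have co: "(case n of 0 \<Rightarrow> 0 | Suc m \<Rightarrow> coeff (B i j) m) - (\<Sum>k<s. A i k * coeff (B k j) n)
      = (if i = j then coeff \<chi> n else 0)" if "i < s" "j < s" for i j n
    using arg_cong[OF PB[OF that], of "\<lambda>p. coeff p n"]
    by (simp add: coeff_sum coeff_pCons split: nat.splits)
  have rec: "(\<lambda>i. (case n of 0 \<Rightarrow> 0 | Suc m \<Rightarrow> b m i) - ?L (b n) i) = (\<lambda>i. coeff \<chi> n * w i)" for n
  proof
    fix i
    show "(case n of 0 \<Rightarrow> 0 | Suc m \<Rightarrow> b m i) - ?L (b n) i = coeff \<chi> n * w i"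
    proof (cases "i < s")
      case True
      have "(\<Sum>j<s. A i j * b n j) = (\<Sum>k<s. \<Sum>j<s. A i k * coeff (B k j) n * w j)"
        by (intro sum.cong) (auto simp: b_def sum_distrib_left mult.assoc)
      also have "\<dots> = (\<Sum>j<s. (\<Sum>k<s. A i k * coeff (B k j) n) * w j)"
        by (subst sum.swap) (simp add: sum_distrib_right)
      finally have "(case n of 0 \<Rightarrow> 0 | Suc m \<Rightarrow> b m i) - ?L (b n) i =
        (\<Sum>j<s. ((case n of 0 \<Rightarrow> 0 | Suc m \<Rightarrow> coeff (B i j) m) - (\<Sum>k<s. A i k * coeff (B k j) n)) * w j)"
        using True by (cases n) (simp_all add: mat_app_def b_def sum_subtractf left_diff_distrib sum_negf)
      also have "\<dots> = (\<Sum>j<s. (if i = j then coeff \<chi> n else 0) * w j)"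
        using True by (intro sum.cong) (auto simp: co)
      also have "\<dots> = (\<Sum>j<s. (if i = j then coeff \<chi> n * w j else 0))" by (intro sum.cong) auto
      finally show ?thesis using True by simp
    qed (use w in \<open>auto simp: mat_app_def b_def split: nat.splits\<close>)
  qed
  have tele: "(\<Sum>n\<le>N. coeff \<chi> n * (?L ^^ n) w i) = - (?L ^^ Suc N) (b N) i" for N i
  proof (induction N)
    case 0
    show ?case using fun_cong[OF rec[of 0], of i] by simp
  next
    case (Suc N)
    have "(?L ^^ Suc N) (\<lambda>i. b N i - 1 * ?L (b (Suc N)) i) i = (?L ^^ Suc N) (\<lambda>i. 0 - (- coeff \<chi> (Suc N)) * w i) i"
      using rec[of "Suc N"] by simp
    moreover have "(?L ^^ Suc N) (\<lambda>i. 0) i = 0"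
      by (simp only: mat_app_pow_zero)
    ultimately have "(?L ^^ Suc N) (b N) i - (?L ^^ Suc N) (?L (b (Suc N))) i = coeff \<chi> (Suc N) * (?L ^^ Suc N) w i"
      unfolding mat_app_pow_lincomb by simp
    moreover have "(?L ^^ Suc N) (?L (b (Suc N))) = (?L ^^ Suc (Suc N)) (b (Suc N))"
      by (simp only: funpow_swap1 funpow.simps o_apply)
    ultimately have "coeff \<chi> (Suc N) * (?L ^^ Suc N) w i = (?L ^^ Suc N) (b N) i - (?L ^^ Suc (Suc N)) (b (Suc N)) i"
      by (simp only:)
    then show ?case by (simp only: sum.atMost_Suc Suc.IH) (rule minus_add_cancel[of _ "- _", folded diff_conv_add_uminus])
  qed
  \<comment> \<open>\<open>N\<close> exceeds the degrees of all entries of the adjugate, so the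
    remainder \<open>b N\<close> of the telescoping sum vanishes.\<close>
  define N where "N = degree \<chi> + (\<Sum>i<s. \<Sum>j<s. Suc (degree (B i j)))"
  have "b N = (\<lambda>i. 0)"
  proof
    fix i
    have "coeff (B i j) N = 0" if "i < s" "j < s" for j
    proof (rule coeff_eq_0)
      have "Suc (degree (B i j)) \<le> (\<Sum>j<s. Suc (degree (B i j)))"
        using that by (intro member_le_sum) auto
      also have "\<dots> \<le> (\<Sum>i<s. \<Sum>j<s. Suc (degree (B i j)))"
        using that by (intro member_le_sum[of i "{..<s}" "\<lambda>i. \<Sum>j<s. Suc (degree (B i j))"]) auto
      finally show "degree (B i j) < N" by (simp add: N_def)
    qed
    then show "b N i = 0" by (simp add: b_def)
  qed
  moreover have "(?L ^^ Suc N) (\<lambda>i. 0) i = 0" for i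
    by (simp only: mat_app_pow_zero)
  ultimately have "(\<Sum>n\<le>N. coeff \<chi> n * (?L ^^ n) w i) = 0" using tele[where N = N and i = i] by simp
  moreover have "(\<Sum>n\<le>N. coeff \<chi> n * (?L ^^ n) w i) = (\<Sum>n\<le>degree \<chi>. coeff \<chi> n * (?L ^^ n) w i)"
    by (rule sum.mono_neutral_right) (auto simp: N_def coeff_eq_0)
  ultimately show ?thesis by simp
qed

text \<open>Applying the factors one after another evaluates their product at \<open>A\<close>. The
  range \<open>N\<close> is kept free because the induction step calls the hypothesis with a larger
  one.\<close>

lemma poly_app_linear_factors:
  fixes A :: "nat \<Rightarrow> nat \<Rightarrow> 'f :: comm_ring_1"
  assumes "degree (\<Prod>a\<leftarrow>as. [:-a, 1:]) \<le> N"
  shows "foldr (\<lambda>a v i. mat_app s A v i - a * v i) as w =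
    (\<lambda>i. \<Sum>n\<le>N. coeff (\<Prod>a\<leftarrow>as. [:-a, 1:]) n * (mat_app s A ^^ n) w i)"
  using assms
proof (induction as arbitrary: N)
  case Nil
  have "(\<Sum>n\<le>N. coeff 1 n * (mat_app s A ^^ n) w i) = (\<Sum>n\<in>{0}. coeff 1 n * (mat_app s A ^^ n) w i)" for i
    by (rule sum.mono_neutral_right) (auto simp: coeff_1)
  then show ?case by simp
next
  case (Cons a as)
  define p where "p = (\<Prod>a\<leftarrow>as. [:-a, 1:])"
  define M where "M = N + degree p"
  let ?L = "mat_app s A"
  have q: "(\<Prod>a\<leftarrow>a # as. [:-a, 1:]) = pCons 0 p - smult a p" by (simp add: p_def)
  have IH: "foldr (\<lambda>a v i. ?L v i - a * v i) as w = (\<lambda>i. \<Sum>n\<le>M. coeff p n * (?L ^^ n) w i)"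
    unfolding p_def by (rule Cons.IH) (simp add: M_def p_def)
  have "foldr (\<lambda>a v i. ?L v i - a * v i) (a # as) w = 
      (\<lambda>i. (\<Sum>n\<le>M. coeff p n * ?L ((?L ^^ n) w) i) - a * (\<Sum>n\<le>M. coeff p n * (?L ^^ n) w i))"
    by (simp add: IH mat_app_sum)
  also have "\<dots> = (\<lambda>i. \<Sum>n\<le>Suc M. coeff (pCons 0 p - smult a p) n * (?L ^^ n) w i)"
  proof
    fix i
    have "(\<Sum>n\<le>Suc M. coeff (pCons 0 p - smult a p) n * (?L ^^ n) w i) =
      (\<Sum>n\<le>Suc M. coeff (pCons 0 p) n * (?L ^^ n) w i) - a * (\<Sum>n\<le>Suc M. coeff p n * (?L ^^ n) w i)"
      by (simp add: sum_subtractf left_diff_distrib sum_distrib_left mult.assoc del: sum.atMost_Suc)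
    also have "(\<Sum>n\<le>Suc M. coeff (pCons 0 p) n * (?L ^^ n) w i) = (\<Sum>n\<le>M. coeff p n * ?L ((?L ^^ n) w) i)"
      by (simp add: sum.atMost_Suc_shift del: sum.atMost_Suc)
    also have "(\<Sum>n\<le>Suc M. coeff p n * (?L ^^ n) w i) = (\<Sum>n\<le>M. coeff p n * (?L ^^ n) w i)"
      by (simp add: M_def coeff_eq_0)
    finally show "(\<Sum>n\<le>M. coeff p n * ?L ((?L ^^ n) w) i) - a * (\<Sum>n\<le>M. coeff p n * (?L ^^ n) w i) =
      (\<Sum>n\<le>Suc M. coeff (pCons 0 p - smult a p) n * (?L ^^ n) w i)" by simp
  qed
  also have "\<dots> = (\<lambda>i. \<Sum>n\<le>N. coeff (pCons 0 p - smult a p) n * (?L ^^ n) w i)"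
  proof
    fix i
    show "(\<Sum>n\<le>Suc M. coeff (pCons 0 p - smult a p) n * (?L ^^ n) w i) = (\<Sum>n\<le>N. coeff (pCons 0 p - smult a p) n * (?L ^^ n) w i)"
      using Cons.prems unfolding q by (intro sum.mono_neutral_right) (auto simp: M_def coeff_eq_0 simp del: coeff_diff)
  qed
  finally show ?case unfolding q .
qed

lemma mat_app_commute:
  assumes "\<And>i j. i < s \<Longrightarrow> j < s \<Longrightarrow> (\<Sum>k<s. A i k * B k j) = (\<Sum>k<s. B i k * A k j)"
  shows "mat_app s A (mat_app s B v) = mat_app s B (mat_app s A v)"
proof
  fix i :: nat
  have e: "(\<Sum>k<s. A i k * (\<Sum>j<s. B k j * v j)) = (\<Sum>j<s. (\<Sum>k<s. A i k * B k j) * v j)" for A B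
    unfolding sum_distrib_left sum_distrib_right by (subst sum.swap) (simp add: mult.assoc)
  show "mat_app s A (mat_app s B v) i = mat_app s B (mat_app s A v) i"
  proof (cases "i < s")
    case True
    then have "mat_app s A (mat_app s B v) i = (\<Sum>k<s. A i k * (\<Sum>j<s. B k j * v j))"
      and "mat_app s B (mat_app s A v) i = (\<Sum>k<s. B i k * (\<Sum>j<s. A k j * v j))"
      by (simp_all add: mat_app_def)
    then show ?thesis using True by (simp add: e assms)
  qed (simp add: mat_app_def)
qed

text \<open>The linear factors of the characteristic polynomial are applied to \<open>w\<close> one
  after another. The result is 0 by Cayley-Hamilton, so the last nonzero vector on the way is an
  eigenvector of \<open>A\<close>. It is a polynomial in \<open>A\<close> applied to
  \<open>w\<close>; hence every \<open>B\<close> that commutes with \<open>A\<close> and has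
  \<open>w\<close> as eigenvector keeps its eigenvalue.\<close>

lemma refine_eigenvector:
  fixes A :: "nat \<Rightarrow> nat \<Rightarrow> 'f :: field"
  assumes "splits (char_poly (mat s s (\<lambda>(i, j). A i j)))"
    and w: "\<And>i. i \<ge> s \<Longrightarrow> w i = 0" "w \<noteq> (\<lambda>i. 0)"
  shows "\<exists>w' \<rho>. w' \<noteq> (\<lambda>i. 0) \<and> (\<forall>i\<ge>s. w' i = 0) \<and> mat_app s A w' = (\<lambda>i. \<rho> * w' i) \<and>
    (\<forall>B \<sigma>. (\<forall>i<s. \<forall>j<s. (\<Sum>k<s. A i k * B k j) = (\<Sum>k<s. B i k * A k j)) \<longrightarrow>
       mat_app s B w = (\<lambda>i. \<sigma> * w i) \<longrightarrow> mat_app s B w' = (\<lambda>i. \<sigma> * w' i))"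
proof -
  let ?\<chi> = "char_poly (mat s s (\<lambda>(i, j). A i j))"
  let ?F = "\<lambda>as. foldr (\<lambda>a v i. mat_app s A v i - a * v i) as w"
  obtain u as where \<chi>: "?\<chi> = smult u (\<Prod>a\<leftarrow>as. [:-a, 1:])" using assms(1) unfolding splits_def by blast
  have "lead_coeff ?\<chi> = 1" using degree_monic_char_poly[of "mat s s (\<lambda>(i, j). A i j)" s] by auto
  then have u: "u \<noteq> 0" using \<chi> by auto
  have "?F as i = 0" for i
  proof -
    have "u * ?F as i = (\<Sum>n\<le>degree ?\<chi>. coeff ?\<chi> n * (mat_app s A ^^ n) w i)"
      unfolding \<chi> by (subst poly_app_linear_factors[OF order_refl]) (use u in \<open>simp add: sum_distrib_left mult.assoc\<close>)
    then show ?thesis using cayley_hamilton_app[of s w A i] w(1) u by simp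
  qed
  then have "?F as = (\<lambda>i. 0)" by auto
  \<comment> \<open>\<open>bs\<close> is a stage at which the vector is still nonzero while the next
    factor kills it.\<close>
  then have "\<exists>a bs. ?F bs \<noteq> (\<lambda>i. 0) \<and> ?F (a # bs) = (\<lambda>i. 0)"
  proof (induction as)
    case Nil
    then show ?case using w(2) by simp
  next
    case (Cons a as)
    then show ?case by (cases "?F as = (\<lambda>i. 0)") blast+
  qed
  then obtain a bs where bs: "?F bs \<noteq> (\<lambda>i. 0)" "?F (a # bs) = (\<lambda>i. 0)" by blast
  have supp: "\<forall>i\<ge>s. ?F bs i = 0"
    by (induction bs) (auto simp: w mat_app_def)
  have keep: "mat_app s B (?F bs) = (\<lambda>i. \<sigma> * ?F bs i)"
    if "\<forall>i<s. \<forall>j<s. (\<Sum>k<s. A i k * B k j) = (\<Sum>k<s. B i k * A k j)" "mat_app s B w = (\<lambda>i. \<sigma> * w i)" for B \<sigma>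
  proof (induction bs)
    case Nil
    then show ?case using that by simp
  next
    case (Cons b bs)
    have "mat_app s B (mat_app s A (?F bs)) = mat_app s A (mat_app s B (?F bs))"
      using that(1) by (intro mat_app_commute) auto
    also have "\<dots> = (\<lambda>i. \<sigma> * mat_app s A (?F bs) i)"
      unfolding Cons by (rule mat_app_smult)
    finally have "mat_app s B (mat_app s A (?F bs)) = (\<lambda>i. \<sigma> * mat_app s A (?F bs) i)" .
    then show ?case using Cons by (simp add: mat_app_lincomb algebra_simps)
  qed
  have "mat_app s A (?F bs) = (\<lambda>i. a * ?F bs i)" using bs(2) by (auto simp: fun_eq_iff)
  with bs(1) supp keep show ?thesis by blast
qed

subsection \<open>Places of the rational function field\<close>

text \<open>\<open>fls_subdegree 0\<close> is 0, whereas the valuation of 0 is infinite; hence the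
  separate disjunct.\<close>

definition vge :: "'k :: field fls \<Rightarrow> int \<Rightarrow> bool" where
  "vge f B \<longleftrightarrow> f = 0 \<or> B \<le> fls_subdegree f"

lemma vge_iff: "vge f B \<longleftrightarrow> (\<forall>n<B. fls_nth f n = 0)"
  unfolding vge_def
  by (metis fls_eq0_below_subdegree fls_subdegree_geI fls_zero_nth less_le_trans)

lemma vge_0 [simp]: "vge 0 B" by (simp add: vge_def)

lemma vge_add: "vge f B \<Longrightarrow> vge g B \<Longrightarrow> vge (f + g) B" by (simp add: vge_iff)

lemma vge_minus: "vge f B \<Longrightarrow> vge (- f) B" by (simp add: vge_iff)

lemma vge_sum: "(\<And>i. i \<in> I \<Longrightarrow> vge (f i) B) \<Longrightarrow> vge (sum f I) B"
  by (induction I rule: infinite_finite_induct) (auto intro: vge_add)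

lemma vge_mult: "vge f B \<Longrightarrow> vge g B' \<Longrightarrow> vge (f * g) (B + B')"
  by (cases "f = 0 \<or> g = 0") (auto simp: vge_def)

lemma vge_const: "vge (fls_const c) 0" by (simp add: vge_def)

lemma vge_mult0: "vge f 0 \<Longrightarrow> vge g 0 \<Longrightarrow> vge (f * g) 0"
  using vge_mult[of f 0 g 0] by simp

lemma fls_nth0_mult:
  assumes "vge f 0" "vge g 0"
  shows "fls_nth (f * g) 0 = fls_nth f 0 * fls_nth g 0"
proof -
  have r: "f = fps_to_fls (fls_regpart f)" if "vge f 0" for f :: "'a fls"
    using that by (intro fls_eqI) (auto simp: vge_iff)
  have "f * g = fps_to_fls (fls_regpart f * fls_regpart g)"
    using r[OF assms(1)] r[OF assms(2)] fls_times_fps_to_fls by metis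
  then show ?thesis by simp
qed

text \<open>The places of \<open>'k(z)\<close>, ramified of order \<open>E\<close>: \<open>z = c + w\<^sup>E\<close> at \<open>Some c\<close> and
  \<open>z = w\<^sup>-\<^sup>E\<close> at \<open>None\<close>, the point at infinity.\<close>

definition place_elem :: "nat \<Rightarrow> 'k option \<Rightarrow> 'k :: field fls" where
  "place_elem E c = (case c of None \<Rightarrow> fls_X_intpow (- int E) | Some c \<Rightarrow> fls_const c + fls_X_intpow (int E))"

definition place :: "nat \<Rightarrow> 'k option \<Rightarrow> 'k :: field poly \<Rightarrow> 'k fls" where
  "place E c p = poly (map_poly fls_const p) (place_elem E c)"

lemma fls_const_sum: "fls_const (sum f A) = (\<Sum>a\<in>A. fls_const (f a))"
  by (induction A rule: infinite_finite_induct) (simp_all flip: fls_plus_const)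

lemma map_poly_fls_const_hom:
  "map_poly fls_const (p + q) = map_poly fls_const p + map_poly fls_const (q :: 'k :: field poly)"
  "map_poly fls_const (p * q) = map_poly fls_const p * map_poly fls_const q"
  by (rule poly_eqI; simp add: coeff_map_poly coeff_mult fls_plus_const)
    (rule poly_eqI; simp add: coeff_map_poly coeff_mult fls_const_sum fls_const_mult_const)

lemma place_add [simp]: "place E c (p + q) = place E c p + place E c q"
  by (simp add: place_def map_poly_fls_const_hom)

lemma place_mult [simp]: "place E c (p * q) = place E c p * place E c q"
  by (simp add: place_def map_poly_fls_const_hom)

lemma place_const [simp]: "place E c [:a:] = fls_const a"
  by (cases "a = 0") (simp_all add: place_def map_poly_pCons)

lemma place_0 [simp]: "place E c 0 = 0" by (simp add: place_def)

lemma place_1 [simp]: "place E c 1 = 1" using place_const[of E c 1] by (simp add: one_pCons)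

lemma place_hom: "comm_ring_hom (place E c)"
  by unfold_locales auto

lemma place_pCons: "place E c (pCons a p) = fls_const a + place_elem E c * place E c p"
  by (cases "a = 0 \<and> p = 0") (auto simp: place_def map_poly_pCons)

lemma place_power: "place E c (p ^ n) = place E c p ^ n"
  by (induction n) simp_all

text \<open>This carries a splitting obtained with \<open>fls_cp E\<close> from the unramified place
  to the ramified one.\<close>

lemma fls_compose_power_place:
  assumes "E > 0"
  shows "fls_compose_power (place 1 c p) E = place E c p"
proof (induction p rule: pCons_induct)
  case (pCons a p)
  have "fls_compose_power (place_elem 1 c :: 'a fls) E = place_elem E c"
    using assms by (auto simp: place_elem_def split: option.splits)
  with pCons show ?case using assms by (simp add: place_pCons)
qed simp

lemma place_Some:
  assumes "E > 0"
  shows "vge (place E (Some c) p) 0" "fls_nth (place E (Some c) p) 0 = poly p c"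
proof -
  have e: "vge (place_elem E (Some c) :: 'a fls) 0" "fls_nth (place_elem E (Some c) :: 'a fls) 0 = c"
    using assms by (auto simp: place_elem_def vge_iff)
  have "vge (place E (Some c) p) 0 \<and> fls_nth (place E (Some c) p) 0 = poly p c"
  proof (induction p rule: pCons_induct)
    case (pCons a p)
    then show ?case unfolding place_pCons
      using e by (auto simp: fls_nth0_mult intro!: vge_add vge_mult0 vge_const)
  qed simp
  then show "vge (place E (Some c) p) 0" "fls_nth (place E (Some c) p) 0 = poly p c" by auto
qed

lemma subdegree_place_Some:
  assumes "E > 0" "p \<noteq> 0"
  shows "place E (Some c) p \<noteq> 0" "fls_subdegree (place E (Some c) p) = int E * int (order c p)"
proof -
  obtain q where q: "p = [:-c, 1:] ^ order c p * q" "\<not> [:-c, 1:] dvd q"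
    using order_decomp[OF assms(2)] by blast
  have "poly q c \<noteq> 0" using q(2) by (simp add: poly_eq_0_iff_dvd)
  then have "fls_nth (place E (Some c) q) 0 \<noteq> 0" unfolding place_Some(2)[OF assms(1)] .
  then have pq: "place E (Some c) q \<noteq> 0" "fls_subdegree (place E (Some c) q) = 0"
    using place_Some(1)[OF assms(1), of c q] by (auto simp: vge_def intro: antisym fls_subdegree_leI)
  have l: "place E (Some c) [:-c, 1:] = fls_X_intpow (int E)"
    by (simp add: place_pCons place_elem_def fls_plus_const flip: fls_const_uminus)
  have "place E (Some c) p = fls_X_intpow (int E) ^ order c p * place E (Some c) q"
    by (subst q(1)) (simp only: place_mult place_power l)
  then show "place E (Some c) p \<noteq> 0" "fls_subdegree (place E (Some c) p) = int E * int (order c p)"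
    using pq by (simp_all add: fls_X_intpow_power mult.commute)
qed

lemma subdegree_place_None:
  assumes "E > 0" "p \<noteq> 0"
  shows "place E None p \<noteq> 0 \<and> fls_subdegree (place E None p) = - int E * int (degree p)"
  using assms(2)
proof (induction p rule: pCons_induct)
  case (pCons a p)
  show ?case
  proof (cases "p = 0")
    case True
    then show ?thesis using pCons.hyps by (simp add: place_pCons)
  next
    case False
    define X :: "'a fls" where "X = fls_X_intpow (- int E)"
    have "fls_X_intpow m \<noteq> (0 :: 'a fls)" "fls_subdegree (fls_X_intpow m :: 'a fls) = m" for m by simp_all
    then have X: "X \<noteq> 0" "fls_subdegree X = - int E" unfolding X_def by blast+
    let ?g = "X * place E None p"
    have g: "?g \<noteq> 0" "fls_subdegree ?g = - int E * int (degree (pCons a p))"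
      using pCons.IH[OF False] False X by (auto simp: algebra_simps)
    have lt: "fls_subdegree ?g < 0" unfolding g(2) using assms(1) False by simp
    have eq: "place E None (pCons a p) = fls_const a + ?g" by (simp add: place_pCons place_elem_def X_def)
    have "fls_subdegree (fls_const a + ?g) = fls_subdegree ?g"
    proof (rule fls_subdegree_eqI)
      show "fls_nth (fls_const a + ?g) (fls_subdegree ?g) \<noteq> 0" using lt g(1) by simp
      show "fls_nth (fls_const a + ?g) k = 0" if "k < fls_subdegree ?g" for k using that lt by simp
    qed
    then show ?thesis using eq g lt by (metis fls_zero_subdegree less_irrefl)
  qed
qed simp

lemma place_nonzero: "E > 0 \<Longrightarrow> p \<noteq> 0 \<Longrightarrow> place E c p \<noteq> 0"
  using subdegree_place_Some(1)[of E p] subdegree_place_None[of E p] by (cases c) simp_all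

text \<open>The bound depends on the degree alone and not on the place; it keeps the valuations of
  units bounded uniformly over all lines.\<close>

lemma vge_place:
  assumes "E > 0" "degree p \<le> d"
  shows "vge (place E c p) (- int E * int d)"
proof (cases "p = 0")
  case False
  have "int E * int (degree p) \<le> int E * int d" using assms by (intro mult_left_mono) auto
  then show ?thesis
    using subdegree_place_Some(2)[OF assms(1) False] subdegree_place_None[OF assms(1) False]
    by (cases c) (auto simp: vge_def intro: order.trans[of _ 0])
qed simp

lemma subdegree_place_le:
  assumes "E > 0" "degree p \<le> d"
  shows "fls_subdegree (place E c p) \<le> int E * int d"
proof (cases "p = 0")
  case False
  have "int E * int (degree p) \<le> int E * int d" using assms by (intro mult_left_mono) auto
  moreover have "int E * int (order a p) \<le> int E * int (degree p)" for a
    using order_degree[OF False] by (intro mult_left_mono) auto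
  moreover have "- (int E * int (degree p)) \<le> int E * int d"
    by (rule order.trans[of _ 0]) simp_all
  ultimately show ?thesis
    using subdegree_place_Some(2)[OF assms(1) False] subdegree_place_None[OF assms(1) False]
    by (cases c) (auto intro: order.trans)
qed simp

text \<open>A root of \<open>q\<close> is also a root of \<open>p\<close>; dividing both by the
  linear factor preserves the inequalities between the orders.\<close>

lemma dvd_if_order_le:
  fixes p q :: "'k :: alg_closed_field poly"
  assumes "q \<noteq> 0" "p \<noteq> 0" "\<And>a. order a q \<le> order a p"
  shows "q dvd p"
  using assms
proof (induction "degree q" arbitrary: p q)
  case 0
  then show ?case by (metis dvd_trans is_unit_iff_degree one_dvd)
next
  case (Suc d)
  then obtain a where a: "poly q a = 0" using alg_closed_imp_poly_has_root[of q] by auto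
  then have "order a q > 0" using Suc.prems by (simp add: order_gt_0_iff)
  then have "poly p a = 0" using Suc.prems(3)[of a] by (metis not_gr0 order_root le_zero_eq)
  then obtain p' where p': "p = [:-a, 1:] * p'" using poly_eq_0_iff_dvd by (metis dvdE)
  obtain q' where q': "q = [:-a, 1:] * q'" using a poly_eq_0_iff_dvd by (metis dvdE)
  have nz: "q' \<noteq> 0" "p' \<noteq> 0" using Suc.prems p' q' by auto
  have "degree q = Suc (degree q')" unfolding q' using nz by (subst degree_mult_eq) auto
  moreover have "order b q' \<le> order b p'" for b
  proof -
    have "order b q = order b [:-a, 1:] + order b q'" "order b p = order b [:-a, 1:] + order b p'"
      using Suc.prems p' q' order_mult by blast+
    then show ?thesis using Suc.prems(3)[of b] by simp
  qed
  ultimately have "q' dvd p'" using Suc.hyps(1)[of q' p'] Suc.hyps(2) nz by simp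
  then show ?case unfolding p' q' by (rule mult_dvd_mono[OF dvd_refl])
qed

text \<open>A rational function without poles on the projective line is constant: the finite places
  give divisibility, and the place at infinity bounds the degree of the quotient.\<close>

lemma constant_ratio_if_vge_all_places:
  fixes p q :: "'k :: alg_closed_field poly"
  assumes "E > 0" "q \<noteq> 0" "\<And>c. vge (place E c p) (fls_subdegree (place E c q))"
  shows "\<exists>k. p = smult k q"
proof (cases "p = 0")
  case True
  then show ?thesis by (intro exI[of _ 0]) simp
next
  case False
  have "q dvd p"
  proof (rule dvd_if_order_le[OF assms(2) False])
    fix a
    show "order a q \<le> order a p"
      using assms(3)[of "Some a"] subdegree_place_Some[OF assms(1) False, of a]
        subdegree_place_Some[OF assms(1,2), of a] assms(1) by (simp add: vge_def)
  qed
  then obtain r where r: "p = q * r" by blast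
  have "degree p \<le> degree q"
    using assms(3)[of None] subdegree_place_None[OF assms(1) False]
        subdegree_place_None[OF assms(1,2)] assms(1) by (simp add: vge_def)
  then have "degree r = 0" using r False by (simp add: degree_mult_eq)
  then obtain k where "r = [:k:]" by (elim degree_eq_zeroE)
  with r show ?thesis by (intro exI[of _ k]) (simp add: mult.commute)
qed

text \<open>Characteristic polynomials commute with ring homomorphisms and have degree
  \<open>s\<close> here, so the exponent of \<open>newton_puiseux\<close> for this degree works for
  every matrix and every place.\<close>

lemma place_char_poly_splits:
  "\<exists>E>0. \<forall>c. \<forall>N :: 'k :: {alg_closed_field, field_char_0} poly mat.
     N \<in> carrier_mat s s \<longrightarrow> splits (char_poly (map_mat (place E c) N))"
proof -
  obtain E where E: "E > 0"
    "\<And>F :: 'k fls poly. F \<noteq> 0 \<Longrightarrow> degree F \<le> s \<Longrightarrow> splits (fls_cp E F)"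
    using newton_puiseux by blast
  have "splits (char_poly (map_mat (place E c) N))" if N: "N \<in> carrier_mat s s" for c and N :: "'k poly mat"
  proof -
    interpret p1: comm_ring_hom "place 1 c" by (rule place_hom)
    interpret pE: comm_ring_hom "place E c" by (rule place_hom)
    let ?F = "char_poly (map_mat (place 1 c) N)"
    have "degree ?F = s" "coeff ?F s = 1"
      using degree_monic_char_poly[of "map_mat (place 1 c) N" s] N by auto
    then have "splits (fls_cp E ?F)" using E(2)[of ?F] by (metis coeff_0 order_refl zero_neq_one)
    moreover have "fls_cp E ?F = char_poly (map_mat (place E c) N)"
      unfolding p1.char_poly_hom[OF N] pE.char_poly_hom[OF N]
      by (intro poly_eqI) (simp add: coeff_map_poly fls_compose_power_place[OF E(1), unfolded One_nat_def])
    ultimately show ?thesis by simp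
  qed
  with E(1) show ?thesis by blast
qed

text \<open>The eigenvalue equation is read at an entry of \<open>w\<close> of least
  valuation.\<close>

lemma vge_eigenvalue:
  fixes M :: "nat \<Rightarrow> nat \<Rightarrow> 'k :: field fls"
  assumes eig: "\<And>j. j < s \<Longrightarrow> (\<Sum>l<s. M j l * w l) = \<rho> * w j"
    and w: "\<exists>j<s. w j \<noteq> 0" and M: "\<And>j l. j < s \<Longrightarrow> l < s \<Longrightarrow> vge (M j l) B"
  shows "vge \<rho> B"
proof -
  let ?J = "{j. j < s \<and> w j \<noteq> 0}"
  have J: "finite ?J" "?J \<noteq> {}" using w by auto
  define j where "j = arg_min_on (\<lambda>j. fls_subdegree (w j)) ?J"
  have j: "j \<in> ?J" unfolding j_def by (rule arg_min_if_finite(1)[OF J])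
  have "vge (w l) (fls_subdegree (w j))" if "l < s" for l
    using arg_min_least[OF J, of l "\<lambda>j. fls_subdegree (w j)"] that unfolding vge_def j_def by auto
  then have "vge (\<rho> * w j) (B + fls_subdegree (w j))"
    using j by (subst eig[symmetric]) (auto intro!: vge_sum vge_mult M)
  then show ?thesis using j by (cases "\<rho> = 0") (auto simp: vge_def)
qed

subsection \<open>Polynomial functions in a subset of the coordinates\<close>

text \<open>The elements are functions on the whole ambient space and not on \<open>V\<close>, so
  that \<open>p = 0\<close> means the zero polynomial function; vanishing on \<open>V\<close> is a
  weaker statement unless the coordinates in \<open>T\<close> are independent.\<close>

inductive_set pf :: "nat set \<Rightarrow> ((nat \<Rightarrow> 'k :: field) \<Rightarrow> 'k) set" for T :: "nat set" where
  const: "(\<lambda>_. c) \<in> pf T"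
| coord: "i \<in> T \<Longrightarrow> (\<lambda>x. x i) \<in> pf T"
| add: "p \<in> pf T \<Longrightarrow> q \<in> pf T \<Longrightarrow> (\<lambda>x. p x + q x) \<in> pf T"
| mult: "p \<in> pf T \<Longrightarrow> q \<in> pf T \<Longrightarrow> (\<lambda>x. p x * q x) \<in> pf T"

lemma poly_funs_eq_pf: "poly_funs n = pf {..<n}"
proof (intro equalityI subsetI)
  show "p \<in> pf {..<n}" if "p \<in> poly_funs n" for p :: "(nat \<Rightarrow> 'k :: field) \<Rightarrow> 'k"
    using that by induction (auto intro: pf.intros)
  show "p \<in> poly_funs n" if "p \<in> pf {..<n}" for p :: "(nat \<Rightarrow> 'k :: field) \<Rightarrow> 'k"
    using that by induction (auto intro: poly_funs.intros)
qed

lemma pf_mono: "p \<in> pf S \<Longrightarrow> S \<subseteq> T \<Longrightarrow> p \<in> pf T"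
  by (induction rule: pf.induct) (auto intro: pf.intros)

lemma pf_uminus: "p \<in> pf T \<Longrightarrow> (\<lambda>x. - p x) \<in> pf T"
  using pf.mult[OF pf.const[of "- 1"]] by simp

lemma pf_diff: "p \<in> pf T \<Longrightarrow> q \<in> pf T \<Longrightarrow> (\<lambda>x. p x - q x) \<in> pf T"
  using pf.add[OF _ pf_uminus, of p T q] by simp

lemma pf_sum: "(\<And>i. i \<in> I \<Longrightarrow> p i \<in> pf T) \<Longrightarrow> (\<lambda>x. \<Sum>i\<in>I. p i x) \<in> pf T"
  by (induction I rule: infinite_finite_induct) (auto intro: pf.intros)

lemma pf_prod: "(\<And>i. i \<in> I \<Longrightarrow> p i \<in> pf T) \<Longrightarrow> (\<lambda>x. \<Prod>i\<in>I. p i x) \<in> pf T"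
  by (induction I rule: infinite_finite_induct) (auto intro: pf.intros)

lemma pf_power: "p \<in> pf T \<Longrightarrow> (\<lambda>x. p x ^ m) \<in> pf T"
  by (induction m) (auto intro: pf.intros)

lemma pf_zero: "0 \<in> pf T" "(\<lambda>_. 0) \<in> pf T"
  using pf.const[of 0] by (auto simp: zero_fun_def)

lemma pf_empty: "p \<in> pf {} \<Longrightarrow> \<exists>c. p = (\<lambda>_. c)"
  by (induction rule: pf.induct) auto

text \<open>Collects the powers of \<open>x j\<close>. The degree bound is uniform in
  \<open>x\<close>, so only finitely many coefficient functions are nonzero.\<close>

lemma pf_insert:
  assumes "p \<in> pf (insert j T)"
  shows "\<exists>F d. (\<forall>x. degree (F x) \<le> d) \<and> (\<forall>i. (\<lambda>x. coeff (F x) i) \<in> pf T) \<and> (\<forall>x. p x = poly (F x) (x j))"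
  using assms
proof (induction rule: pf.induct)
  case (const c)
  have "(\<lambda>x. coeff [:c:] i) \<in> pf T" for i by (rule pf.const)
  then show ?case by (intro exI[of _ "\<lambda>_. [:c:]"] exI[of _ 0]) auto
next
  case (coord i)
  show ?case
  proof (cases "i = j")
    case True
    have "(\<lambda>x. coeff [:0, 1:] i) \<in> pf T" for i by (rule pf.const)
    then show ?thesis using True by (intro exI[of _ "\<lambda>_. [:0, 1:]"] exI[of _ 1]) auto
  next
    case False
    then have "i \<in> T" using coord by simp
    have "(\<lambda>x. coeff [:x i:] m) \<in> pf T" for m
      using pf.coord[OF \<open>i \<in> T\<close>] by (cases m) (auto simp: pf_zero)
    then show ?thesis by (intro exI[of _ "\<lambda>x. [:x i:]"] exI[of _ 0]) auto
  qed
next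
  case (add p q)
  then obtain F d G e where F: "\<forall>x. degree (F x) \<le> d" "\<forall>i. (\<lambda>x. coeff (F x) i) \<in> pf T" "\<forall>x. p x = poly (F x) (x j)"
    and G: "\<forall>x. degree (G x) \<le> e" "\<forall>i. (\<lambda>x. coeff (G x) i) \<in> pf T" "\<forall>x. q x = poly (G x) (x j)"
    by blast
  have "degree (F x + G x) \<le> max d e" for x using F(1) G(1) by (meson degree_add_le max.coboundedI1 max.coboundedI2)
  moreover have "(\<lambda>x. coeff (F x + G x) i) \<in> pf T" for i using F(2) G(2) by (simp add: pf.add)
  ultimately show ?case using F(3) G(3) by (intro exI[of _ "\<lambda>x. F x + G x"] exI[of _ "max d e"]) auto
next
  case (mult p q)
  then obtain F d G e where F: "\<forall>x. degree (F x) \<le> d" "\<forall>i. (\<lambda>x. coeff (F x) i) \<in> pf T" "\<forall>x. p x = poly (F x) (x j)"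
    and G: "\<forall>x. degree (G x) \<le> e" "\<forall>i. (\<lambda>x. coeff (G x) i) \<in> pf T" "\<forall>x. q x = poly (G x) (x j)"
    by blast
  have "degree (F x * G x) \<le> d + e" for x using F(1) G(1) by (meson add_mono degree_mult_le order_trans)
  moreover have "(\<lambda>x. coeff (F x * G x) i) \<in> pf T" for i
    unfolding coeff_mult using F(2) G(2) by (intro pf_sum pf.mult) auto
  ultimately show ?case using F(3) G(3) by (intro exI[of _ "\<lambda>x. F x * G x"] exI[of _ "d + e"]) auto
qed

section \<open>Restriction to lines\<close>

text \<open>The line runs in the ambient space and may leave \<open>V\<close>; for this reason the
  places below are applied only to functions in \<open>pf T\<close>, whose coordinates are
  independent.\<close>

definition seg :: "(nat \<Rightarrow> 'k) \<Rightarrow> (nat \<Rightarrow> 'k) \<Rightarrow> 'k :: field \<Rightarrow> nat \<Rightarrow> 'k" where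
  "seg a b z = (\<lambda>i. a i + z * (b i - a i))"

lemma seg_0 [simp]: "seg a b 0 = a" and seg_1 [simp]: "seg a b 1 = b"
  by (auto simp: seg_def)

text \<open>The degree bound is quantified ahead of the line because later counts may not depend on
  its endpoints.\<close>

lemma pf_seg:
  fixes p :: "(nat \<Rightarrow> 'k :: field) \<Rightarrow> 'k"
  assumes "p \<in> pf T"
  shows "\<exists>d. \<forall>a b. \<exists>Q. degree Q \<le> d \<and> (\<forall>z. poly Q z = p (seg a b z))"
  using assms
proof (induction rule: pf.induct)
  case (const c)
  show ?case by (intro exI[of _ 0] allI exI[of _ "[:c:]"]) auto
next
  case (coord i)
  have "degree [:a i, b i - a i:] \<le> 1 \<and> (\<forall>z. poly [:a i, b i - a i:] z = seg a b z i)" for a b :: "nat \<Rightarrow> 'k"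
    by (auto simp: seg_def)
  then show ?case by blast
next
  case (add p q)
  then obtain d e where d: "\<forall>a b. \<exists>Q. degree Q \<le> d \<and> (\<forall>z. poly Q z = p (seg a b z))"
    and e: "\<forall>a b. \<exists>Q. degree Q \<le> e \<and> (\<forall>z. poly Q z = q (seg a b z))" by blast
  show ?case
  proof (intro exI[of _ "max d e"] allI)
    fix a b
    obtain P Q where "degree P \<le> d" "\<forall>z. poly P z = p (seg a b z)" "degree Q \<le> e" "\<forall>z. poly Q z = q (seg a b z)"
      using d e by blast
    then show "\<exists>Q. degree Q \<le> max d e \<and> (\<forall>z. poly Q z = p (seg a b z) + q (seg a b z))"
      by (intro exI[of _ "P + Q"]) (auto intro: degree_add_le)
  qed
next
  case (mult p q)
  then obtain d e where d: "\<forall>a b. \<exists>Q. degree Q \<le> d \<and> (\<forall>z. poly Q z = p (seg a b z))"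
    and e: "\<forall>a b. \<exists>Q. degree Q \<le> e \<and> (\<forall>z. poly Q z = q (seg a b z))" by blast
  show ?case
  proof (intro exI[of _ "d + e"] allI)
    fix a b
    obtain P Q where PQ: "degree P \<le> d" "\<forall>z. poly P z = p (seg a b z)" "degree Q \<le> e" "\<forall>z. poly Q z = q (seg a b z)"
      using d e by blast
    have "degree (P * Q) \<le> d + e" by (rule order_trans[OF degree_mult_le add_mono[OF PQ(1,3)]])
    then show "\<exists>Q. degree Q \<le> d + e \<and> (\<forall>z. poly Q z = p (seg a b z) * q (seg a b z))"
      using PQ by (intro exI[of _ "P * Q"]) simp
  qed
qed

definition on_seg :: "(nat \<Rightarrow> 'k) \<Rightarrow> (nat \<Rightarrow> 'k) \<Rightarrow> ((nat \<Rightarrow> 'k) \<Rightarrow> 'k :: field) \<Rightarrow> 'k poly" where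
  "on_seg a b p = (SOME Q. \<forall>z. poly Q z = p (seg a b z))"

lemma poly_on_seg: "p \<in> pf T \<Longrightarrow> poly (on_seg a b p) z = p (seg a b z)"
proof -
  assume "p \<in> pf T"
  then have "\<exists>Q. \<forall>z. poly Q z = p (seg a b z)" using pf_seg[of p T] by blast
  from someI_ex[OF this] show ?thesis unfolding on_seg_def by blast
qed

lemma on_seg_eqI:
  fixes p :: "(nat \<Rightarrow> 'k :: field_char_0) \<Rightarrow> 'k"
  assumes "p \<in> pf T" "\<And>z. poly Q z = p (seg a b z)"
  shows "on_seg a b p = Q"
proof -
  have "poly (on_seg a b p) = poly Q" using poly_on_seg[OF assms(1)] assms(2) by (intro ext) simp
  then show ?thesis by (simp only: poly_eq_poly_eq_iff)
qed

lemma on_seg_ring: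
  fixes p q :: "(nat \<Rightarrow> 'k :: field_char_0) \<Rightarrow> 'k"
  assumes "p \<in> pf T" "q \<in> pf T"
  shows "on_seg a b (\<lambda>x. p x + q x) = on_seg a b p + on_seg a b q"
    and "on_seg a b (\<lambda>x. p x * q x) = on_seg a b p * on_seg a b q"
  using assms by (auto intro!: on_seg_eqI[where T = T] pf.intros simp: poly_on_seg)

lemma on_seg_const: "on_seg a b (\<lambda>_. c) = [:c :: 'k :: field_char_0:]"
  by (rule on_seg_eqI[OF pf.const[of _ "{}"]]) simp

lemma degree_on_seg:
  fixes p :: "(nat \<Rightarrow> 'k :: field_char_0) \<Rightarrow> 'k"
  assumes "p \<in> pf T"
  shows "\<exists>d. \<forall>a b. degree (on_seg a b p) \<le> d"
proof -
  obtain d where d: "\<forall>a b. \<exists>Q. degree Q \<le> d \<and> (\<forall>z. poly Q z = p (seg a b z))"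
    using pf_seg[OF assms] by blast
  have "degree (on_seg a b p) \<le> d" for a b
  proof -
    obtain Q where "degree Q \<le> d" "\<forall>z. poly Q z = p (seg a b z)" using d by blast
    then show ?thesis using on_seg_eqI[OF assms, of Q a b] by simp
  qed
  then show ?thesis by blast
qed

subsection \<open>Irreducible closed subsets of a torus\<close>

text \<open>Only the coordinates below \<open>n\<close> of a point matter; \<open>V_closed\<close> says that \<open>V\<close> is closed in the torus.\<close>

locale torus_subset =
  fixes n :: nat and V :: "(nat \<Rightarrow> 'k :: {alg_closed_field, field_char_0}) set"
  assumes V_nonempty: "V \<noteq> {}"
    and V_torus: "\<And>x i. x \<in> V \<Longrightarrow> i < n \<Longrightarrow> x i \<noteq> 0"
    and V_closed: "\<And>x. x \<in> affine_points n \<Longrightarrow> (\<And>i. i < n \<Longrightarrow> x i \<noteq> 0) \<Longrightarrow>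
      (\<And>f. f \<in> pf {..<n} \<Longrightarrow> (\<And>y. y \<in> V \<Longrightarrow> f y = 0) \<Longrightarrow> f x = 0) \<Longrightarrow> x \<in> V"
    and V_irred: "\<And>p q. p \<in> pf {..<n} \<Longrightarrow> q \<in> pf {..<n} \<Longrightarrow> (\<And>x. x \<in> V \<Longrightarrow> p x * q x = 0) \<Longrightarrow>
      (\<forall>x\<in>V. p x = 0) \<or> (\<forall>x\<in>V. q x = 0)"
begin

text \<open>The relation \<open>q y * u y = p y\<close> is demanded on all of \<open>V\<close> and
  not only near \<open>x\<close>. A local fraction acquires it when both parts are multiplied by a
  polynomial that vanishes off the neighbourhood but not at \<open>x\<close>.\<close>

definition reg :: "((nat \<Rightarrow> 'k) \<Rightarrow> 'k) \<Rightarrow> bool" where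
  "reg u \<longleftrightarrow> (\<forall>x\<in>V. \<exists>p\<in>pf {..<n}. \<exists>q\<in>pf {..<n}. q x \<noteq> 0 \<and> (\<forall>y\<in>V. q y * u y = p y))"

lemma reg_pf: "p \<in> pf {..<n} \<Longrightarrow> reg p"
  unfolding reg_def
  by (intro ballI bexI[of _ p] bexI[of _ "\<lambda>_. 1"]) (auto intro: pf.const)

lemma regE:
  assumes "reg u" "x \<in> V"
  obtains p q where "p \<in> pf {..<n}" "q \<in> pf {..<n}" "q x \<noteq> 0" "\<forall>y\<in>V. q y * u y = p y"
proof -
  from bspec[OF assms(1)[unfolded reg_def] assms(2)] show ?thesis
    by (elim bexE conjE) (rule that)
qed

lemma regI:
  assumes "\<And>x. x \<in> V \<Longrightarrow> \<exists>p q. p \<in> pf {..<n} \<and> q \<in> pf {..<n} \<and> q x \<noteq> 0 \<and> (\<forall>y\<in>V. q y * u y = p y)"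
  shows "reg u"
  unfolding reg_def
proof
  fix x assume "x \<in> V"
  from assms[OF this] show "\<exists>p\<in>pf {..<n}. \<exists>q\<in>pf {..<n}. q x \<noteq> 0 \<and> (\<forall>y\<in>V. q y * u y = p y)"
    by (elim exE conjE) (intro bexI conjI)
qed

lemma reg_mult:
  assumes "reg u" "reg v" shows "reg (\<lambda>x. u x * v x)"
proof (rule regI)
  fix x assume x: "x \<in> V"
  obtain p q where pq: "p \<in> pf {..<n}" "q \<in> pf {..<n}" "q x \<noteq> 0" "\<forall>y\<in>V. q y * u y = p y"
    by (rule regE[OF assms(1) x])
  obtain p' q' where pq': "p' \<in> pf {..<n}" "q' \<in> pf {..<n}" "q' x \<noteq> 0" "\<forall>y\<in>V. q' y * v y = p' y"
    by (rule regE[OF assms(2) x])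
  have eq: "q y * q' y * (u y * v y) = p y * p' y" if "y \<in> V" for y
  proof -
    have "q y * q' y * (u y * v y) = (q y * u y) * (q' y * v y)" by (simp only: ac_simps)
    then show ?thesis using pq(4) pq'(4) that by simp
  qed
  show "\<exists>p q. p \<in> pf {..<n} \<and> q \<in> pf {..<n} \<and> q x \<noteq> 0 \<and> (\<forall>y\<in>V. q y * (u y * v y) = p y)"
    by (rule exI[of _ "\<lambda>y. p y * p' y"], rule exI[of _ "\<lambda>y. q y * q' y"])
      (use eq pq(3) pq'(3) pf.mult[OF pq(1) pq'(1)] pf.mult[OF pq(2) pq'(2)] in simp)
qed

lemma reg_inverse:
  assumes "reg u" "\<And>x. x \<in> V \<Longrightarrow> u x \<noteq> 0" shows "reg (\<lambda>x. inverse (u x))"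
proof (rule regI)
  fix x assume x: "x \<in> V"
  obtain p q where pq: "p \<in> pf {..<n}" "q \<in> pf {..<n}" "q x \<noteq> 0" "\<forall>y\<in>V. q y * u y = p y"
    by (rule regE[OF assms(1) x])
  have "p x \<noteq> 0" using assms(2)[OF x] pq(3) by (simp flip: bspec[OF pq(4) x])
  moreover have "p y * inverse (u y) = q y" if "y \<in> V" for y
    using assms(2)[OF that] by (simp flip: bspec[OF pq(4) that])
  ultimately show "\<exists>p q. p \<in> pf {..<n} \<and> q \<in> pf {..<n} \<and> q x \<noteq> 0 \<and> (\<forall>y\<in>V. q y * inverse (u y) = p y)"
    using pq(1,2) by (intro exI[of _ q] exI[of _ p]) simp
qed

text \<open>Once the denominator of \<open>u\<close> at \<open>x\<close> is cleared, irreducibility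
  applies to \<open>D\<close> and the numerator.\<close>

lemma reg_eq_0:
  assumes "reg u" "D \<in> pf {..<n}" "\<exists>x\<in>V. D x \<noteq> 0" "\<And>x. x \<in> V \<Longrightarrow> D x * u x = 0" "x \<in> V"
  shows "u x = 0"
proof -
  obtain p q where pq: "p \<in> pf {..<n}" "q \<in> pf {..<n}" "q x \<noteq> 0" "\<forall>y\<in>V. q y * u y = p y"
    by (rule regE[OF assms(1,5)])
  have "D y * p y = 0" if "y \<in> V" for y
    using assms(4)[OF that] by (auto simp flip: bspec[OF pq(4) that])
  then have "\<forall>x\<in>V. p x = 0" using V_irred[OF assms(2) pq(1)] assms(3) by blast
  then show ?thesis using pq(3,4) assms(5) by force
qed

text \<open>General position: irreducibility gives finitely many nonzero polynomial functions a
  common point of nonvanishing. This supplies the endpoints of the lines.\<close>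

lemma nonzero_prod:
  assumes "finite I" "\<And>i. i \<in> I \<Longrightarrow> p i \<in> pf {..<n}" "\<And>i. i \<in> I \<Longrightarrow> \<exists>x\<in>V. p i x \<noteq> 0"
  shows "\<exists>x\<in>V. \<forall>i\<in>I. p i x \<noteq> 0"
proof -
  have "\<exists>x\<in>V. (\<Prod>i\<in>I. p i x) \<noteq> 0" using assms
  proof (induction I rule: finite_induct)
    case empty
    then show ?case using V_nonempty by auto
  next
    case (insert i I)
    let ?q = "\<lambda>x. \<Prod>i\<in>I. p i x"
    have q: "?q \<in> pf {..<n}" using insert.prems(1) by (intro pf_prod) simp
    have "\<exists>x\<in>V. ?q x \<noteq> 0" using insert by (intro insert.IH) simp_all
    moreover have "\<exists>x\<in>V. p i x \<noteq> 0" using insert.prems(2) by simp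
    ultimately have "\<not> (\<forall>x\<in>V. p i x * ?q x = 0)"
      using V_irred[OF insert.prems(1)[OF insertI1] q] by blast
    then show ?case using insert.hyps by simp
  qed
  then show ?thesis using assms(1) by simp
qed

text \<open>\<open>T\<close> is a maximal set of coordinates without a polynomial relation on
  \<open>V\<close>. A relation for \<open>insert j T\<close>, sorted by powers of
  \<open>x j\<close>, is an algebraic equation for \<open>x j\<close>.\<close>

lemma transcendence_basis:
  "\<exists>T\<subseteq>{..<n}. (\<forall>p\<in>pf T. (\<forall>x\<in>V. p x = 0) \<longrightarrow> p = 0) \<and>
     (\<forall>j<n. \<exists>d c. (\<forall>i. c i \<in> pf T) \<and> d > 0 \<and> c d \<noteq> 0 \<and> (\<forall>x\<in>V. (\<Sum>i\<le>d. c i x * x j ^ i) = 0))"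
proof -
  define ind where "ind T \<longleftrightarrow> (\<forall>p\<in>pf T. (\<forall>x\<in>V. p x = 0) \<longrightarrow> p = 0)" for T
  have ind0: "ind {}" unfolding ind_def using V_nonempty pf_empty by (fastforce simp: zero_fun_def)
  have fin: "finite {T. T \<subseteq> {..<n} \<and> ind T}" by (rule finite_subset[of _ "Pow {..<n}"]) auto
  have "{T. T \<subseteq> {..<n} \<and> ind T} \<noteq> {}" using ind0 by blast
  from finite_has_maximal[OF fin this] obtain T where T: "T \<subseteq> {..<n}" "ind T"
    "\<forall>S\<in>{T. T \<subseteq> {..<n} \<and> ind T}. T \<subseteq> S \<longrightarrow> T = S" by blast
  have "\<exists>d c. (\<forall>i. c i \<in> pf T) \<and> d > 0 \<and> c d \<noteq> 0 \<and> (\<forall>x\<in>V. (\<Sum>i\<le>d. c i x * x j ^ i) = 0)" if j: "j < n" for j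
  proof (cases "j \<in> T")
    case True
    \<comment> \<open>For \<open>j\<close> in \<open>T\<close> the tautology
      \<open>x j - x j = 0\<close> is an equation of degree 1 with leading coefficient 1.\<close>
    define c :: "nat \<Rightarrow> (nat \<Rightarrow> 'k) \<Rightarrow> 'k" where
      "c i = (if i = 0 then (\<lambda>x. - x j) else if i = 1 then (\<lambda>_. 1) else (\<lambda>_. 0))" for i
    have "c i \<in> pf T" for i using True by (auto simp: c_def intro: pf.intros pf_uminus)
    then show ?thesis by (intro exI[of _ 1] exI[of _ c]) (auto simp: c_def fun_eq_iff)
  next
    case False
    then have "\<not> ind (insert j T)"
      using T(3)[rule_format, of "insert j T"] T(1) j by blast
    then obtain p where p: "p \<in> pf (insert j T)" "\<forall>x\<in>V. p x = 0" "p \<noteq> 0" unfolding ind_def by blast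
    obtain F d where F: "\<forall>x. degree (F x) \<le> d" "\<forall>i. (\<lambda>x. coeff (F x) i) \<in> pf T" "\<forall>x. p x = poly (F x) (x j)"
      using pf_insert[OF p(1)] by blast
    define c where "c i = (\<lambda>x. coeff (F x) i)" for i
    have px: "p x = (\<Sum>i\<le>d. c i x * x j ^ i)" for x
    proof -
      have "(\<Sum>i\<le>degree (F x). coeff (F x) i * x j ^ i) = (\<Sum>i\<le>d. coeff (F x) i * x j ^ i)"
        using F(1) by (intro sum.mono_neutral_left) (auto simp: coeff_eq_0)
      then show ?thesis using F(3) by (simp add: poly_altdef c_def)
    qed
    have c0: "c i = 0" if "i > d" for i
      using F(1) that by (intro ext) (auto simp: c_def intro!: coeff_eq_0 intro: le_less_trans)
    have "\<exists>i. c i \<noteq> 0"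
    proof (rule ccontr)
      assume "\<not> ?thesis"
      then have "p = 0" by (intro ext) (auto simp: px)
      then show False using p by simp
    qed
    moreover have "finite {i. c i \<noteq> 0}" by (rule finite_subset[of _ "{..d}"]) (use c0 not_le in auto)
    ultimately obtain e where e: "c e \<noteq> 0" "\<And>i. c i \<noteq> 0 \<Longrightarrow> i \<le> e"
      using Max_in[of "{i. c i \<noteq> 0}"] Max_ge[of "{i. c i \<noteq> 0}"] by blast
    have px': "p x = (\<Sum>i\<le>e. c i x * x j ^ i)" for x
    proof -
      have "i \<le> e" if "c i x \<noteq> 0" for i
      proof (rule e(2), rule notI)
        assume "c i = 0"
        then show False using that by simp
      qed
      moreover have "e \<le> d" using c0[of e] e(1) by (meson not_le)
      ultimately show ?thesis unfolding px by (intro sum.mono_neutral_right) auto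
    qed
    \<comment> \<open>Degree 0 in \<open>x j\<close> would leave a nonzero function in
      \<open>pf T\<close> that vanishes on \<open>V\<close>, against the independence of
      \<open>T\<close>.\<close>
    have "e \<noteq> 0"
    proof
      assume "e = 0"
      then have "p = c 0" using px' by auto
      then have "c 0 = 0" using T(2) p(2) F(2) unfolding ind_def c_def by metis
      then show False using e \<open>e = 0\<close> by simp
    qed
    moreover have "\<forall>i. c i \<in> pf T" using F(2) unfolding c_def by simp
    moreover have "\<forall>x\<in>V. (\<Sum>i\<le>e. c i x * x j ^ i) = 0"
    proof
      fix x assume "x \<in> V"
      then show "(\<Sum>i\<le>e. c i x * x j ^ i) = 0" using p(2) px'[of x] by simp
    qed
    ultimately show ?thesis using e(1) by (intro exI[of _ e] exI[of _ c]) simp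
  qed
  then show ?thesis using T(1,2) unfolding ind_def by blast
qed

end

text \<open>\<open>f\<close> is on \<open>V\<close> a linear combination of the \<open>b l\<close> over the fraction field of \<open>pf T\<close>, with common
  denominator \<open>D\<close>.\<close>

definition fspan :: "(nat \<Rightarrow> 'k :: field) set \<Rightarrow> nat set \<Rightarrow> 'i set \<Rightarrow> ('i \<Rightarrow> (nat \<Rightarrow> 'k) \<Rightarrow> 'k) \<Rightarrow> ((nat \<Rightarrow> 'k) \<Rightarrow> 'k) \<Rightarrow> bool" where
  "fspan V T I b f \<longleftrightarrow> (\<exists>D m. D \<in> pf T \<and> D \<noteq> 0 \<and> (\<forall>l\<in>I. m l \<in> pf T) \<and>
     (\<forall>x\<in>V. D x * f x = (\<Sum>l\<in>I. m l x * b l x)))"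

lemma fspanI:
  "D \<in> pf T \<Longrightarrow> D \<noteq> 0 \<Longrightarrow> (\<And>l. l \<in> I \<Longrightarrow> m l \<in> pf T) \<Longrightarrow>
    (\<And>x. x \<in> V \<Longrightarrow> D x * f x = (\<Sum>l\<in>I. m l x * b l x)) \<Longrightarrow> fspan V T I b f"
  unfolding fspan_def by (intro exI[of _ D] exI[of _ m]) simp

lemma fspanE:
  assumes "fspan V T I b f"
  obtains D m where "D \<in> pf T" "D \<noteq> 0" "\<forall>l\<in>I. m l \<in> pf T"
    "\<forall>x\<in>V. D x * f x = (\<Sum>l\<in>I. m l x * b l x)"
  using assms unfolding fspan_def by (elim exE conjE) (rule that)

section \<open>Linear algebra over the fraction field of the independent coordinates\<close>

locale torus_transcendence = torus_subset n V
  for n and V :: "(nat \<Rightarrow> 'k :: {alg_closed_field, field_char_0}) set" +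
  fixes T :: "nat set"
  assumes T_sub: "T \<subseteq> {..<n}"
    and T_indep: "\<And>p. p \<in> pf T \<Longrightarrow> (\<And>x. x \<in> V \<Longrightarrow> p x = 0) \<Longrightarrow> p = 0"
begin

lemma pf_T: "p \<in> pf T \<Longrightarrow> p \<in> pf {..<n}"
  by (rule pf_mono[OF _ T_sub])

lemma nonzero_on_V: "p \<in> pf T \<Longrightarrow> p \<noteq> 0 \<Longrightarrow> \<exists>x\<in>V. p x \<noteq> 0"
  using T_indep by blast

lemma pf_T_eqI:
  assumes "p \<in> pf T" "q \<in> pf T" "\<And>x. x \<in> V \<Longrightarrow> p x = q x"
  shows "p = q"
proof -
  have "(\<lambda>x. p x - q x) = 0" using assms by (intro T_indep pf_diff) simp_all
  then show ?thesis by (auto simp: fun_eq_iff)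
qed

text \<open>By independence a function in \<open>pf T\<close> is zero as soon as it vanishes on
  \<open>V\<close>, so irreducibility of \<open>V\<close> excludes zero divisors.\<close>

lemma pf_T_domain:
  fixes p q :: "(nat \<Rightarrow> 'k) \<Rightarrow> 'k"
  assumes "p \<in> pf T" "q \<in> pf T" "p \<noteq> 0" "q \<noteq> 0"
  shows "(\<lambda>x. p x * q x) \<noteq> 0"
proof
  assume "(\<lambda>x. p x * q x) = 0"
  then have "p x * q x = 0" for x by (metis zero_fun_apply)
  then have "(\<forall>x\<in>V. p x = 0) \<or> (\<forall>x\<in>V. q x = 0)"
    by (intro V_irred pf_T assms) simp
  then show False using nonzero_on_V assms by blast
qed

lemma pf_T_prod_nonzero:
  fixes p :: "'i \<Rightarrow> (nat \<Rightarrow> 'k) \<Rightarrow> 'k"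
  shows "finite I \<Longrightarrow> (\<And>i. i \<in> I \<Longrightarrow> p i \<in> pf T) \<Longrightarrow> (\<And>i. i \<in> I \<Longrightarrow> p i \<noteq> 0) \<Longrightarrow> (\<lambda>x. \<Prod>i\<in>I. p i x) \<noteq> 0"
proof (induction I rule: finite_induct)
  case empty
  then show ?case by (simp add: fun_eq_iff)
next
  case (insert i I)
  have "(\<lambda>x. p i x * (\<Prod>i\<in>I. p i x)) \<noteq> 0"
  proof (rule pf_T_domain)
    show "p i \<in> pf T" "p i \<noteq> 0" using insert.prems by blast+
    show "(\<lambda>x. \<Prod>i\<in>I. p i x) \<in> pf T" using insert.prems(1) by (intro pf_prod) blast
    show "(\<lambda>x. \<Prod>i\<in>I. p i x) \<noteq> 0" using insert.prems by (intro insert.IH) blast+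
  qed
  moreover have "(\<lambda>x. \<Prod>i\<in>insert i I. p i x) = (\<lambda>x. p i x * (\<Prod>i\<in>I. p i x))"
    using insert.hyps by simp
  ultimately show ?case by metis
qed

abbreviation "fsp \<equiv> fspan V T"

lemma fspan_cong: "fsp I b f \<Longrightarrow> (\<And>x. x \<in> V \<Longrightarrow> f x = g x) \<Longrightarrow> fsp I b g"
proof -
  assume f: "fsp I b f" and fg: "\<And>x. x \<in> V \<Longrightarrow> f x = g x"
  obtain D m where D: "D \<in> pf T" "D \<noteq> 0" "\<forall>l\<in>I. m l \<in> pf T"
    "\<forall>x\<in>V. D x * f x = (\<Sum>l\<in>I. m l x * b l x)" using f by (rule fspanE)
  show ?thesis by (rule fspanI[OF D(1,2), of _ m]) (use D(3,4) fg in simp_all)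
qed

lemma fspan_zero: "fsp I b (\<lambda>_. 0)"
  by (rule fspanI[of "\<lambda>_. 1" _ _ "\<lambda>_ _. 0"]) (simp_all add: pf.const fun_eq_iff)

lemma fspan_base:
  assumes "finite I" "i \<in> I" shows "fsp I b (b i)"
proof (rule fspanI[of "\<lambda>_. 1" _ _ "\<lambda>l _. if l = i then 1 else 0"])
  show "1 * b i x = (\<Sum>l\<in>I. (if l = i then 1 else 0) * b l x)" for x
  proof -
    have "(\<Sum>l\<in>I. (if l = i then 1 else 0) * b l x) = (\<Sum>l\<in>I. if l = i then b l x else 0)"
      by (intro sum.cong) auto
    then show ?thesis using assms by simp
  qed
qed (simp_all add: pf.const fun_eq_iff)

lemma fspan_mult:
  assumes "p \<in> pf T" "fsp I b f" shows "fsp I b (\<lambda>x. p x * f x)"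
proof -
  obtain D m where D: "D \<in> pf T" "D \<noteq> 0" "\<forall>l\<in>I. m l \<in> pf T"
    "\<forall>x\<in>V. D x * f x = (\<Sum>l\<in>I. m l x * b l x)" using assms(2) by (rule fspanE)
  show ?thesis
  proof (rule fspanI[OF D(1,2), of _ "\<lambda>l x. p x * m l x"])
    show "(\<lambda>x. p x * m l x) \<in> pf T" if "l \<in> I" for l using assms(1) D(3) that by (intro pf.mult) simp_all
    fix x assume "x \<in> V"
    have "D x * (p x * f x) = p x * (D x * f x)" by simp
    also have "\<dots> = (\<Sum>l\<in>I. p x * m l x * b l x)"
      using D(4) \<open>x \<in> V\<close> by (simp add: sum_distrib_left mult.assoc)
    finally show "D x * (p x * f x) = (\<Sum>l\<in>I. p x * m l x * b l x)" .
  qed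
qed

lemma fspan_div:
  assumes "p \<in> pf T" "p \<noteq> 0" "fsp I b (\<lambda>x. p x * f x)" shows "fsp I b f"
proof -
  obtain D m where D: "D \<in> pf T" "D \<noteq> 0" "\<forall>l\<in>I. m l \<in> pf T"
    "\<forall>x\<in>V. D x * (p x * f x) = (\<Sum>l\<in>I. m l x * b l x)" using assms(3) by (rule fspanE)
  show ?thesis
    by (rule fspanI[OF pf.mult[OF D(1) assms(1)] pf_T_domain[OF D(1) assms(1) D(2) assms(2)], of _ m])
      (use D in \<open>simp_all add: mult.assoc\<close>)
qed

lemma fspan_add:
  assumes "fsp I b f" "fsp I b g" shows "fsp I b (\<lambda>x. f x + g x)"
proof -
  obtain D m where D: "D \<in> pf T" "D \<noteq> 0" "\<forall>l\<in>I. m l \<in> pf T"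
    "\<forall>x\<in>V. D x * f x = (\<Sum>l\<in>I. m l x * b l x)" using assms(1) by (rule fspanE)
  obtain D' m' where D': "D' \<in> pf T" "D' \<noteq> 0" "\<forall>l\<in>I. m' l \<in> pf T"
    "\<forall>x\<in>V. D' x * g x = (\<Sum>l\<in>I. m' l x * b l x)" using assms(2) by (rule fspanE)
  show ?thesis
  proof (rule fspanI[OF pf.mult[OF D(1) D'(1)] pf_T_domain[OF D(1) D'(1) D(2) D'(2)], of _ "\<lambda>l x. D' x * m l x + D x * m' l x"])
    show "(\<lambda>x. D' x * m l x + D x * m' l x) \<in> pf T" if "l \<in> I" for l
      using D D' that by (intro pf.add pf.mult) simp_all
    fix x assume "x \<in> V"
    have "D x * D' x * (f x + g x) = D' x * (D x * f x) + D x * (D' x * g x)"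
      by (simp add: algebra_simps)
    also have "\<dots> = D' x * (\<Sum>l\<in>I. m l x * b l x) + D x * (\<Sum>l\<in>I. m' l x * b l x)"
      using D(4) D'(4) \<open>x \<in> V\<close> by simp
    finally show "D x * D' x * (f x + g x) = (\<Sum>l\<in>I. (D' x * m l x + D x * m' l x) * b l x)"
      by (simp add: sum_distrib_left sum.distrib algebra_simps)
  qed
qed

lemma fspan_sum:
  "(\<And>i. i \<in> J \<Longrightarrow> fsp I b (f i)) \<Longrightarrow> fsp I b (\<lambda>x. \<Sum>i\<in>J. f i x)"
  by (induction J rule: infinite_finite_induct) (simp_all add: fspan_zero fspan_add)

end

section \<open>A finite basis of the function field\<close>

text \<open>The function field is never constructed. A basis of it consists of polynomial functions
  \<open>b l\<close>, independent over \<open>pf T\<close> on \<open>V\<close>, whose span with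
  denominators is stable under multiplication by every coordinate.\<close>

locale torus_basis = torus_transcendence n V T
  for n and V :: "(nat \<Rightarrow> 'k :: {alg_closed_field, field_char_0}) set" and T +
  fixes s :: nat and b :: "nat \<Rightarrow> (nat \<Rightarrow> 'k) \<Rightarrow> 'k"
  assumes s_pos: "0 < s"
    and b_poly: "\<And>l. l < s \<Longrightarrow> b l \<in> pf {..<n}"
    and b_indep: "\<And>c l. (\<And>l. l < s \<Longrightarrow> c l \<in> pf T) \<Longrightarrow>
      (\<And>x. x \<in> V \<Longrightarrow> (\<Sum>l<s. c l x * b l x) = 0) \<Longrightarrow> l < s \<Longrightarrow> c l = 0"
    and b_coord: "\<And>i j. i < n \<Longrightarrow> j < s \<Longrightarrow> fspan V T {..<s} b (\<lambda>x. x i * b j x)"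

text \<open>The monomials whose exponents stay below the degrees \<open>d j\<close> of the algebraic
  equations span everything; a maximal independent family among them is the basis.\<close>

lemma (in torus_subset) torus_basis_exists: "\<exists>T s b. torus_basis n V T s b"
proof -
  obtain T where T: "T \<subseteq> {..<n}" "\<forall>p\<in>pf T. (\<forall>x\<in>V. p x = 0) \<longrightarrow> p = 0"
    and "\<forall>j<n. \<exists>d c. (\<forall>i. c i \<in> pf T) \<and> d > 0 \<and> c d \<noteq> 0 \<and> (\<forall>x\<in>V. (\<Sum>i\<le>d. c i x * x j ^ i) = 0)"
    using transcendence_basis by blast
  then have "\<forall>j\<in>{..<n}. \<exists>d c. (\<forall>i. c i \<in> pf T) \<and> d > 0 \<and> c d \<noteq> 0 \<and> (\<forall>x\<in>V. (\<Sum>i\<le>d. c i x * x j ^ i) = 0)"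
    by simp
  from bchoice[OF this] obtain d where "\<forall>j\<in>{..<n}. \<exists>c. (\<forall>i. c i \<in> pf T) \<and> d j > 0 \<and> c (d j) \<noteq> 0 \<and> (\<forall>x\<in>V. (\<Sum>i\<le>d j. c i x * x j ^ i) = 0)"
    by (elim exE)
  from bchoice[OF this] obtain c where c: "\<forall>j\<in>{..<n}. (\<forall>i. c j i \<in> pf T) \<and> d j > 0 \<and> c j (d j) \<noteq> 0 \<and> (\<forall>x\<in>V. (\<Sum>i\<le>d j. c j i x * x j ^ i) = 0)"
    by (elim exE)
  have dc: "\<And>j i. j < n \<Longrightarrow> c j i \<in> pf T" "\<And>j. j < n \<Longrightarrow> d j > 0" "\<And>j. j < n \<Longrightarrow> c j (d j) \<noteq> 0"
    "\<And>j x. j < n \<Longrightarrow> x \<in> V \<Longrightarrow> (\<Sum>i\<le>d j. c j i x * x j ^ i) = 0"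
    using c by simp_all
  interpret torus_transcendence n V T
    by unfold_locales (use T in auto)
  define E0 where "E0 = (\<Pi>\<^sub>E j\<in>{..<n}. {..<d j})"
  define mon where "mon e x = (\<Prod>j<n. x j ^ e j)" for e :: "nat \<Rightarrow> nat" and x :: "nat \<Rightarrow> 'k"
  have mon_pf: "mon e \<in> pf {..<n}" for e
    unfolding mon_def[abs_def] by (intro pf_prod pf_power pf.coord) simp
  have finE0: "finite E0" unfolding E0_def by (intro finite_PiE) auto
  define ind where "ind S \<longleftrightarrow> (\<forall>m. (\<forall>e\<in>S. m e \<in> pf T) \<longrightarrow> (\<forall>x\<in>V. (\<Sum>e\<in>S. m e x * mon e x) = 0) \<longrightarrow> (\<forall>e\<in>S. m e = 0))" for S
  have fin: "finite {S. S \<subseteq> E0 \<and> ind S}" by (rule finite_subset[of _ "Pow E0"]) (use finE0 in auto)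
  have "{S. S \<subseteq> E0 \<and> ind S} \<noteq> {}"
  proof -
    have "ind {}" unfolding ind_def by simp
    then show ?thesis by blast
  qed
  from finite_has_maximal[OF fin this] obtain S where S: "S \<subseteq> E0" "ind S"
    "\<forall>S'\<in>{S. S \<subseteq> E0 \<and> ind S}. S \<subseteq> S' \<longrightarrow> S = S'" by blast
  have finS: "finite S" using S(1) finE0 finite_subset by blast
  have mon_span: "fsp S mon (mon e)" if e: "e \<in> E0" for e
  proof (cases "e \<in> S")
    case True
    then show ?thesis by (rule fspan_base[OF finS])
  next
    case False
    then have "\<not> ind (insert e S)" using S(3)[rule_format, of "insert e S"] S(1) e by blast
    then obtain m where m: "\<forall>e\<in>insert e S. m e \<in> pf T" "\<forall>x\<in>V. (\<Sum>e\<in>insert e S. m e x * mon e x) = 0"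
      "\<not> (\<forall>e\<in>insert e S. m e = 0)" unfolding ind_def by blast
    have rel: "m e x * mon e x + (\<Sum>e\<in>S. m e x * mon e x) = 0" if "x \<in> V" for x
      using m(2) that False finS by simp
    have "m e \<noteq> 0"
    proof
      assume z: "m e = 0"
      then have "\<forall>x\<in>V. (\<Sum>e\<in>S. m e x * mon e x) = 0" using rel by simp
      moreover have "\<forall>e\<in>S. m e \<in> pf T" using m(1) by simp
      ultimately have "\<forall>e\<in>S. m e = 0" using S(2) unfolding ind_def by blast
      then show False using m(3) z by simp
    qed
    then show ?thesis
    proof (rule fspanI[where D = "m e" and m = "\<lambda>e x. - m e x", rotated])
      show "m e \<in> pf T" using m(1) by simp
      show "(\<lambda>x. - m l x) \<in> pf T" if "l \<in> S" for l using m(1) that by (intro pf_uminus) simp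
      show "m e x * mon e x = (\<Sum>e\<in>S. - m e x * mon e x)" if "x \<in> V" for x
        using rel[OF that] by (simp add: sum_negf eq_neg_iff_add_eq_0)
    qed
  qed
  have mon_coord: "fsp S mon (\<lambda>x. x i * mon e x)" if e: "e \<in> E0" and i: "i < n" for e i
  proof -
    have upd: "(\<Prod>j<n. x j ^ (e(i := k)) j) = x i ^ k * (\<Prod>j\<in>{..<n} - {i}. x j ^ e j)" for x :: "nat \<Rightarrow> 'k" and k
    proof -
      have "(\<Prod>j<n. x j ^ (e(i := k)) j) = x i ^ (e(i := k)) i * (\<Prod>j\<in>{..<n} - {i}. x j ^ (e(i := k)) j)"
        using i by (intro prod.remove) auto
      moreover have "(\<Prod>j\<in>{..<n} - {i}. x j ^ (e(i := k)) j) = (\<Prod>j\<in>{..<n} - {i}. x j ^ e j)"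
        by (intro prod.cong) auto
      ultimately show ?thesis by simp
    qed
    have mon_upd: "mon (e(i := k)) x = x i ^ k * (\<Prod>j\<in>{..<n} - {i}. x j ^ e j)" for x k
      unfolding mon_def by (rule upd)
    have x_mon: "x i * mon e x = mon (e(i := Suc (e i))) x" for x
      using mon_upd[of "e i" x] mon_upd[of "Suc (e i)" x] by simp
    have inE0: "e(i := k) \<in> E0" if "k < d i" for k
      using e that i unfolding E0_def by (auto simp: PiE_iff extensional_def)
    show ?thesis
    proof (cases "Suc (e i) < d i")
      case True
      show ?thesis by (rule fspan_cong[OF mon_span[OF inE0[OF True]]]) (simp add: x_mon)
    next
      case False
      moreover have "e i < d i" using PiE_mem[OF e[unfolded E0_def], of i] i by simp
      ultimately have di: "Suc (e i) = d i" by simp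
      \<comment> \<open>The raised exponent has left the box \<open>E0\<close>. The equation of
        \<open>x i\<close> replaces its \<open>d i\<close>-th power by lower ones, at the cost of
        the factor \<open>c i (d i)\<close>.\<close>
      have "fsp S mon (\<lambda>x. \<Sum>k<d i. (- c i k x) * mon (e(i := k)) x)"
        using inE0 dc(1)[OF i] by (intro fspan_sum fspan_mult pf_uminus mon_span) auto
      then have "fsp S mon (\<lambda>x. c i (d i) x * (x i * mon e x))"
      proof (rule fspan_cong)
        fix x assume x: "x \<in> V"
        have "c i (d i) x * x i ^ d i = - (\<Sum>k<d i. c i k x * x i ^ k)"
          using dc(4)[OF i x] by (simp add: lessThan_Suc_atMost[symmetric] eq_neg_iff_add_eq_0 add.commute)
        then have "c i (d i) x * (x i * mon e x) = - (\<Sum>k<d i. c i k x * x i ^ k) * (\<Prod>j\<in>{..<n} - {i}. x j ^ e j)"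
          unfolding x_mon mon_upd di by (simp add: mult.assoc[symmetric])
        also have "\<dots> = (\<Sum>k<d i. (- c i k x) * mon (e(i := k)) x)"
          unfolding mon_upd by (simp add: sum_distrib_right sum_negf mult.assoc)
        finally show "(\<Sum>k<d i. (- c i k x) * mon (e(i := k)) x) = c i (d i) x * (x i * mon e x)" by simp
      qed
      then show ?thesis by (rule fspan_div[OF dc(1)[OF i] dc(3)[OF i]])
    qed
  qed
  define s where "s = card S"
  obtain h where h: "bij_betw h {..<s} S" unfolding s_def
    using ex_bij_betw_nat_finite[OF finS] by (auto simp: atLeast0LessThan)
  define b where "b l = mon (h l)" for l
  have reidx: "(\<Sum>e\<in>S. m e x * mon e x) = (\<Sum>l<s. m (h l) x * b l x)" for m x
    unfolding b_def by (rule sum.reindex_bij_betw[OF h, symmetric])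
  have span_b: "fsp {..<s} b f" if f: "fsp S mon f" for f
  proof -
    obtain D m where D: "D \<in> pf T" "D \<noteq> 0" "\<forall>l\<in>S. m l \<in> pf T"
      "\<forall>x\<in>V. D x * f x = (\<Sum>l\<in>S. m l x * mon l x)" using f by (rule fspanE)
    show ?thesis
      by (rule fspanI[OF D(1,2), of _ "\<lambda>l. m (h l)"])
        (use D(3,4) bij_betwE[OF h] in \<open>simp_all add: reidx\<close>)
  qed
  \<comment> \<open>The constant monomial belongs to the span, which would be zero for an empty
    family.\<close>
  have "S \<noteq> {}"
  proof
    assume "S = {}"
    have "(\<lambda>j\<in>{..<n}. 0) \<in> E0" unfolding E0_def using dc(2) by auto
    from mon_span[OF this] \<open>S = {}\<close> obtain D where D: "D \<in> pf T" "D \<noteq> 0"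
      "\<forall>x\<in>V. D x * mon (\<lambda>j\<in>{..<n}. 0) x = 0" by (auto elim: fspanE)
    have "mon (\<lambda>j\<in>{..<n}. 0) x = 1" for x unfolding mon_def by (intro prod.neutral) simp
    then have "\<forall>x\<in>V. D x = 0" using D(3) by simp
    then show False using nonzero_on_V[OF D(1,2)] by blast
  qed
  have "torus_basis n V T s b"
  proof unfold_locales
    show "0 < s" using \<open>S \<noteq> {}\<close> finS by (simp add: s_def card_gt_0_iff)
    show "b l \<in> pf {..<n}" for l unfolding b_def by (rule mon_pf)
    show "fsp {..<s} b (\<lambda>x. x i * b j x)" if "i < n" "j < s" for i j
      using that bij_betwE[OF h] S(1) unfolding b_def[of j] by (intro span_b mon_coord) auto
  next
    fix c :: "nat \<Rightarrow> (nat \<Rightarrow> 'k) \<Rightarrow> 'k" and l :: nat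
    assume c: "\<And>l. l < s \<Longrightarrow> c l \<in> pf T" "\<And>x. x \<in> V \<Longrightarrow> (\<Sum>l<s. c l x * b l x) = 0" and l: "l < s"
    define m where "m e = c (inv_into {..<s} h e)" for e
    have mh: "m (h l) = c l" if "l < s" for l
      using h that by (simp add: m_def bij_betw_def)
    have mS: "\<forall>e\<in>S. m e \<in> pf T"
    proof
      fix e assume "e \<in> S"
      then obtain l where "l < s" "e = h l" using h unfolding bij_betw_def by auto
      then show "m e \<in> pf T" using mh c(1) by simp
    qed
    have "\<forall>x\<in>V. (\<Sum>e\<in>S. m e x * mon e x) = 0"
    proof
      fix x assume "x \<in> V"
      have "(\<Sum>e\<in>S. m e x * mon e x) = (\<Sum>l<s. c l x * b l x)"
        unfolding reidx by (intro sum.cong) (simp_all add: mh)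
      then show "(\<Sum>e\<in>S. m e x * mon e x) = 0" using c(2)[OF \<open>x \<in> V\<close>] by simp
    qed
    then have "\<forall>e\<in>S. m e = 0" using S(2) mS unfolding ind_def by blast
    then show "c l = 0" using mh[OF l] bij_betwE[OF h] l by auto
  qed
  then show ?thesis by blast
qed

context torus_basis
begin

text \<open>Multiplication by \<open>f\<close> preserves the span of the basis \<open>b\<close> of the function field over the
  rational functions in the coordinates of \<open>T\<close>.\<close>

definition ok :: "((nat \<Rightarrow> 'k) \<Rightarrow> 'k) \<Rightarrow> bool" where
  "ok f \<longleftrightarrow> (\<forall>j<s. fsp {..<s} b (\<lambda>x. f x * b j x))"

lemma ok_cong:
  assumes "ok f" "\<And>x. x \<in> V \<Longrightarrow> f x = g x" shows "ok g"
  unfolding ok_def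
proof (intro allI impI)
  fix j assume "j < s"
  then have "fsp {..<s} b (\<lambda>x. f x * b j x)" using assms(1) by (simp add: ok_def)
  then show "fsp {..<s} b (\<lambda>x. g x * b j x)" by (rule fspan_cong) (simp add: assms(2))
qed

lemma ok_fspan:
  assumes "ok f" "fsp {..<s} b g" shows "fsp {..<s} b (\<lambda>x. f x * g x)"
proof -
  obtain D m where D: "D \<in> pf T" "D \<noteq> 0" "\<forall>l\<in>{..<s}. m l \<in> pf T"
    "\<forall>x\<in>V. D x * g x = (\<Sum>l\<in>{..<s}. m l x * b l x)" using assms(2) by (rule fspanE)
  have "fsp {..<s} b (\<lambda>x. \<Sum>l\<in>{..<s}. m l x * (f x * b l x))"
    by (rule fspan_sum, rule fspan_mult) (use D(3) assms(1) in \<open>simp_all add: ok_def\<close>)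
  then have "fsp {..<s} b (\<lambda>x. D x * (f x * g x))"
  proof (rule fspan_cong)
    fix x assume "x \<in> V"
    have "(\<Sum>l\<in>{..<s}. m l x * (f x * b l x)) = f x * (\<Sum>l\<in>{..<s}. m l x * b l x)"
      by (simp add: sum_distrib_left mult.left_commute)
    then show "(\<Sum>l\<in>{..<s}. m l x * (f x * b l x)) = D x * (f x * g x)"
      using D(4) \<open>x \<in> V\<close> by (simp add: mult.left_commute)
  qed
  then show ?thesis by (rule fspan_div[OF D(1,2)])
qed

lemma ok_mult: "ok f \<Longrightarrow> ok g \<Longrightarrow> ok (\<lambda>x. f x * g x)"
  unfolding ok_def[of "\<lambda>x. f x * g x"] mult.assoc
  by (intro allI impI, rule ok_fspan) (simp_all add: ok_def)

lemma ok_add: "ok f \<Longrightarrow> ok g \<Longrightarrow> ok (\<lambda>x. f x + g x)"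
  unfolding ok_def by (simp add: distrib_right fspan_add)

lemma ok_pf_T: "p \<in> pf T \<Longrightarrow> ok p"
  unfolding ok_def by (intro allI impI fspan_mult fspan_base) simp_all

lemma ok_div:
  assumes "p \<in> pf T" "p \<noteq> 0" "ok (\<lambda>x. p x * f x)" shows "ok f"
  unfolding ok_def
proof (intro allI impI)
  fix j assume "j < s"
  then have "fsp {..<s} b (\<lambda>x. p x * (f x * b j x))" using assms(3) by (simp add: ok_def mult.assoc)
  then show "fsp {..<s} b (\<lambda>x. f x * b j x)" by (rule fspan_div[OF assms(1,2)])
qed

lemma ok_pf: "p \<in> pf {..<n} \<Longrightarrow> ok p"
proof (induction rule: pf.induct)
  case (const c)
  then show ?case by (rule ok_pf_T[OF pf.const])
next
  case (coord i)
  then show ?case by (simp add: ok_def b_coord)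
qed (simp_all add: ok_add ok_mult)

lemma b0_nonzero: "\<exists>x\<in>V. b 0 x \<noteq> 0"
proof (rule ccontr)
  assume b0: "\<not> ?thesis"
  define c1 :: "nat \<Rightarrow> (nat \<Rightarrow> 'k) \<Rightarrow> 'k" where "c1 l = (if l = 0 then \<lambda>_. 1 else (\<lambda>_. 0))" for l
  have "c1 0 = 0"
  proof (rule b_indep[OF _ _ s_pos])
    show "c1 l \<in> pf T" for l by (simp add: c1_def pf.const)
    show "(\<Sum>l<s. c1 l x * b l x) = 0" if "x \<in> V" for x
      using b0 that by (intro sum.neutral) (auto simp: c1_def)
  qed
  moreover have "c1 0 x = 1" for x by (simp add: c1_def)
  ultimately show False by (metis zero_fun_apply zero_neq_one)
qed

text \<open>The linear dependence of \<open>s + 1\<close> powers of \<open>q\<close> gives an algebraic equation for \<open>q\<close>,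
  whose lowest coefficient is the multiple of \<open>q\<close>.\<close>

lemma pf_norm:
  assumes q: "q \<in> pf {..<n}" "\<exists>x\<in>V. q x \<noteq> 0"
  shows "\<exists>q' D. q' \<in> pf {..<n} \<and> D \<in> pf T \<and> D \<noteq> 0 \<and> (\<forall>x\<in>V. q x * q' x = D x)"
proof -
  \<comment> \<open>The powers of \<open>q\<close> multiply \<open>b 0\<close>, which stands in for
    1, since 1 need not be a basis element; irreducibility cancels \<open>b 0\<close> later.\<close>
  have "\<forall>i. fsp {..<s} b (\<lambda>x. q x ^ i * b 0 x)"
    using ok_pf[OF pf_power[OF q(1)]] s_pos by (simp add: ok_def)
  from choice[OF this[unfolded fspan_def]] obtain D where "\<forall>i. \<exists>m. D i \<in> pf T \<and> D i \<noteq> 0 \<and> (\<forall>l\<in>{..<s}. m l \<in> pf T) \<and>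
     (\<forall>x\<in>V. D i x * (q x ^ i * b 0 x) = (\<Sum>l\<in>{..<s}. m l x * b l x))" by (elim exE)
  from choice[OF this] obtain m where Dm: "\<forall>i. D i \<in> pf T \<and> D i \<noteq> 0 \<and> (\<forall>l\<in>{..<s}. m i l \<in> pf T) \<and>
     (\<forall>x\<in>V. D i x * (q x ^ i * b 0 x) = (\<Sum>l\<in>{..<s}. m i l x * b l x))" by (elim exE)
  have D: "\<And>i. D i \<in> pf T" "\<And>i. D i \<noteq> 0" "\<And>i l. l < s \<Longrightarrow> m i l \<in> pf T"
    "\<And>i x. x \<in> V \<Longrightarrow> D i x * (q x ^ i * b 0 x) = (\<Sum>l<s. m i l x * b l x)"
    using Dm by simp_all
  have "\<exists>c. (\<forall>i\<in>{..s}. c i \<in> pf T) \<and> (\<exists>i\<in>{..s}. c i \<noteq> 0) \<and> (\<forall>j<s. (\<Sum>i\<in>{..s}. c i * m i j) = 0)"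
  proof (rule linear_dependence[where e = "\<lambda>_. 1"])
    show "p * p' = 0 \<Longrightarrow> p = 0 \<or> p' = 0" if "p \<in> pf T" "p' \<in> pf T" for p p' :: "(nat \<Rightarrow> 'k) \<Rightarrow> 'k"
      using pf_T_domain[OF that] by (auto simp: times_fun_def)
  qed (use D(3) in \<open>simp_all add: pf_zero pf.const plus_fun_def times_fun_def fun_Compl_def pf.add pf.mult pf_uminus fun_eq_iff\<close>)
  then obtain c where c: "\<And>i. i \<le> s \<Longrightarrow> c i \<in> pf T" "\<exists>i\<le>s. c i \<noteq> 0" "\<And>j. j < s \<Longrightarrow> (\<Sum>i\<le>s. c i * m i j) = 0"
    by auto
  define e where "e i = (\<lambda>x. c i x * D i x)" for i
  have e_pf: "e i \<in> pf T" if "i \<le> s" for i unfolding e_def using c(1) D(1) that by (intro pf.mult) simp_all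
  have rel0: "(\<Sum>i\<le>s. e i x * q x ^ i) * b 0 x = 0" if x: "x \<in> V" for x
  proof -
    have "(\<Sum>i\<le>s. e i x * q x ^ i) * b 0 x = (\<Sum>i\<le>s. c i x * (\<Sum>l<s. m i l x * b l x))"
      unfolding sum_distrib_right by (intro sum.cong refl) (simp add: e_def mult.assoc flip: D(4)[OF x])
    also have "\<dots> = (\<Sum>l<s. (\<Sum>i\<le>s. c i x * m i l x) * b l x)"
      unfolding sum_distrib_left sum_distrib_right by (subst sum.swap) (simp add: mult.assoc)
    also have "\<dots> = 0"
    proof (rule sum.neutral, rule ballI)
      fix l assume "l \<in> {..<s}"
      then have "(\<Sum>i\<le>s. c i * m i l) x = 0" using c(3) by simp
      moreover have "(\<Sum>i\<in>I. c i * m i l) x = (\<Sum>i\<in>I. c i x * m i l x)" for I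
        by (induction I rule: infinite_finite_induct) simp_all
      ultimately show "(\<Sum>i\<le>s. c i x * m i l x) * b l x = 0" by simp
    qed
    finally show ?thesis .
  qed
  note b0 = b0_nonzero
  have rel: "(\<Sum>i\<le>s. e i x * q x ^ i) = 0" if "x \<in> V" for x
  proof -
    have "(\<lambda>x. \<Sum>i\<le>s. e i x * q x ^ i) \<in> pf {..<n}"
      by (intro pf_sum pf.mult[OF pf_T[OF e_pf] pf_power[OF q(1)]]) simp
    from V_irred[OF this b_poly[OF s_pos]] rel0 b0 that show ?thesis by blast
  qed
  obtain i1 where "i1 \<le> s" "c i1 \<noteq> 0" using c(2) by blast
  then have ne: "e i1 \<noteq> 0" unfolding e_def using c(1) D(1,2) by (intro pf_T_domain) simp_all
  \<comment> \<open>Cancelling the \<open>i0\<close>-th power of \<open>q\<close>, again by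
    irreducibility, leaves a relation with nonzero constant term \<open>e i0\<close>.\<close>
  define i0 where "i0 = (LEAST i. e i \<noteq> 0)"
  have i0: "e i0 \<noteq> 0" "i0 \<le> i1" using LeastI[of "\<lambda>i. e i \<noteq> 0", OF ne] Least_le[of "\<lambda>i. e i \<noteq> 0", OF ne] by (auto simp: i0_def)
  have i0s: "i0 \<le> s" using i0(2) \<open>i1 \<le> s\<close> by simp
  have e0: "e i = 0" if "i < i0" for i using not_less_Least[of i "\<lambda>i. e i \<noteq> 0"] that by (auto simp: i0_def)
  define g where "g x = (\<Sum>i\<in>{Suc i0..s}. e i x * q x ^ (i - Suc i0))" for x
  have g_pf: "g \<in> pf {..<n}" unfolding g_def[abs_def]
    by (intro pf_sum pf.mult[OF pf_T[OF e_pf] pf_power[OF q(1)]]) simp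
  have split: "(\<Sum>i\<le>s. e i x * q x ^ i) = q x ^ i0 * (e i0 x + q x * g x)" for x
  proof -
    have "(\<Sum>i\<le>s. e i x * q x ^ i) = (\<Sum>i\<in>{i0..s}. e i x * q x ^ i)"
      by (rule sum.mono_neutral_right) (use e0 in \<open>auto simp: not_le\<close>)
    also have "\<dots> = e i0 x * q x ^ i0 + (\<Sum>i\<in>{Suc i0..s}. e i x * q x ^ i)"
      using i0s by (simp add: sum.atLeast_Suc_atMost)
    also have "(\<Sum>i\<in>{Suc i0..s}. e i x * q x ^ i) = q x ^ i0 * (q x * g x)"
      unfolding g_def sum_distrib_left
    proof (intro sum.cong refl)
      fix i assume "i \<in> {Suc i0..s}"
      then have "q x ^ i = q x ^ i0 * (q x * q x ^ (i - Suc i0))"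
        by (simp flip: power_add power_Suc)
      then show "e i x * q x ^ i = q x ^ i0 * (q x * (e i x * q x ^ (i - Suc i0)))" by simp
    qed
    finally show ?thesis by (simp add: algebra_simps)
  qed
  have "q x ^ i0 * (e i0 x + q x * g x) = 0" if "x \<in> V" for x
    using rel[OF that] unfolding split .
  then have "(\<forall>x\<in>V. q x ^ i0 = 0) \<or> (\<forall>x\<in>V. e i0 x + q x * g x = 0)"
    by (rule V_irred[OF pf_power[OF q(1)] pf.add[OF pf_T[OF e_pf[OF i0s]] pf.mult[OF q(1) g_pf]]])
  then have "\<forall>x\<in>V. e i0 x + q x * g x = 0" using q(2) by force
  then have "\<forall>x\<in>V. q x * - g x = e i0 x" by (simp add: eq_neg_iff_add_eq_0[symmetric])
  then show ?thesis using pf_uminus[OF g_pf] e_pf[OF i0s] i0(1) by blast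
qed

text \<open>The fraction of \<open>u\<close> at one single point suffices, as it is valid on all of
  \<open>V\<close>; \<open>pf_norm\<close> turns its denominator into a function of the coordinates
  in \<open>T\<close>.\<close>

lemma reg_over_T:
  assumes "reg u"
  shows "\<exists>D p. D \<in> pf T \<and> D \<noteq> 0 \<and> p \<in> pf {..<n} \<and> (\<forall>x\<in>V. D x * u x = p x)"
proof -
  obtain x where x: "x \<in> V" using V_nonempty by blast
  obtain p q where pq: "p \<in> pf {..<n}" "q \<in> pf {..<n}" "q x \<noteq> 0" "\<forall>y\<in>V. q y * u y = p y"
    by (rule regE[OF assms x])
  obtain q' D where q': "q' \<in> pf {..<n}" "D \<in> pf T" "D \<noteq> 0" "\<forall>x\<in>V. q x * q' x = D x"
    using pf_norm[OF pq(2)] pq(3) x by blast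
  have "D x * u x = q' x * p x" if "x \<in> V" for x
    using that by (simp flip: bspec[OF q'(4)] bspec[OF pq(4)])
  then show ?thesis using q'(2,3) pf.mult[OF q'(1) pq(1)] by blast
qed

lemma ok_reg:
  assumes "reg u" shows "ok u"
proof -
  obtain D p where D: "D \<in> pf T" "D \<noteq> 0" "p \<in> pf {..<n}" "\<forall>x\<in>V. D x * u x = p x"
    using reg_over_T[OF assms] by blast
  have "ok (\<lambda>x. D x * u x)" by (rule ok_cong[OF ok_pf[OF D(3)]]) (use D(4) in simp)
  then show ?thesis by (rule ok_div[OF D(1,2)])
qed

end

section \<open>Multiplication matrices and their specialisation\<close>

context torus_basis
begin

text \<open>\<open>m / D\<close> is the matrix of multiplication by \<open>f\<close> with respect to the basis \<open>b\<close>.\<close>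

definition rep :: "((nat \<Rightarrow> 'k) \<Rightarrow> 'k) \<Rightarrow> (nat \<Rightarrow> nat \<Rightarrow> (nat \<Rightarrow> 'k) \<Rightarrow> 'k) \<Rightarrow> ((nat \<Rightarrow> 'k) \<Rightarrow> 'k) \<Rightarrow> bool" where
  "rep D m f \<longleftrightarrow> D \<in> pf T \<and> D \<noteq> 0 \<and> (\<forall>j<s. \<forall>l<s. m j l \<in> pf T) \<and>
     (\<forall>j<s. \<forall>x\<in>V. D x * (f x * b j x) = (\<Sum>l<s. m j l x * b l x))"

lemma repD:
  assumes "rep D m f"
  shows "D \<in> pf T" "D \<noteq> 0" "\<And>j l. j < s \<Longrightarrow> l < s \<Longrightarrow> m j l \<in> pf T"
    "\<And>j x. j < s \<Longrightarrow> x \<in> V \<Longrightarrow> D x * (f x * b j x) = (\<Sum>l<s. m j l x * b l x)"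
  using assms unfolding rep_def by blast+

lemma repI:
  assumes "D \<in> pf T" "D \<noteq> 0" "\<And>j l. j < s \<Longrightarrow> l < s \<Longrightarrow> m j l \<in> pf T"
    "\<And>j x. j < s \<Longrightarrow> x \<in> V \<Longrightarrow> D x * (f x * b j x) = (\<Sum>l<s. m j l x * b l x)"
  shows "rep D m f"
  using assms unfolding rep_def by blast

lemma ok_rep:
  assumes "ok f" shows "\<exists>D m. rep D m f"
proof -
  have "\<forall>j\<in>{..<s}. fsp {..<s} b (\<lambda>x. f x * b j x)" using assms by (simp add: ok_def)
  from bchoice[OF this[unfolded fspan_def]] obtain D where
    "\<forall>j\<in>{..<s}. \<exists>m. D j \<in> pf T \<and> D j \<noteq> 0 \<and> (\<forall>l\<in>{..<s}. m l \<in> pf T) \<and>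
     (\<forall>x\<in>V. D j x * (f x * b j x) = (\<Sum>l\<in>{..<s}. m l x * b l x))" by (elim exE)
  from bchoice[OF this] obtain m where
    Dm: "\<forall>j\<in>{..<s}. D j \<in> pf T \<and> D j \<noteq> 0 \<and> (\<forall>l\<in>{..<s}. m j l \<in> pf T) \<and>
     (\<forall>x\<in>V. D j x * (f x * b j x) = (\<Sum>l\<in>{..<s}. m j l x * b l x))" by (elim exE)
  have "rep (\<lambda>x. \<Prod>j<s. D j x) (\<lambda>j l x. (\<Prod>i\<in>{..<s} - {j}. D i x) * m j l x) f"
  proof (rule repI)
    show "(\<lambda>x. \<Prod>j<s. D j x) \<in> pf T" by (rule pf_prod) (use Dm in blast)
    show "(\<lambda>x. \<Prod>j<s. D j x) \<noteq> 0" by (rule pf_T_prod_nonzero) (use Dm in auto)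
    show "(\<lambda>x. (\<Prod>i\<in>{..<s} - {j}. D i x) * m j l x) \<in> pf T" if "j < s" "l < s" for j l
      by (rule pf.mult, rule pf_prod) (use Dm that in auto)
    fix j x assume j: "j < s" and x: "x \<in> V"
    have "(\<Prod>j<s. D j x) = D j x * (\<Prod>i\<in>{..<s} - {j}. D i x)" using j by (intro prod.remove) auto
    then have "(\<Prod>j<s. D j x) * (f x * b j x) = (\<Prod>i\<in>{..<s} - {j}. D i x) * (D j x * (f x * b j x))"
      by (simp add: ac_simps)
    also have "\<dots> = (\<Sum>l<s. (\<Prod>i\<in>{..<s} - {j}. D i x) * m j l x * b l x)"
      using Dm j x by (simp add: sum_distrib_left mult.assoc)
    finally show "(\<Prod>j<s. D j x) * (f x * b j x) = (\<Sum>l<s. (\<Prod>i\<in>{..<s} - {j}. D i x) * m j l x * b l x)" .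
  qed
  then show ?thesis by blast
qed

lemma rep_unique:
  assumes R: "rep D m f" and R': "rep D' m' g" and fg: "\<And>x. x \<in> V \<Longrightarrow> f x = g x" and jl: "j < s" "l < s"
  shows "(\<lambda>x. D' x * m j l x) = (\<lambda>x. D x * m' j l x)"
proof -
  have "(\<lambda>l x. D' x * m j l x - D x * m' j l x) l = 0"
  proof (rule b_indep[OF _ _ jl(2)])
    show "(\<lambda>x. D' x * m j l x - D x * m' j l x) \<in> pf T" if "l < s" for l
      using repD[OF R] repD[OF R'] that jl(1) by (intro pf_diff pf.mult) simp_all
    fix x assume x: "x \<in> V"
    have "(\<Sum>l<s. (D' x * m j l x - D x * m' j l x) * b l x) =
        D' x * (\<Sum>l<s. m j l x * b l x) - D x * (\<Sum>l<s. m' j l x * b l x)"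
      by (simp add: left_diff_distrib sum_subtractf sum_distrib_left mult.assoc)
    also have "\<dots> = 0"
      using x by (simp add: repD(4)[OF R jl(1), symmetric] repD(4)[OF R' jl(1), symmetric] fg)
    finally show "(\<Sum>l<s. (D' x * m j l x - D x * m' j l x) * b l x) = 0" .
  qed
  then have "D' x * m j l x - D x * m' j l x = 0" for x by (metis zero_fun_apply)
  then show ?thesis by auto
qed

lemma rep_pf_T:
  assumes "p \<in> pf T" shows "rep (\<lambda>_. 1) (\<lambda>j l. if j = l then p else (\<lambda>_. 0)) p"
proof (rule repI)
  show "(\<lambda>_. 1) \<noteq> (0 :: (nat \<Rightarrow> 'k) \<Rightarrow> 'k)" by (simp add: fun_eq_iff)
  fix j :: nat and x :: "nat \<Rightarrow> 'k" assume j: "j < s"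
  have "(\<Sum>l<s. (if j = l then p else (\<lambda>_. 0)) x * b l x) = (\<Sum>l<s. if j = l then p x * b l x else 0)"
    by (intro sum.cong) auto
  then show "1 * (p x * b j x) = (\<Sum>l<s. (if j = l then p else (\<lambda>_. 0)) x * b l x)" using j by simp
qed (simp_all add: assms pf.const pf_zero)

lemma rep_add:
  assumes R: "rep D m f" and R': "rep D' m' g"
  shows "rep (\<lambda>x. D x * D' x) (\<lambda>j l x. D' x * m j l x + D x * m' j l x) (\<lambda>x. f x + g x)"
proof (rule repI)
  show "(\<lambda>x. D x * D' x) \<in> pf T" by (rule pf.mult[OF repD(1)[OF R] repD(1)[OF R']])
  show "(\<lambda>x. D x * D' x) \<noteq> 0" by (rule pf_T_domain[OF repD(1)[OF R] repD(1)[OF R'] repD(2)[OF R] repD(2)[OF R']])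
  show "(\<lambda>x. D' x * m j l x + D x * m' j l x) \<in> pf T" if "j < s" "l < s" for j l
    using repD(1,3)[OF R] repD(1,3)[OF R'] that by (intro pf.add pf.mult) simp_all
  fix j x assume j: "j < s" and x: "x \<in> V"
  have "D x * D' x * ((f x + g x) * b j x) = D' x * (D x * (f x * b j x)) + D x * (D' x * (g x * b j x))"
    by (simp add: algebra_simps)
  also have "\<dots> = (\<Sum>l<s. (D' x * m j l x + D x * m' j l x) * b l x)"
    unfolding repD(4)[OF R j x] repD(4)[OF R' j x]
    by (simp add: sum_distrib_left sum.distrib distrib_right mult.assoc)
  finally show "D x * D' x * ((f x + g x) * b j x) = (\<Sum>l<s. (D' x * m j l x + D x * m' j l x) * b l x)" .
qed

lemma rep_mult:
  assumes R: "rep D m f" and R': "rep D' m' g"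
  shows "rep (\<lambda>x. D x * D' x) (\<lambda>j l x. \<Sum>k<s. m j k x * m' k l x) (\<lambda>x. f x * g x)"
proof (rule repI)
  show "(\<lambda>x. D x * D' x) \<in> pf T" by (rule pf.mult[OF repD(1)[OF R] repD(1)[OF R']])
  show "(\<lambda>x. D x * D' x) \<noteq> 0" by (rule pf_T_domain[OF repD(1)[OF R] repD(1)[OF R'] repD(2)[OF R] repD(2)[OF R']])
  show "(\<lambda>x. \<Sum>k<s. m j k x * m' k l x) \<in> pf T" if "j < s" "l < s" for j l
    using repD(3)[OF R] repD(3)[OF R'] that by (intro pf_sum pf.mult) simp_all
  fix j x assume j: "j < s" and x: "x \<in> V"
  have "D x * D' x * (f x * g x * b j x) = D' x * g x * (D x * (f x * b j x))" by (simp add: ac_simps)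
  also have "\<dots> = (\<Sum>k<s. m j k x * (D' x * (g x * b k x)))"
    unfolding repD(4)[OF R j x] by (simp add: sum_distrib_left ac_simps)
  also have "\<dots> = (\<Sum>k<s. \<Sum>l<s. m j k x * m' k l x * b l x)"
    using x by (intro sum.cong) (simp_all add: repD(4)[OF R'] sum_distrib_left mult.assoc)
  also have "\<dots> = (\<Sum>l<s. (\<Sum>k<s. m j k x * m' k l x) * b l x)"
    by (subst sum.swap) (simp add: sum_distrib_right)
  finally show "D x * D' x * (f x * g x * b j x) = (\<Sum>l<s. (\<Sum>k<s. m j k x * m' k l x) * b l x)" .
qed

text \<open>Both products represent multiplication by the product of \<open>f\<close> and
  \<open>g\<close>. The resulting commutation is what lets an eigenvector of one matrix be refined
  for another.\<close>

lemma rep_commute: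
  assumes R: "rep D m f" and R': "rep D' m' g" and jl: "j < s" "l < s"
  shows "(\<lambda>x. \<Sum>k<s. m j k x * m' k l x) = (\<lambda>x. \<Sum>k<s. m' j k x * m k l x)"
proof (rule pf_T_eqI)
  show pf: "(\<lambda>x. \<Sum>k<s. m j k x * m' k l x) \<in> pf T" "(\<lambda>x. \<Sum>k<s. m' j k x * m k l x) \<in> pf T"
    using repD(3)[OF R] repD(3)[OF R'] jl by (intro pf_sum pf.mult; simp)+
  let ?D = "\<lambda>x. D x * D' x"
  have D: "?D \<in> pf T" "?D \<noteq> 0" using repD(1,2)[OF rep_mult[OF R R']] by auto
  have "(\<lambda>x. D' x * D x * (\<Sum>k<s. m j k x * m' k l x)) = (\<lambda>x. D x * D' x * (\<Sum>k<s. m' j k x * m k l x))"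
    by (rule rep_unique[OF rep_mult[OF R R'] rep_mult[OF R' R] _ jl]) (simp add: mult.commute)
  then have "?D x * ((\<Sum>k<s. m j k x * m' k l x) - (\<Sum>k<s. m' j k x * m k l x)) = 0" for x
    by (auto simp: fun_eq_iff algebra_simps)
  then have "(\<forall>x\<in>V. ?D x = 0) \<or> (\<forall>x\<in>V. (\<Sum>k<s. m j k x * m' k l x) - (\<Sum>k<s. m' j k x * m k l x) = 0)"
    by (intro V_irred[OF pf_T[OF D(1)] pf_T[OF pf_diff[OF pf]]]) simp
  then show "(\<Sum>k<s. m j k x * m' k l x) = (\<Sum>k<s. m' j k x * m k l x)" if "x \<in> V" for x
    using nonzero_on_V[OF D] that by fastforce
qed

end

text \<open>A common eigenvector of the multiplication matrices specialised along \<open>\<iota>\<close> substitutes for an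
  extension of \<open>\<iota>\<close> to the function field of \<open>V\<close>, the eigenvalue of \<open>f\<close> being the value at \<open>f\<close>.\<close>

locale torus_spec = torus_basis n V T s b
  for n and V :: "(nat \<Rightarrow> 'k :: {alg_closed_field, field_char_0}) set" and T s b +
  fixes \<iota> :: "((nat \<Rightarrow> 'k) \<Rightarrow> 'k) \<Rightarrow> 'f :: field"
  assumes spec_add: "\<And>p q. p \<in> pf T \<Longrightarrow> q \<in> pf T \<Longrightarrow> \<iota> (\<lambda>x. p x + q x) = \<iota> p + \<iota> q"
    and spec_mult: "\<And>p q. p \<in> pf T \<Longrightarrow> q \<in> pf T \<Longrightarrow> \<iota> (\<lambda>x. p x * q x) = \<iota> p * \<iota> q"
    and spec_0: "\<iota> (\<lambda>_. 0) = 0" and spec_1: "\<iota> (\<lambda>_. 1) = 1"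
begin

lemma spec_sum: "(\<And>i. i \<in> I \<Longrightarrow> p i \<in> pf T) \<Longrightarrow> \<iota> (\<lambda>x. \<Sum>i\<in>I. p i x) = (\<Sum>i\<in>I. \<iota> (p i))"
proof (induction I rule: infinite_finite_induct)
  case (insert i I)
  have "\<iota> (\<lambda>x. p i x + (\<Sum>i\<in>I. p i x)) = \<iota> (p i) + \<iota> (\<lambda>x. \<Sum>i\<in>I. p i x)"
    using insert.prems by (intro spec_add pf_sum) auto
  then show ?case using insert by simp
qed (simp_all add: spec_0)

lemma spec_sum_mult:
  assumes "\<And>k. k < s \<Longrightarrow> p k \<in> pf T" "\<And>k. k < s \<Longrightarrow> q k \<in> pf T"
  shows "\<iota> (\<lambda>x. \<Sum>k<s. p k x * q k x) = (\<Sum>k<s. \<iota> (p k) * \<iota> (q k))"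
proof -
  have "\<iota> (\<lambda>x. \<Sum>k<s. p k x * q k x) = (\<Sum>k<s. \<iota> (\<lambda>x. p k x * q k x))"
    by (rule spec_sum[of "{..<s}" "\<lambda>k x. p k x * q k x"]) (use assms in \<open>auto intro: pf.mult\<close>)
  also have "\<dots> = (\<Sum>k<s. \<iota> (p k) * \<iota> (q k))"
    using assms by (intro sum.cong) (simp_all add: spec_mult)
  finally show ?thesis .
qed

text \<open>Row \<open>j\<close> of \<open>m\<close> expands the product of \<open>f\<close> with
  \<open>b j\<close>. With this convention the model case of an eigenvector is the vector of values
  of the basis at a point of \<open>V\<close>, with the value of \<open>f\<close> as
  eigenvalue.\<close>

definition eig :: "(nat \<Rightarrow> 'f) \<Rightarrow> ((nat \<Rightarrow> 'k) \<Rightarrow> 'k) \<Rightarrow> 'f \<Rightarrow> bool" where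
  "eig w f \<rho> \<longleftrightarrow> (\<exists>D m. rep D m f \<and> \<iota> D \<noteq> 0 \<and> (\<forall>j<s. (\<Sum>l<s. \<iota> (m j l) * w l) = \<iota> D * \<rho> * w j))"

lemma eigI: "rep D m f \<Longrightarrow> \<iota> D \<noteq> 0 \<Longrightarrow> (\<And>j. j < s \<Longrightarrow> (\<Sum>l<s. \<iota> (m j l) * w l) = \<iota> D * \<rho> * w j) \<Longrightarrow> eig w f \<rho>"
  unfolding eig_def by blast

lemma eigE:
  assumes "eig w f \<rho>"
  obtains D m where "rep D m f" "\<iota> D \<noteq> 0" "\<forall>j<s. (\<Sum>l<s. \<iota> (m j l) * w l) = \<iota> D * \<rho> * w j"
  using assms unfolding eig_def by blast

text \<open>Two matrices of the same function are proportional by \<open>rep_unique\<close>. The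
  equation thus passes to every representation, even to one whose denominator is sent to 0 by
  \<open>\<iota>\<close>.\<close>

lemma eig_rep:
  assumes "eig w f \<rho>" and R: "rep D m g" and fg: "\<And>x. x \<in> V \<Longrightarrow> f x = g x" and j: "j < s"
  shows "(\<Sum>l<s. \<iota> (m j l) * w l) = \<iota> D * \<rho> * w j"
proof -
  obtain D' m' where R': "rep D' m' f" and D': "\<iota> D' \<noteq> 0" and e: "\<forall>j<s. (\<Sum>l<s. \<iota> (m' j l) * w l) = \<iota> D' * \<rho> * w j"
    by (rule eigE[OF assms(1)])
  have "\<iota> D * \<iota> (m' j l) = \<iota> D' * \<iota> (m j l)" if l: "l < s" for l
  proof -
    have "\<iota> (\<lambda>x. D x * m' j l x) = \<iota> (\<lambda>x. D' x * m j l x)"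
      by (rule arg_cong[OF rep_unique[OF R' R fg j l]])
    then show ?thesis using repD(1,3)[OF R] repD(1,3)[OF R'] j l by (simp add: spec_mult)
  qed
  then have "\<iota> D' * (\<Sum>l<s. \<iota> (m j l) * w l) = \<iota> D * (\<Sum>l<s. \<iota> (m' j l) * w l)"
    by (simp add: sum_distrib_left mult.assoc[symmetric])
  also have "\<dots> = \<iota> D' * (\<iota> D * \<rho> * w j)" using e j by simp
  finally show ?thesis using D' by simp
qed

lemma eig_unique:
  assumes "eig w f \<rho>" "eig w g \<sigma>" "\<And>x. x \<in> V \<Longrightarrow> f x = g x" "\<exists>j<s. w j \<noteq> 0"
  shows "\<rho> = \<sigma>"
proof -
  obtain D m where R: "rep D m g" and D: "\<iota> D \<noteq> 0" and e: "\<forall>j<s. (\<Sum>l<s. \<iota> (m j l) * w l) = \<iota> D * \<sigma> * w j"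
    by (rule eigE[OF assms(2)])
  obtain j where j: "j < s" "w j \<noteq> 0" using assms(4) by blast
  have "\<iota> D * \<rho> * w j = (\<Sum>l<s. \<iota> (m j l) * w l)"
    by (rule eig_rep[OF assms(1) R assms(3) j(1), symmetric])
  also have "\<dots> = \<iota> D * \<sigma> * w j" using e j(1) by blast
  finally have "\<iota> D * \<rho> * w j = \<iota> D * \<sigma> * w j" .
  then show ?thesis using D j by auto
qed

lemma eig_pf_T: "p \<in> pf T \<Longrightarrow> eig w p (\<iota> p)"
proof (rule eigI[OF rep_pf_T])
  assume p: "p \<in> pf T"
  show "\<iota> (\<lambda>_. 1) \<noteq> 0" by (simp add: spec_1)
  fix j assume "j < s"
  have "(\<Sum>l<s. \<iota> (if j = l then p else (\<lambda>_. 0)) * w l) = (\<Sum>l<s. if j = l then \<iota> p * w l else 0)"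
    by (intro sum.cong) (auto simp: spec_0)
  then show "(\<Sum>l<s. \<iota> (if j = l then p else (\<lambda>_. 0)) * w l) = \<iota> (\<lambda>_. 1) * \<iota> p * w j"
    using \<open>j < s\<close> by (simp add: spec_1)
qed

lemma eig_add:
  assumes "eig w f \<rho>" "eig w g \<sigma>" shows "eig w (\<lambda>x. f x + g x) (\<rho> + \<sigma>)"
proof -
  obtain D m where R: "rep D m f" and D: "\<iota> D \<noteq> 0" and e: "\<forall>j<s. (\<Sum>l<s. \<iota> (m j l) * w l) = \<iota> D * \<rho> * w j"
    by (rule eigE[OF assms(1)])
  obtain D' m' where R': "rep D' m' g" and D': "\<iota> D' \<noteq> 0" and e': "\<forall>j<s. (\<Sum>l<s. \<iota> (m' j l) * w l) = \<iota> D' * \<sigma> * w j"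
    by (rule eigE[OF assms(2)])
  note pfs = repD(1,3)[OF R] repD(1,3)[OF R']
  have DD: "\<iota> (\<lambda>x. D x * D' x) = \<iota> D * \<iota> D'" using pfs by (simp add: spec_mult)
  show ?thesis
  proof (rule eigI[OF rep_add[OF R R']])
    show "\<iota> (\<lambda>x. D x * D' x) \<noteq> 0" using D D' DD by simp
    fix j assume j: "j < s"
    have "(\<Sum>l<s. \<iota> (\<lambda>x. D' x * m j l x + D x * m' j l x) * w l) =
      (\<Sum>l<s. (\<iota> D' * \<iota> (m j l) + \<iota> D * \<iota> (m' j l)) * w l)"
      using pfs j by (intro sum.cong) (simp_all add: spec_add spec_mult pf.mult)
    also have "\<dots> = \<iota> D' * (\<Sum>l<s. \<iota> (m j l) * w l) + \<iota> D * (\<Sum>l<s. \<iota> (m' j l) * w l)"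
      by (simp add: distrib_right sum.distrib sum_distrib_left mult.assoc)
    finally show "(\<Sum>l<s. \<iota> (\<lambda>x. D' x * m j l x + D x * m' j l x) * w l) = \<iota> (\<lambda>x. D x * D' x) * (\<rho> + \<sigma>) * w j"
      by (simp only: DD e[rule_format, OF j] e'[rule_format, OF j]) (simp add: algebra_simps)
  qed
qed

lemma eig_mult:
  assumes "eig w f \<rho>" "eig w g \<sigma>" shows "eig w (\<lambda>x. f x * g x) (\<rho> * \<sigma>)"
proof -
  obtain D m where R: "rep D m f" and D: "\<iota> D \<noteq> 0" and e: "\<forall>j<s. (\<Sum>l<s. \<iota> (m j l) * w l) = \<iota> D * \<rho> * w j"
    by (rule eigE[OF assms(1)])
  obtain D' m' where R': "rep D' m' g" and D': "\<iota> D' \<noteq> 0" and e': "\<forall>j<s. (\<Sum>l<s. \<iota> (m' j l) * w l) = \<iota> D' * \<sigma> * w j"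
    by (rule eigE[OF assms(2)])
  note pfs = repD(1,3)[OF R] repD(1,3)[OF R']
  have DD: "\<iota> (\<lambda>x. D x * D' x) = \<iota> D * \<iota> D'" using pfs by (simp add: spec_mult)
  show ?thesis
  proof (rule eigI[OF rep_mult[OF R R']])
    show "\<iota> (\<lambda>x. D x * D' x) \<noteq> 0" using D D' DD by simp
    fix j assume j: "j < s"
    have "(\<Sum>l<s. \<iota> (\<lambda>x. \<Sum>k<s. m j k x * m' k l x) * w l) = (\<Sum>l<s. \<Sum>k<s. \<iota> (m j k) * \<iota> (m' k l) * w l)"
    proof (rule sum.cong[OF refl])
      fix l assume "l \<in> {..<s}"
      then have "\<iota> (\<lambda>x. \<Sum>k<s. m j k x * m' k l x) = (\<Sum>k<s. \<iota> (m j k) * \<iota> (m' k l))"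
        using pfs j by (intro spec_sum_mult) auto
      then show "\<iota> (\<lambda>x. \<Sum>k<s. m j k x * m' k l x) * w l = (\<Sum>k<s. \<iota> (m j k) * \<iota> (m' k l) * w l)"
        by (simp add: sum_distrib_right)
    qed
    also have "\<dots> = (\<Sum>k<s. \<iota> (m j k) * (\<Sum>l<s. \<iota> (m' k l) * w l))"
      by (subst sum.swap) (simp add: sum_distrib_left mult.assoc)
    also have "\<dots> = \<iota> D' * \<sigma> * (\<Sum>k<s. \<iota> (m j k) * w k)"
      using e' by (simp add: sum_distrib_left ac_simps)
    finally show "(\<Sum>l<s. \<iota> (\<lambda>x. \<Sum>k<s. m j k x * m' k l x) * w l) = \<iota> (\<lambda>x. D x * D' x) * (\<rho> * \<sigma>) * w j"
      by (simp only: DD e[rule_format, OF j]) (simp add: ac_simps)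
  qed
qed

abbreviation spec_mat :: "(nat \<Rightarrow> nat \<Rightarrow> (nat \<Rightarrow> 'k) \<Rightarrow> 'k) \<Rightarrow> 'f mat" where
  "spec_mat m \<equiv> mat s s (\<lambda>(j, l). \<iota> (m j l))"

lemma eig_mat_app:
  assumes "eig w g \<sigma>" "rep D m g" "\<forall>i\<ge>s. w i = 0"
  shows "mat_app s (\<lambda>j l. \<iota> (m j l)) w = (\<lambda>i. (\<iota> D * \<sigma>) * w i)"
proof
  fix i
  show "mat_app s (\<lambda>j l. \<iota> (m j l)) w i = (\<iota> D * \<sigma>) * w i"
  proof (cases "i < s")
    case True
    from eig_rep[OF assms(1,2) refl True] show ?thesis using True by (simp add: mat_app_def)
  qed (use assms(3) in \<open>simp add: mat_app_def\<close>)
qed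

text \<open>The matrix of \<open>f\<close> commutes with the matrices of all functions treated
  before, so \<open>refine_eigenvector\<close> adds \<open>f\<close> without changing any earlier
  eigenvalue.\<close>

lemma eig_extend:
  assumes splits: "\<And>D m f. rep D m f \<Longrightarrow> splits (char_poly (spec_mat m))"
    and w: "w \<noteq> (\<lambda>i. 0)" "\<forall>i\<ge>s. w i = 0" and R: "rep D m f" "\<iota> D \<noteq> 0"
  shows "\<exists>w'. w' \<noteq> (\<lambda>i. 0) \<and> (\<forall>i\<ge>s. w' i = 0) \<and> (\<exists>\<rho>. eig w' f \<rho>) \<and> (\<forall>g \<sigma>. eig w g \<sigma> \<longrightarrow> eig w' g \<sigma>)"
proof -
  let ?A = "\<lambda>j l. \<iota> (m j l)"
  obtain w' \<rho> where w': "w' \<noteq> (\<lambda>i. 0)" "\<forall>i\<ge>s. w' i = 0" "mat_app s ?A w' = (\<lambda>i. \<rho> * w' i)"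
    "\<forall>B \<sigma>. (\<forall>i<s. \<forall>j<s. (\<Sum>k<s. ?A i k * B k j) = (\<Sum>k<s. B i k * ?A k j)) \<longrightarrow>
       mat_app s B w = (\<lambda>i. \<sigma> * w i) \<longrightarrow> mat_app s B w' = (\<lambda>i. \<sigma> * w' i)"
    using refine_eigenvector[OF splits[OF R(1)], of w] w by blast
  have eigI': "eig v g \<sigma>" if "rep D m g" "\<iota> D \<noteq> 0" "mat_app s (\<lambda>j l. \<iota> (m j l)) v = (\<lambda>i. (\<iota> D * \<sigma>) * v i)" for D m g v \<sigma>
  proof (rule eigI[OF that(1,2)])
    fix j assume "j < s"
    then show "(\<Sum>l<s. \<iota> (m j l) * v l) = \<iota> D * \<sigma> * v j" using fun_cong[OF that(3), of j] by (simp add: mat_app_def)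
  qed
  have "eig w' f (\<rho> / \<iota> D)" by (rule eigI'[OF R]) (use w'(3) R(2) in simp)
  moreover have "eig w' g \<sigma>" if g: "eig w g \<sigma>" for g \<sigma>
  proof -
    obtain D' m' where R': "rep D' m' g" and D': "\<iota> D' \<noteq> 0" by (rule eigE[OF g])
    let ?B = "\<lambda>j l. \<iota> (m' j l)"
    have comm: "(\<Sum>k<s. ?A i k * ?B k j) = (\<Sum>k<s. ?B i k * ?A k j)" if ij: "i < s" "j < s" for i j
    proof -
      have "\<iota> (\<lambda>x. \<Sum>k<s. m i k x * m' k j x) = \<iota> (\<lambda>x. \<Sum>k<s. m' i k x * m k j x)"
        by (rule arg_cong[OF rep_commute[OF R(1) R' ij]])
      moreover have "\<iota> (\<lambda>x. \<Sum>k<s. m i k x * m' k j x) = (\<Sum>k<s. ?A i k * ?B k j)"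
        "\<iota> (\<lambda>x. \<Sum>k<s. m' i k x * m k j x) = (\<Sum>k<s. ?B i k * ?A k j)"
        using repD(3)[OF R(1)] repD(3)[OF R'] ij by (intro spec_sum_mult; simp)+
      ultimately show ?thesis by simp
    qed
    have "mat_app s ?B w' = (\<lambda>i. (\<iota> D' * \<sigma>) * w' i)"
      by (rule w'(4)[rule_format, OF comm eig_mat_app[OF g R' w(2)]])
    then show ?thesis by (rule eigI'[OF R' D'])
  qed
  ultimately show ?thesis using w'(1,2) by blast
qed

lemma spec_mat_root:
  assumes "eig w f \<rho>" "rep D m f" "\<exists>j<s. w j \<noteq> 0"
  shows "poly (char_poly (spec_mat m)) (\<iota> D * \<rho>) = 0"
proof -
  let ?v = "vec s w"
  have "spec_mat m *\<^sub>v ?v = (\<iota> D * \<rho>) \<cdot>\<^sub>v ?v"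
  proof (rule eq_vecI)
    fix i assume "i < dim_vec ((\<iota> D * \<rho>) \<cdot>\<^sub>v ?v)"
    then have i: "i < s" by simp
    then have "(spec_mat m *\<^sub>v ?v) $ i = (\<Sum>l<s. \<iota> (m i l) * w l)"
      by (simp add: scalar_prod_def atLeast0LessThan)
    then show "(spec_mat m *\<^sub>v ?v) $ i = ((\<iota> D * \<rho>) \<cdot>\<^sub>v ?v) $ i"
      using eig_rep[OF assms(1,2) refl i] i by simp
  qed simp
  moreover have "?v \<noteq> 0\<^sub>v s"
  proof -
    obtain j where "j < s" "w j \<noteq> 0" using assms(3) by blast
    then have "?v $ j \<noteq> 0\<^sub>v s $ j" by simp
    then show ?thesis by metis
  qed
  ultimately have "eigenvalue (spec_mat m) (\<iota> D * \<rho>)"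
    unfolding eigenvalue_def eigenvector_def by (intro exI[of _ ?v]) simp
  then show ?thesis using eigenvalue_root_char_poly[of "spec_mat m" s] by simp
qed

text \<open>Starting from an eigenvector for the given root, the elements of \<open>F\<close> are
  adjoined one at a time. Thus each root is the value of \<open>f\<close> at an extension of the
  place at which all of \<open>F\<close> can be evaluated too.\<close>

lemma common_eig:
  assumes splits: "\<And>D m f. rep D m f \<Longrightarrow> splits (char_poly (spec_mat m))"
    and R: "rep D m f" "\<iota> D \<noteq> 0" and root: "poly (char_poly (spec_mat m)) \<rho> = 0"
    and "finite F" "\<And>g. g \<in> F \<Longrightarrow> \<exists>D m. rep D m g \<and> \<iota> D \<noteq> 0"
  shows "\<exists>w. (\<exists>j<s. w j \<noteq> 0) \<and> eig w f (\<rho> / \<iota> D) \<and> (\<forall>g\<in>F. \<exists>\<sigma>. eig w g \<sigma>)"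
proof -
  have "eigenvalue (spec_mat m) \<rho>" using root eigenvalue_root_char_poly[of "spec_mat m" s] by simp
  then obtain v where v: "v \<in> carrier_vec s" "v \<noteq> 0\<^sub>v s" "spec_mat m *\<^sub>v v = \<rho> \<cdot>\<^sub>v v"
    unfolding eigenvalue_def eigenvector_def by auto
  define w0 where "w0 i = (if i < s then v $ i else 0)" for i
  have w0: "w0 \<noteq> (\<lambda>i. 0)" "\<forall>i\<ge>s. w0 i = 0"
  proof -
    obtain i where "i < s" "v $ i \<noteq> 0" using v(1,2) by (metis carrier_vecD eq_vecI index_zero_vec(1) index_zero_vec(2))
    then show "w0 \<noteq> (\<lambda>i. 0)" unfolding w0_def by metis
  qed (simp add: w0_def)
  have e0: "eig w0 f (\<rho> / \<iota> D)"
  proof (rule eigI[OF R])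
    fix j assume j: "j < s"
    have "(spec_mat m *\<^sub>v v) $ j = (\<Sum>l<s. \<iota> (m j l) * v $ l)"
      using j v(1) by (simp add: scalar_prod_def atLeast0LessThan)
    then have "(\<Sum>l<s. \<iota> (m j l) * v $ l) = \<rho> * v $ j" using v(1,3) j by simp
    then show "(\<Sum>l<s. \<iota> (m j l) * w0 l) = \<iota> D * (\<rho> / \<iota> D) * w0 j" using j R(2) by (simp add: w0_def)
  qed
  have "\<exists>w. w \<noteq> (\<lambda>i. 0) \<and> (\<forall>i\<ge>s. w i = 0) \<and> eig w f (\<rho> / \<iota> D) \<and> (\<forall>g\<in>F. \<exists>\<sigma>. eig w g \<sigma>)"
    using assms(5,6)
  proof (induction F rule: finite_induct)
    case empty
    then show ?case using w0 e0 by blast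
  next
    case (insert g F)
    obtain w where w: "w \<noteq> (\<lambda>i. 0)" "\<forall>i\<ge>s. w i = 0" "eig w f (\<rho> / \<iota> D)" "\<forall>g\<in>F. \<exists>\<sigma>. eig w g \<sigma>"
      using insert.IH insert.prems by (metis insertI2)
    obtain D' m' where "rep D' m' g" "\<iota> D' \<noteq> 0" using insert.prems by blast
    from eig_extend[OF _ w(1,2) this] splits obtain w' where
      w': "w' \<noteq> (\<lambda>i. 0)" "\<forall>i\<ge>s. w' i = 0" "\<exists>\<rho>. eig w' g \<rho>" "\<forall>g \<sigma>. eig w g \<sigma> \<longrightarrow> eig w' g \<sigma>" by blast
    show ?case
    proof (intro exI[of _ w'] conjI ballI)
      fix h assume "h \<in> insert g F"
      then show "\<exists>\<sigma>. eig w' h \<sigma>" using w'(3,4) w(4) by blast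
    qed (use w' w(3) in blast)+
  qed
  then obtain w where w: "w \<noteq> (\<lambda>i. 0)" "\<forall>i\<ge>s. w i = 0" "eig w f (\<rho> / \<iota> D)" "\<forall>g\<in>F. \<exists>\<sigma>. eig w g \<sigma>" by blast
  moreover have "\<exists>j<s. w j \<noteq> 0" using w(1,2) by (meson ext not_le)
  ultimately show ?thesis by blast
qed

end

section \<open>Eigenvalues over the places of a line\<close>

lemma linear_factors_monic:
  "degree (\<Prod>a\<leftarrow>as. [:-a, 1 :: 'r :: idom:]) = length as \<and> lead_coeff (\<Prod>a\<leftarrow>as. [:-a, 1:]) = 1"
proof (induction as)
  case (Cons a as)
  let ?p = "\<Prod>a\<leftarrow>as. [:-a, 1:]"
  have "?p \<noteq> 0" using Cons by (metis coeff_0 zero_neq_one)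
  then have "degree ([:-a, 1:] * ?p) = Suc (length as)" using Cons by (subst degree_mult_eq) auto
  moreover have "lead_coeff ([:-a, 1:] * ?p) = 1" using Cons by (subst lead_coeff_mult) auto
  ultimately show ?case by (simp only: list.map prod_list.Cons length_Cons)
qed simp

text \<open>The coefficient of degree \<open>j\<close> is, up to sign, an elementary symmetric
  function of degree \<open>length as - j\<close> in the roots.\<close>

lemma vge_coeff_linear_factors:
  assumes "\<And>a. a \<in> set as \<Longrightarrow> vge a v" "j \<le> length as"
  shows "vge (coeff (\<Prod>a\<leftarrow>as. [:-a, 1 :: 'k :: field fls:]) j) (int (length as - j) * v)"
  using assms
proof (induction as arbitrary: j)
  case Nil
  then show ?case by (simp add: vge_def)
next
  case (Cons a as)
  let ?p = "\<Prod>a\<leftarrow>as. [:-a, 1:]"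
  have IH: "vge (coeff ?p j) (int (length as - j) * v)" if "j \<le> length as" for j
    using Cons.IH[OF Cons.prems(1) that] by simp
  have 1: "vge (coeff (pCons 0 ?p) j) (int (Suc (length as) - j) * v)"
  proof (cases j)
    case (Suc i)
    then show ?thesis using IH[of i] Cons.prems(2) by simp
  qed simp
  have 2: "vge (a * coeff ?p j) (int (Suc (length as) - j) * v)"
  proof (cases "j \<le> length as")
    case True
    have "vge (a * coeff ?p j) (v + int (length as - j) * v)"
      using IH[OF True] Cons.prems(1) by (intro vge_mult) auto
    moreover have "v + int (length as - j) * v = int (Suc (length as) - j) * v"
      using True by (simp add: Suc_diff_le algebra_simps)
    ultimately show ?thesis by simp
  next
    case False
    then have "coeff ?p j = 0" using linear_factors_monic[of as] by (intro coeff_eq_0) auto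
    then show ?thesis by simp
  qed
  have "(\<Prod>a\<leftarrow>a # as. [:-a, 1:]) = pCons 0 ?p - smult a ?p" by simp
  then show ?case using vge_add[OF 1 vge_minus[OF 2]] by simp
qed

locale torus_places = torus_basis n V T s b
  for n and V :: "(nat \<Rightarrow> 'k :: {alg_closed_field, field_char_0}) set" and T s b +
  fixes E :: nat
  assumes E_pos: "0 < E"
    and E_splits: "\<And>c (N :: 'k poly mat). N \<in> carrier_mat s s \<Longrightarrow> splits (char_poly (map_mat (place E c) N))"
begin

text \<open>Restriction to the line through \<open>y0\<close> and \<open>y1\<close>, followed by expansion at the place \<open>c\<close> of that line.\<close>

definition sp :: "(nat \<Rightarrow> 'k) \<Rightarrow> (nat \<Rightarrow> 'k) \<Rightarrow> 'k option \<Rightarrow> ((nat \<Rightarrow> 'k) \<Rightarrow> 'k) \<Rightarrow> 'k fls" where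
  "sp y0 y1 c p = place E c (on_seg y0 y1 p)"

lemma spec: "torus_spec n V T s b (sp y0 y1 c)"
proof unfold_locales
  show "sp y0 y1 c (\<lambda>_. 0) = 0" "sp y0 y1 c (\<lambda>_. 1) = 1"
    by (simp_all add: sp_def on_seg_const)
qed (simp_all add: sp_def on_seg_ring[of _ T])

definition Eg :: "(nat \<Rightarrow> 'k) \<Rightarrow> (nat \<Rightarrow> 'k) \<Rightarrow> 'k option \<Rightarrow> (nat \<Rightarrow> 'k fls) \<Rightarrow> ((nat \<Rightarrow> 'k) \<Rightarrow> 'k) \<Rightarrow> 'k fls \<Rightarrow> bool" where
  "Eg y0 y1 c = torus_spec.eig V T s b (sp y0 y1 c)"

lemmas Eg_rep = torus_spec.eig_rep[OF spec, folded Eg_def]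
lemmas Eg_unique = torus_spec.eig_unique[OF spec, folded Eg_def]
lemmas Eg_pf_T = torus_spec.eig_pf_T[OF spec, folded Eg_def]
lemmas Eg_add = torus_spec.eig_add[OF spec, folded Eg_def]
lemmas Eg_mult = torus_spec.eig_mult[OF spec, folded Eg_def]
lemmas Eg_root = torus_spec.spec_mat_root[OF spec, folded Eg_def]
lemmas Eg_common = torus_spec.common_eig[OF spec, folded Eg_def]

lemma on_seg_nonzero: "D \<in> pf T \<Longrightarrow> D y0 \<noteq> 0 \<Longrightarrow> on_seg y0 y1 D \<noteq> 0"
  using poly_on_seg[of D T y0 y1 0] by auto

lemma sp_nonzero: "D \<in> pf T \<Longrightarrow> D y0 \<noteq> 0 \<Longrightarrow> sp y0 y1 c D \<noteq> 0"
  unfolding sp_def by (intro place_nonzero E_pos on_seg_nonzero)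

abbreviation seg_mat where
  "seg_mat y0 y1 m \<equiv> mat s s (\<lambda>(j, l). on_seg y0 y1 (m j l))"

lemma sp_mat: "mat s s (\<lambda>(j, l). sp y0 y1 c (m j l)) = map_mat (place E c) (seg_mat y0 y1 m)"
  by (rule eq_matI) (auto simp: sp_def)

lemma sp_splits: "splits (char_poly (mat s s (\<lambda>(j, l). sp y0 y1 c (m j l))))"
  unfolding sp_mat by (rule E_splits) simp

lemma Eg_const: "Eg y0 y1 c w (\<lambda>_. a) (fls_const a)"
  using Eg_pf_T[OF pf.const, of y0 y1 c w a] by (simp add: sp_def on_seg_const)

text \<open>Eigenvalues are compatible with sums and products, so those of the coordinates determine
  those of all polynomials; two eigenvectors that agree on the coordinates agree on these.\<close>

lemma Eg_pf:
  assumes "p \<in> pf {..<n}"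
    "\<And>i. i < n \<Longrightarrow> Eg y0 y1 c w (\<lambda>x. x i) (\<alpha> i)" "\<And>i. i < n \<Longrightarrow> Eg y0 y1 c w' (\<lambda>x. x i) (\<alpha> i)"
  shows "\<exists>\<rho>. Eg y0 y1 c w p \<rho> \<and> Eg y0 y1 c w' p \<rho>"
  using assms(1)
proof (induction rule: pf.induct)
  case (const a)
  show ?case using Eg_const by blast
next
  case (coord i)
  then show ?case using assms(2,3) by auto
next
  case (add p q)
  then show ?case using Eg_add by blast
next
  case (mult p q)
  then show ?case using Eg_mult by blast
qed

text \<open>At a finite place the entries of the matrix are integral, and the denominator is a unit
  by assumption.\<close>

lemma Eg_integral:
  assumes "Eg y0 y1 (Some z) w f \<rho>" "rep D m f" "poly (on_seg y0 y1 D) z \<noteq> 0" "\<exists>j<s. w j \<noteq> 0"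
  shows "vge \<rho> 0"
proof -
  have "vge (sp y0 y1 (Some z) D * \<rho>) 0"
    by (rule vge_eigenvalue[OF Eg_rep[OF assms(1,2) refl] assms(4)])
      (simp_all add: sp_def place_Some(1)[OF E_pos])
  moreover have "fls_nth (sp y0 y1 (Some z) D) 0 \<noteq> 0" "vge (sp y0 y1 (Some z) D) 0"
    using assms(3) by (simp_all add: sp_def place_Some[OF E_pos])
  moreover from this have "fls_subdegree (sp y0 y1 (Some z) D) \<le> 0" "sp y0 y1 (Some z) D \<noteq> 0"
    by (auto intro: fls_subdegree_leI)
  ultimately show ?thesis
    by (cases "\<rho> = 0") (auto simp: vge_def)
qed

text \<open>The entries contribute poles of order at most \<open>E * d\<close> and the denominator
  zeros of order at most \<open>E * d\<close>; neither bound sees the place or the line.\<close>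

lemma Eg_lower_bound:
  assumes "Eg y0 y1 c w f \<rho>" "rep D m f" "D y0 \<noteq> 0" "\<exists>j<s. w j \<noteq> 0" "\<rho> \<noteq> 0"
    and deg: "degree (on_seg y0 y1 D) \<le> d" "\<And>j l. j < s \<Longrightarrow> l < s \<Longrightarrow> degree (on_seg y0 y1 (m j l)) \<le> d"
  shows "- int (2 * E * d) \<le> fls_subdegree \<rho>"
proof -
  have D0: "sp y0 y1 c D \<noteq> 0" by (rule sp_nonzero[OF repD(1)[OF assms(2)] assms(3)])
  have "vge (sp y0 y1 c D * \<rho>) (- int E * int d)"
    by (rule vge_eigenvalue[OF Eg_rep[OF assms(1,2) refl] assms(4)])
      (simp_all only: sp_def vge_place[OF E_pos deg(2)])
  then have "- int E * int d \<le> fls_subdegree (sp y0 y1 c D) + fls_subdegree \<rho>"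
    using D0 assms(5) by (simp add: vge_def)
  moreover have "fls_subdegree (sp y0 y1 c D) \<le> int E * int d"
    unfolding sp_def by (rule subdegree_place_le[OF E_pos deg(1)])
  ultimately show ?thesis by simp
qed

text \<open>A common eigenvector over a finite place where all coordinates and their inverses are
  integral has a centre in \<open>V\<close>, so that a regular function is integral there as well.\<close>

lemma Eg_regular_integral:
  assumes w: "\<exists>j<s. w j \<noteq> 0"
    and X: "\<And>i. i < n \<Longrightarrow> Eg y0 y1 (Some z) w (\<lambda>x. x i) (\<alpha> i)" "\<And>i. i < n \<Longrightarrow> vge (\<alpha> i) 0"
    and Y: "\<And>i. i < n \<Longrightarrow> Eg y0 y1 (Some z) w (\<lambda>x. inverse (x i)) (\<alpha>' i)" "\<And>i. i < n \<Longrightarrow> vge (\<alpha>' i) 0"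
    and u: "reg u" "Eg y0 y1 (Some z) w u \<rho>"
  shows "vge \<rho> 0"
proof -
  \<comment> \<open>The centre consists of the residues of the coordinates, with
    \<open>undefined\<close> from \<open>n\<close> on as required for a point of affine
    space.\<close>
  define x0 where "x0 i = (if i < n then fls_nth (\<alpha> i) 0 else undefined)" for i
  have ev: "\<exists>\<rho>. Eg y0 y1 (Some z) w p \<rho> \<and> vge \<rho> 0 \<and> fls_nth \<rho> 0 = p x0" if "p \<in> pf {..<n}" for p
    using that
  proof (induction rule: pf.induct)
    case (const a)
    show ?case by (intro exI[of _ "fls_const a"]) (simp add: Eg_const vge_const)
  next
    case (coord i)
    then show ?case using X by (intro exI[of _ "\<alpha> i"]) (simp add: x0_def)
  next
    case (add p q)
    then obtain \<rho> \<sigma> where "Eg y0 y1 (Some z) w p \<rho>" "vge \<rho> 0" "fls_nth \<rho> 0 = p x0"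
      "Eg y0 y1 (Some z) w q \<sigma>" "vge \<sigma> 0" "fls_nth \<sigma> 0 = q x0" by blast
    then show ?case by (intro exI[of _ "\<rho> + \<sigma>"]) (simp add: Eg_add vge_add)
  next
    case (mult p q)
    then obtain \<rho> \<sigma> where "Eg y0 y1 (Some z) w p \<rho>" "vge \<rho> 0" "fls_nth \<rho> 0 = p x0"
      "Eg y0 y1 (Some z) w q \<sigma>" "vge \<sigma> 0" "fls_nth \<sigma> 0 = q x0" by blast
    then show ?case by (intro exI[of _ "\<rho> * \<sigma>"]) (simp add: Eg_mult vge_mult0 fls_nth0_mult)
  qed
  have "x0 \<in> V"
  proof (rule V_closed)
    show "x0 \<in> affine_points n" by (auto simp: affine_points_def x0_def PiE_iff extensional_def)
    fix i assume i: "i < n"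
    \<comment> \<open>Two integral eigenvalues with product 1 have nonzero residues, so the centre
      lies in the torus.\<close>
    have "\<alpha> i * \<alpha>' i = fls_const 1"
    proof (rule Eg_unique[OF Eg_mult[OF X(1)[OF i] Y(1)[OF i]] Eg_const[of y0 y1 "Some z" w 1] _ w])
      show "x i * inverse (x i) = 1" if "x \<in> V" for x using V_torus[OF that i] by simp
    qed
    then have "fls_nth (\<alpha> i) 0 * fls_nth (\<alpha>' i) 0 = 1"
      using fls_nth0_mult[OF X(2)[OF i] Y(2)[OF i]] by simp
    then show "x0 i \<noteq> 0" using i by (auto simp: x0_def)
  next
    fix f assume f: "f \<in> pf {..<n}" "\<And>y. y \<in> V \<Longrightarrow> f y = 0"
    obtain \<sigma> where \<sigma>: "Eg y0 y1 (Some z) w f \<sigma>" "fls_nth \<sigma> 0 = f x0" using ev[OF f(1)] by blast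
    have "\<sigma> = fls_const 0" by (rule Eg_unique[OF \<sigma>(1) Eg_const f(2) w])
    then show "f x0 = 0" using \<sigma>(2) by simp
  qed
  obtain p q where pq: "p \<in> pf {..<n}" "q \<in> pf {..<n}" "q x0 \<noteq> 0" "\<forall>y\<in>V. q y * u y = p y"
    by (rule regE[OF u(1) \<open>x0 \<in> V\<close>])
  obtain \<beta> where \<beta>: "Eg y0 y1 (Some z) w q \<beta>" "vge \<beta> 0" "fls_nth \<beta> 0 = q x0" using ev[OF pq(2)] by blast
  obtain \<gamma> where \<gamma>: "Eg y0 y1 (Some z) w p \<gamma>" "vge \<gamma> 0" using ev[OF pq(1)] by blast
  have "\<beta> * \<rho> = \<gamma>"
    by (rule Eg_unique[OF Eg_mult[OF \<beta>(1) u(2)] \<gamma>(1) _ w]) (use pq(4) in blast)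
  moreover have "\<beta> \<noteq> 0" "fls_subdegree \<beta> \<le> 0" using \<beta>(3) pq(3) by (auto intro: fls_subdegree_leI)
  ultimately show ?thesis using \<gamma>(2) by (cases "\<rho> = 0") (auto simp: vge_def)
qed

text \<open>The roots divided by the denominator are integral at all places, infinity included.
  Hence the coefficient at \<open>s - i\<close>, divided by the \<open>i\<close>-th power of the
  denominator, has no pole on the line and is constant.\<close>

lemma char_poly_constant_ratio:
  assumes R: "rep D m f" "D y0 \<noteq> 0"
    and int: "\<And>c \<rho>. poly (char_poly (mat s s (\<lambda>(j, l). sp y0 y1 c (m j l)))) \<rho> = 0 \<Longrightarrow>
      vge \<rho> (fls_subdegree (sp y0 y1 c D))"
  shows "\<exists>\<kappa>. \<forall>i\<le>s. coeff (char_poly (seg_mat y0 y1 m)) (s - i) = smult (\<kappa> i) (on_seg y0 y1 D ^ i)"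
proof -
  let ?\<chi> = "char_poly (seg_mat y0 y1 m)" and ?d = "on_seg y0 y1 D"
  have d0: "?d \<noteq> 0" by (rule on_seg_nonzero[OF repD(1)[OF R(1)] R(2)])
  have "\<exists>k. coeff ?\<chi> (s - i) = smult k (?d ^ i)" if i: "i \<le> s" for i
  proof (rule constant_ratio_if_vge_all_places[OF E_pos])
    show "?d ^ i \<noteq> 0" using d0 by simp
    fix c :: "'k option"
    interpret pE: comm_ring_hom "place E c" by (rule place_hom)
    let ?F = "char_poly (mat s s (\<lambda>(j, l). sp y0 y1 c (m j l)))"
    have F: "?F = map_poly (place E c) ?\<chi>"
      unfolding sp_mat by (rule pE.char_poly_hom[of _ s]) simp
    obtain t as where as: "?F = smult t (\<Prod>a\<leftarrow>as. [:-a, 1:])"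
      using sp_splits unfolding splits_def by blast
    have dF: "degree ?F = s" "coeff ?F s = 1"
      using degree_monic_char_poly[of "mat s s (\<lambda>(j, l). sp y0 y1 c (m j l))" s] by auto
    have "t \<noteq> 0" using as dF(2) by auto
    then have "length as = s" using as dF(1) linear_factors_monic[of as] by simp
    then have "coeff (\<Prod>a\<leftarrow>as. [:-a, 1:]) s = 1" using linear_factors_monic[of as] by metis
    then have "t = 1" using dF(2) unfolding as by simp
    have "vge a (fls_subdegree (sp y0 y1 c D))" if "a \<in> set as" for a
    proof (rule int)
      have "poly (\<Prod>a\<leftarrow>as. [:-a, 1:]) a = 0"
        using that by (induction as) auto
      then show "poly ?F a = 0" unfolding as by simp
    qed
    then have "vge (coeff ?F (s - i)) (int (s - (s - i)) * fls_subdegree (sp y0 y1 c D))"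
      using vge_coeff_linear_factors[of as _ "s - i"] unfolding as \<open>t = 1\<close> \<open>length as = s\<close> by simp
    then have "vge (place E c (coeff ?\<chi> (s - i))) (int (s - (s - i)) * fls_subdegree (sp y0 y1 c D))"
      by (simp only: F coeff_map_poly place_0)
    then show "vge (place E c (coeff ?\<chi> (s - i))) (fls_subdegree (place E c (?d ^ i)))"
      using i by (simp add: place_power fls_subdegree_pow sp_def)
  qed
  then show ?thesis by metis
qed

text \<open>For \<open>D y\<close> nonzero this is the characteristic polynomial of the matrix
  \<open>m / D\<close> at the point \<open>y\<close>, written with the denominators pulled out of
  the coefficients.\<close>

definition eig_poly :: "((nat \<Rightarrow> 'k) \<Rightarrow> 'k) \<Rightarrow> (nat \<Rightarrow> nat \<Rightarrow> (nat \<Rightarrow> 'k) \<Rightarrow> 'k) \<Rightarrow> (nat \<Rightarrow> 'k) \<Rightarrow> 'k poly" where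
  "eig_poly D m y = (\<Sum>i\<le>s. monom (coeff (char_poly (mat s s (\<lambda>(j, l). m j l y))) (s - i) / D y ^ i) (s - i))"

lemma eig_poly_nonzero: "eig_poly D m y \<noteq> 0"
proof -
  let ?c = "\<lambda>i. coeff (char_poly (mat s s (\<lambda>(j, l). m j l y))) (s - i) / D y ^ i"
  have "coeff (eig_poly D m y) s = (\<Sum>i\<le>s. if s - i = s then ?c i else 0)"
    by (simp add: eig_poly_def coeff_sum)
  also have "\<dots> = (\<Sum>i\<in>{0}. ?c i)"
    by (rule sum.mono_neutral_cong_right) (use s_pos in auto)
  also have "\<dots> = 1" using degree_monic_char_poly[of "mat s s (\<lambda>(j, l). m j l y)" s] by simp
  finally show ?thesis by auto
qed

text \<open>The characteristic polynomial of \<open>m / D\<close> has constant coefficients along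
  the line, so the one at \<open>y0\<close> also belongs to \<open>y1\<close>, where the value of
  \<open>f\<close> is an eigenvalue.\<close>

lemma eig_poly_root:
  assumes R: "rep D m f" "D y0 \<noteq> 0"
    and int: "\<And>c \<rho>. poly (char_poly (mat s s (\<lambda>(j, l). sp y0 y1 c (m j l)))) \<rho> = 0 \<Longrightarrow>
      vge \<rho> (fls_subdegree (sp y0 y1 c D))"
    and y1: "y1 \<in> V" "D y1 \<noteq> 0" "b 0 y1 \<noteq> 0"
  shows "poly (eig_poly D m y0) (f y1) = 0"
proof -
  let ?\<chi> = "char_poly (seg_mat y0 y1 m)"
  obtain \<kappa> where \<kappa>: "\<And>i. i \<le> s \<Longrightarrow> coeff ?\<chi> (s - i) = smult (\<kappa> i) (on_seg y0 y1 D ^ i)"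
    using char_poly_constant_ratio[OF R int] by blast
  define M where "M y = mat s s (\<lambda>(j, l). m j l y)" for y
  have at: "char_poly (M (seg y0 y1 z)) = map_poly (\<lambda>p. poly p z) ?\<chi>" for z
  proof -
    have h: "comm_ring_hom (\<lambda>p :: 'k poly. poly p z)" by unfold_locales auto
    have "map_mat (\<lambda>p. poly p z) (seg_mat y0 y1 m) = M (seg y0 y1 z)"
      by (intro eq_matI) (auto simp: M_def intro!: poly_on_seg repD(3)[OF R(1)])
    then show ?thesis using comm_ring_hom.char_poly_hom[OF h, of "seg_mat y0 y1 m" s] by simp
  qed
  have co: "coeff (char_poly (M (seg y0 y1 z))) (s - i) = \<kappa> i * D (seg y0 y1 z) ^ i" if "i \<le> s" for z i
    unfolding at by (simp add: coeff_map_poly \<kappa>[OF that] poly_on_seg[OF repD(1)[OF R(1)]])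
  have Q: "eig_poly D m y0 = (\<Sum>i\<le>s. monom (\<kappa> i) (s - i))"
    unfolding eig_poly_def using co[of _ 0] R(2) by (intro sum.cong) (auto simp: M_def)
  \<comment> \<open>At a point of \<open>V\<close> the values of the basis form an eigenvector; it
    is nonzero because \<open>b 0 y1\<close> is.\<close>
  define v where "v = vec s (\<lambda>l. b l y1)"
  have "eigenvalue (M y1) (D y1 * f y1)"
    unfolding eigenvalue_def eigenvector_def
  proof (intro exI[of _ v] conjI)
    show "v \<in> carrier_vec (dim_row (M y1))" by (simp add: v_def M_def)
    have "v $ 0 \<noteq> 0" using y1(3) s_pos by (simp add: v_def)
    then show "v \<noteq> 0\<^sub>v (dim_row (M y1))" using s_pos by (auto simp: M_def)
    show "M y1 *\<^sub>v v = (D y1 * f y1) \<cdot>\<^sub>v v"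
    proof (rule eq_vecI)
      fix i assume "i < dim_vec ((D y1 * f y1) \<cdot>\<^sub>v v)"
      then have i: "i < s" by (simp add: v_def)
      then have "(M y1 *\<^sub>v v) $ i = (\<Sum>l<s. m i l y1 * b l y1)"
        by (simp add: M_def v_def scalar_prod_def atLeast0LessThan)
      then show "(M y1 *\<^sub>v v) $ i = ((D y1 * f y1) \<cdot>\<^sub>v v) $ i"
        using repD(4)[OF R(1) i y1(1)] i by (simp add: v_def mult.assoc)
    qed (simp add: M_def v_def)
  qed
  then have "poly (char_poly (M y1)) (D y1 * f y1) = 0"
    using eigenvalue_root_char_poly[of "M y1" s] by (simp add: M_def)
  moreover have "degree (char_poly (M y1)) = s"
    using degree_monic_char_poly[of "M y1" s] by (simp add: M_def)
  ultimately have "0 = (\<Sum>i\<le>s. coeff (char_poly (M y1)) i * (D y1 * f y1) ^ i)"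
    by (simp add: poly_altdef)
  also have "\<dots> = (\<Sum>i\<le>s. coeff (char_poly (M y1)) (s - i) * (D y1 * f y1) ^ (s - i))"
    by (rule sum.reindex_bij_witness[of _ "\<lambda>i. s - i" "\<lambda>i. s - i"]) auto
  also have "\<dots> = (\<Sum>i\<le>s. D y1 ^ s * (\<kappa> i * f y1 ^ (s - i)))"
  proof (rule sum.cong[OF refl])
    fix i assume "i \<in> {..s}"
    then have i: "i \<le> s" by simp
    then have "D y1 ^ s = D y1 ^ i * D y1 ^ (s - i)" by (simp flip: power_add)
    then show "coeff (char_poly (M y1)) (s - i) * (D y1 * f y1) ^ (s - i) = D y1 ^ s * (\<kappa> i * f y1 ^ (s - i))"
      using co[OF i, of 1] by (simp add: power_mult_distrib)
  qed
  also have "\<dots> = D y1 ^ s * poly (eig_poly D m y0) (f y1)"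
    by (simp add: Q poly_sum poly_monom sum_distrib_left)
  finally show ?thesis using y1(2) by simp
qed

end

section \<open>Multiplicative relations between units\<close>

context torus_subset
begin

lemma reg_prod: "(\<And>i. i \<in> I \<Longrightarrow> reg (u i)) \<Longrightarrow> reg (\<lambda>x. \<Prod>i\<in>I. u i x)"
  by (induction I rule: infinite_finite_induct) (simp_all add: reg_mult reg_pf pf.const)

lemma reg_power: "reg u \<Longrightarrow> reg (\<lambda>x. u x ^ k)"
  by (induction k) (simp_all add: reg_mult reg_pf pf.const)

lemma reg_powi:
  assumes "reg u" "\<And>x. x \<in> V \<Longrightarrow> u x \<noteq> 0"
  shows "reg (\<lambda>x. u x powi k)"
  using reg_power[OF assms(1), of "nat k"] reg_power[OF reg_inverse[OF assms], of "nat (- k)"]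
  by (cases "k \<ge> 0") (simp_all add: power_int_def)

lemma reg_diff_const:
  assumes "reg u" shows "reg (\<lambda>x. u x - a)"
proof (rule regI)
  fix x assume "x \<in> V"
  obtain p q where pq: "p \<in> pf {..<n}" "q \<in> pf {..<n}" "q x \<noteq> 0" "\<forall>y\<in>V. q y * u y = p y"
    by (rule regE[OF assms \<open>x \<in> V\<close>])
  have "(\<lambda>y. p y - a * q y) \<in> pf {..<n}"
    by (rule pf_diff[OF pq(1) pf.mult[OF pf.const pq(2)]])
  then show "\<exists>p q. p \<in> pf {..<n} \<and> q \<in> pf {..<n} \<and> q x \<noteq> 0 \<and> (\<forall>y\<in>V. q y * (u y - a) = p y)"
    using pq by (intro exI[of _ "\<lambda>y. p y - a * q y"] exI[of _ q]) (simp add: algebra_simps)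
qed

end

context torus_basis
begin

text \<open>One representation per function is fixed, so that the denominators to be avoided by the
  endpoints form an explicit finite set.\<close>

definition RD :: "((nat \<Rightarrow> 'k) \<Rightarrow> 'k) \<Rightarrow> (nat \<Rightarrow> 'k) \<Rightarrow> 'k" where
  "RD f = (SOME D. \<exists>m. rep D m f)"

definition RM :: "((nat \<Rightarrow> 'k) \<Rightarrow> 'k) \<Rightarrow> nat \<Rightarrow> nat \<Rightarrow> (nat \<Rightarrow> 'k) \<Rightarrow> 'k" where
  "RM f = (SOME m. rep (RD f) m f)"

lemma rep_RD:
  assumes "ok f" shows "rep (RD f) (RM f) f"
proof -
  have "\<exists>m. rep (RD f) m f" unfolding RD_def by (rule someI_ex[OF ok_rep[OF assms]])
  then show ?thesis unfolding RM_def by (rule someI_ex)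
qed

lemma rep_degree_bound:
  assumes "rep D m f"
  shows "\<exists>d. \<forall>y0 y1. degree (on_seg y0 y1 D) \<le> d \<and> (\<forall>j<s. \<forall>l<s. degree (on_seg y0 y1 (m j l)) \<le> d)"
proof -
  obtain d0 where d0: "\<And>y0 y1. degree (on_seg y0 y1 D) \<le> d0"
    using degree_on_seg[OF repD(1)[OF assms]] by blast
  have "\<forall>jl\<in>{..<s} \<times> {..<s}. \<exists>d. \<forall>y0 y1. degree (on_seg y0 y1 (m (fst jl) (snd jl))) \<le> d"
    using degree_on_seg[OF repD(3)[OF assms]] by auto
  from bchoice[OF this] obtain d where
    d: "\<forall>jl\<in>{..<s} \<times> {..<s}. \<forall>y0 y1. degree (on_seg y0 y1 (m (fst jl) (snd jl))) \<le> d jl" by (elim exE)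
  let ?d = "d0 + (\<Sum>jl\<in>{..<s} \<times> {..<s}. d jl)"
  have "degree (on_seg y0 y1 (m j l)) \<le> ?d" if "j < s" "l < s" for y0 y1 j l
  proof -
    have "degree (on_seg y0 y1 (m j l)) \<le> d (j, l)" using d that by auto
    also have "\<dots> \<le> (\<Sum>jl\<in>{..<s} \<times> {..<s}. d jl)" using that by (intro member_le_sum) auto
    finally show ?thesis by simp
  qed
  then show ?thesis using d0 by (intro exI[of _ ?d]) (auto intro: trans_le_add1)
qed

end

text \<open>The indices up to \<open>r\<close> provide \<open>r + 1\<close> unknowns for at most
  \<open>r\<close> equations.\<close>

lemma integer_orthogonal:
  fixes Z :: "(nat \<Rightarrow> int) set"
  assumes "finite Z" "card Z \<le> r"
  shows "\<exists>e. (\<exists>i\<le>r. e i \<noteq> 0) \<and> (\<forall>v\<in>Z. (\<Sum>i\<le>r. e i * v i) = 0)"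
proof -
  obtain h where h: "bij_betw h {..<card Z} Z"
    using ex_bij_betw_nat_finite[OF assms(1)] by (auto simp: atLeast0LessThan)
  obtain e where e: "\<exists>i\<in>{..r}. e i \<noteq> 0" "\<forall>j<card Z. (\<Sum>i\<in>{..r}. e i * h j i) = 0"
    using linear_dependence_idom[of "{..r}" "card Z" "\<lambda>i j. h j i"] assms(2) by auto
  have "(\<Sum>i\<le>r. e i * v i) = 0" if vZ: "v \<in> Z" for v
  proof -
    obtain j where "j < card Z" "v = h j" using h vZ unfolding bij_betw_def by auto
    then show ?thesis using e(2) by simp
  qed
  then show ?thesis using e(1) by auto
qed

context torus_places
begin

lemma Eg_power: "Eg y0 y1 c w f \<rho> \<Longrightarrow> Eg y0 y1 c w (\<lambda>x. f x ^ k) (\<rho> ^ k)"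
proof (induction k)
  case 0
  then show ?case using Eg_const[of y0 y1 c w 1] by simp
next
  case (Suc k)
  then show ?case by (simp add: Eg_mult)
qed

lemma Eg_powi:
  assumes f: "Eg y0 y1 c w f \<rho>" and g: "Eg y0 y1 c w (\<lambda>x. inverse (f x)) \<sigma>"
    and nz: "\<And>x. x \<in> V \<Longrightarrow> f x \<noteq> 0" and w: "\<exists>j<s. w j \<noteq> 0"
  shows "Eg y0 y1 c w (\<lambda>x. f x powi k) (\<rho> powi k)" "\<rho> \<noteq> 0"
proof -
  have "\<rho> * \<sigma> = fls_const 1"
    by (rule Eg_unique[OF Eg_mult[OF f g] Eg_const[of y0 y1 c w 1] _ w]) (use nz in simp)
  then have 1: "\<rho> * \<sigma> = 1" by simp
  then show "\<rho> \<noteq> 0" by auto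
  have \<sigma>: "\<sigma> = inverse \<rho>" using 1 by (metis inverse_unique)
  show "Eg y0 y1 c w (\<lambda>x. f x powi k) (\<rho> powi k)"
    using Eg_power[OF f, of "nat k"] Eg_power[OF g, of "nat (- k)"]
    by (cases "k \<ge> 0") (simp_all add: power_int_def \<sigma>)
qed

lemma Eg_prod:
  "(\<And>i. i \<in> I \<Longrightarrow> Eg y0 y1 c w (f i) (\<rho> i)) \<Longrightarrow> Eg y0 y1 c w (\<lambda>x. \<Prod>i\<in>I. f i x) (\<Prod>i\<in>I. \<rho> i)"
proof (induction I rule: infinite_finite_induct)
  case (insert i I)
  then show ?case by (simp add: Eg_mult)
qed (use Eg_const[of y0 y1 c w 1] in simp_all)

text \<open>\<open>witness y0 y1 c u r \<alpha> v\<close>: the values at the place \<open>c\<close> of the units \<open>u i\<close> under a common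
  eigenvector with eigenvalues \<open>\<alpha> i\<close> of the coordinates form the vector \<open>v\<close>.\<close>

definition witness where
  "witness y0 y1 c u r \<alpha> v \<longleftrightarrow> (\<exists>w \<beta>. (\<exists>j<s. w j \<noteq> 0) \<and> (\<forall>i<n. Eg y0 y1 c w (\<lambda>x. x i) (\<alpha> i)) \<and>
     (\<forall>i\<le>r. Eg y0 y1 c w (u i) (\<beta> i)) \<and> (\<forall>i\<le>r. \<exists>\<beta>'. Eg y0 y1 c w (\<lambda>x. inverse (u i x)) \<beta>') \<and>
     v = (\<lambda>i. if i \<le> r then fls_subdegree (\<beta> i) else 0))"

lemma witnessE:
  assumes "witness y0 y1 c u r \<alpha> v"
  obtains w \<beta> where "\<exists>j<s. w j \<noteq> 0" "\<forall>i<n. Eg y0 y1 c w (\<lambda>x. x i) (\<alpha> i)"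
    "\<forall>i\<le>r. Eg y0 y1 c w (u i) (\<beta> i)" "\<forall>i\<le>r. \<exists>\<beta>'. Eg y0 y1 c w (\<lambda>x. inverse (u i x)) \<beta>'"
    "v = (\<lambda>i. if i \<le> r then fls_subdegree (\<beta> i) else 0)"
proof -
  obtain w \<beta> where w: "(\<exists>j<s. w j \<noteq> 0) \<and> (\<forall>i<n. Eg y0 y1 c w (\<lambda>x. x i) (\<alpha> i)) \<and>
     (\<forall>i\<le>r. Eg y0 y1 c w (u i) (\<beta> i)) \<and> (\<forall>i\<le>r. \<exists>\<beta>'. Eg y0 y1 c w (\<lambda>x. inverse (u i x)) \<beta>') \<and>
     v = (\<lambda>i. if i \<le> r then fls_subdegree (\<beta> i) else 0)"
    using assms unfolding witness_def by (elim exE)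
  show ?thesis
    by (rule that[OF w[THEN conjunct1] w[THEN conjunct2, THEN conjunct1]
      w[THEN conjunct2, THEN conjunct2, THEN conjunct1]
      w[THEN conjunct2, THEN conjunct2, THEN conjunct2, THEN conjunct1]
      w[THEN conjunct2, THEN conjunct2, THEN conjunct2, THEN conjunct2]])
qed

text \<open>Each unit is a polynomial divided by some \<open>\<Delta> i\<close> in
  \<open>pf T\<close> that stays nonzero on the line. Its eigenvalue is therefore determined by the
  eigenvalues of the coordinates.\<close>

lemma witness_unique:
  assumes "witness y0 y1 c u r \<alpha> v" "witness y0 y1 c u r \<alpha> v'"
    and \<Delta>: "\<And>i. i \<le> r \<Longrightarrow> \<Delta> i \<in> pf T" "\<And>i. i \<le> r \<Longrightarrow> \<Delta> i y0 \<noteq> 0" "\<And>i. i \<le> r \<Longrightarrow> p i \<in> pf {..<n}"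
      "\<And>i x. i \<le> r \<Longrightarrow> x \<in> V \<Longrightarrow> \<Delta> i x * u i x = p i x"
  shows "v = v'"
proof -
  obtain w \<beta> where w: "\<exists>j<s. w j \<noteq> 0" "\<forall>i<n. Eg y0 y1 c w (\<lambda>x. x i) (\<alpha> i)" "\<forall>i\<le>r. Eg y0 y1 c w (u i) (\<beta> i)"
    "v = (\<lambda>i. if i \<le> r then fls_subdegree (\<beta> i) else 0)"
    using assms(1) by (rule witnessE)
  obtain w' \<beta>' where w': "\<exists>j<s. w' j \<noteq> 0" "\<forall>i<n. Eg y0 y1 c w' (\<lambda>x. x i) (\<alpha> i)" "\<forall>i\<le>r. Eg y0 y1 c w' (u i) (\<beta>' i)"
    "v' = (\<lambda>i. if i \<le> r then fls_subdegree (\<beta>' i) else 0)"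
    using assms(2) by (rule witnessE)
  have "\<beta> i = \<beta>' i" if i: "i \<le> r" for i
  proof -
    obtain \<rho> where \<rho>: "Eg y0 y1 c w (p i) \<rho>" "Eg y0 y1 c w' (p i) \<rho>"
      using Eg_pf[OF \<Delta>(3)[OF i], of y0 y1 c w \<alpha> w'] w(2) w'(2) by blast
    have "sp y0 y1 c (\<Delta> i) * \<beta> i = \<rho>"
      by (rule Eg_unique[OF Eg_mult[OF Eg_pf_T[OF \<Delta>(1)[OF i]] w(3)[rule_format, OF i]] \<rho>(1) \<Delta>(4)[OF i] w(1)])
    moreover have "sp y0 y1 c (\<Delta> i) * \<beta>' i = \<rho>"
      by (rule Eg_unique[OF Eg_mult[OF Eg_pf_T[OF \<Delta>(1)[OF i]] w'(3)[rule_format, OF i]] \<rho>(2) \<Delta>(4)[OF i] w'(1)])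
    ultimately show ?thesis using sp_nonzero[OF \<Delta>(1)[OF i] \<Delta>(2)[OF i], of y1 c] by (metis mult_cancel_left)
  qed
  then show ?thesis using w(4) w'(4) by (auto simp: fun_eq_iff)
qed

lemma eigenvalues_finite:
  fixes y0 y1 :: "nat \<Rightarrow> 'k" and c :: "'k option"
  assumes "rep D m f" "D y0 \<noteq> 0"
  defines "A \<equiv> {\<alpha>. \<exists>w. (\<exists>j<s. w j \<noteq> 0) \<and> Eg y0 y1 c w f \<alpha>}"
  shows "finite A" "card A \<le> s"
proof -
  let ?p = "char_poly (mat s s (\<lambda>(j, l). sp y0 y1 c (m j l)))"
  let ?g = "\<lambda>\<alpha>. sp y0 y1 c D * \<alpha>"
  have p: "degree ?p = s" "coeff ?p s = 1"
    using degree_monic_char_poly[of "mat s s (\<lambda>(j, l). sp y0 y1 c (m j l))" s] by auto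
  then have p0: "?p \<noteq> 0" by auto
  have sub: "?g ` A \<subseteq> {x. poly ?p x = 0}"
    using Eg_root[OF _ assms(1), of y0 y1 c] unfolding A_def by auto
  have inj: "inj_on ?g A"
    using sp_nonzero[OF repD(1)[OF assms(1)] assms(2), of y1 c] by (intro inj_onI) simp
  have fin: "finite {x. poly ?p x = 0}" by (rule poly_roots_finite[OF p0])
  show "finite A" using finite_imageD[OF finite_subset[OF sub fin] inj] .
  have "card A = card (?g ` A)" by (rule card_image[OF inj, symmetric])
  also have "\<dots> \<le> card {x. poly ?p x = 0}" by (rule card_mono[OF fin sub])
  also have "\<dots> \<le> s" using card_poly_roots_bound[OF p0] p(1) by simp
  finally show "card A \<le> s" .
qed

text \<open>The vectors are counted through the tuples \<open>\<alpha>\<close>: each of the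
  \<open>n\<close> entries has at most \<open>s\<close> possible values, and by
  \<open>witness_unique\<close> a tuple determines its vector.\<close>

lemma witness_card:
  assumes X: "\<And>i. i < n \<Longrightarrow> RD (\<lambda>x. x i) y0 \<noteq> 0"
    and \<Delta>: "\<And>i. i \<le> r \<Longrightarrow> \<Delta> i \<in> pf T" "\<And>i. i \<le> r \<Longrightarrow> \<Delta> i y0 \<noteq> 0" "\<And>i. i \<le> r \<Longrightarrow> p i \<in> pf {..<n}"
      "\<And>i x. i \<le> r \<Longrightarrow> x \<in> V \<Longrightarrow> \<Delta> i x * u i x = p i x"
  shows "finite {v. \<exists>\<alpha>. witness y0 y1 c u r \<alpha> v}" "card {v. \<exists>\<alpha>. witness y0 y1 c u r \<alpha> v} \<le> s ^ n"
proof -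
  define A where "A i = {\<alpha>. \<exists>w. (\<exists>j<s. w j \<noteq> 0) \<and> Eg y0 y1 c w (\<lambda>x. x i) \<alpha>}" for i
  have A: "finite (A i)" "card (A i) \<le> s" if i: "i < n" for i
  proof -
    have "(\<lambda>x. x i) \<in> pf {..<n}" using i by (intro pf.coord) simp
    from eigenvalues_finite[OF rep_RD[OF ok_pf[OF this]] X[OF i], of y1 c]
    show "finite (A i)" "card (A i) \<le> s" unfolding A_def .
  qed
  define P where "P = (\<Pi>\<^sub>E i\<in>{..<n}. A i)"
  have finP: "finite P" unfolding P_def using A by (intro finite_PiE) auto
  have cardP: "card P \<le> s ^ n"
  proof -
    have "card P = (\<Prod>i<n. card (A i))" unfolding P_def by (simp add: card_PiE)
    also have "\<dots> \<le> (\<Prod>i<n. s)" using A by (intro prod_mono) auto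
    finally show ?thesis by simp
  qed
  have sub: "{v. \<exists>\<alpha>. witness y0 y1 c u r \<alpha> v} \<subseteq> (\<lambda>\<alpha>. SOME v. witness y0 y1 c u r \<alpha> v) ` P"
  proof
    fix v assume "v \<in> {v. \<exists>\<alpha>. witness y0 y1 c u r \<alpha> v}"
    then obtain \<alpha> where \<alpha>: "witness y0 y1 c u r \<alpha> v" by blast
    let ?\<alpha> = "restrict \<alpha> {..<n}"
    have wit: "witness y0 y1 c u r ?\<alpha> v" using \<alpha> unfolding witness_def by simp
    obtain w where w: "\<exists>j<s. w j \<noteq> 0" "\<forall>i<n. Eg y0 y1 c w (\<lambda>x. x i) (\<alpha> i)"
      using \<alpha> by (rule witnessE)
    have "\<alpha> i \<in> A i" if "i < n" for i
      unfolding A_def using w(1) w(2)[rule_format, OF that] by (intro CollectI exI[of _ w] conjI)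
    then have "?\<alpha> \<in> P" unfolding P_def by auto
    moreover have "(SOME v. witness y0 y1 c u r ?\<alpha> v) = v"
      by (rule witness_unique[OF someI[of "witness y0 y1 c u r ?\<alpha>", OF wit] wit \<Delta>])
    ultimately show "v \<in> (\<lambda>\<alpha>. SOME v. witness y0 y1 c u r \<alpha> v) ` P" by (metis imageI)
  qed
  show "finite {v. \<exists>\<alpha>. witness y0 y1 c u r \<alpha> v}" by (rule finite_surj[OF finP sub])
  show "card {v. \<exists>\<alpha>. witness y0 y1 c u r \<alpha> v} \<le> s ^ n" using surj_card_le[OF finP sub] cardP by simp
qed

text \<open>Restricted to the line from a general point \<open>y0\<close> to a general point \<open>y1\<close> of \<open>V\<close>, units have integral
  eigenvalues except over the zeros of \<open>G\<close> and infinity, at most \<open>B + 1\<close> places, each carrying at most \<open>s ^ n\<close>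
  vectors of valuations. An exponent vector orthogonal to all of these yields a unit whose characteristic
  polynomial is constant along the line, so that its value at \<open>y1\<close> is a root of \<open>Q Z\<close>, which depends on \<open>y0\<close>
  only. The valuations are bounded independently of the line, so only finitely many sets \<open>Z\<close> of vectors can
  occur, and \<open>y1\<close> is chosen to avoid all roots of all \<open>Q Z\<close>.\<close>

theorem unit_relation:
  "\<exists>r. \<forall>u. (\<forall>i\<le>r. reg (u i)) \<and> (\<forall>i\<le>r. \<forall>x\<in>V. u i x \<noteq> 0) \<longrightarrow>
     (\<exists>e :: nat \<Rightarrow> int. (\<exists>i\<le>r. e i \<noteq> 0) \<and> (\<exists>c. \<forall>x\<in>V. (\<Prod>i\<le>r. u i x powi e i) = c))"
proof -
  define X Y :: "nat \<Rightarrow> (nat \<Rightarrow> 'k) \<Rightarrow> 'k" where "X i = (\<lambda>x. x i)" and "Y i = (\<lambda>x. inverse (x i))" for i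
  have okX: "ok (X i)" and okY: "ok (Y i)" if "i < n" for i
  proof -
    have pfX: "X i \<in> pf {..<n}" unfolding X_def using that by (intro pf.coord) simp
    show "ok (X i)" by (rule ok_pf[OF pfX])
    show "ok (Y i)" unfolding Y_def
      by (rule ok_reg[OF reg_inverse[OF reg_pf[OF pfX, unfolded X_def]]]) (use V_torus that in blast)
  qed
  note repX = rep_RD[OF okX] and repY = rep_RD[OF okY]
  \<comment> \<open>At a finite place that is not a zero of \<open>G\<close>, the coordinates and
    their inverses have integral eigenvalues.\<close>
  define G where "G x = (\<Prod>i<n. RD (X i) x * RD (Y i) x)" for x
  have G_pf: "G \<in> pf T" unfolding G_def[abs_def]
    by (rule pf_prod, rule pf.mult) (use repD(1)[OF repX] repD(1)[OF repY] in simp_all)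
  obtain B where B: "\<And>y0 y1. degree (on_seg y0 y1 G) \<le> B" using degree_on_seg[OF G_pf] by blast
  \<comment> \<open>\<open>B\<close> bounds the number of zeros of \<open>G\<close> on a line, 1
    counts infinity, and \<open>s ^ n\<close> bounds the vectors at each place. None of these
    involves \<open>u\<close>.\<close>
  define r where "r = (B + 1) * s ^ n"
  have "\<exists>e :: nat \<Rightarrow> int. (\<exists>i\<le>r. e i \<noteq> 0) \<and> (\<exists>c. \<forall>x\<in>V. (\<Prod>i\<le>r. u i x powi e i) = c)"
    if u: "\<forall>i\<le>r. reg (u i)" "\<forall>i\<le>r. \<forall>x\<in>V. u i x \<noteq> 0" for u
  proof -
    define u' where "u' i = (\<lambda>x. inverse (u i x))" for i
    have reg_u': "reg (u' i)" if "i \<le> r" for i unfolding u'_def using u that by (intro reg_inverse) auto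
    have rep_u: "rep (RD (u i)) (RM (u i)) (u i)" and rep_u': "rep (RD (u' i)) (RM (u' i)) (u' i)"
      if "i \<le> r" for i using u(1) reg_u' that by (auto intro: rep_RD ok_reg)
    have "\<forall>i\<in>{..r}. \<exists>d. (\<forall>y0 y1. degree (on_seg y0 y1 (RD (u i))) \<le> d \<and> (\<forall>j<s. \<forall>l<s. degree (on_seg y0 y1 (RM (u i) j l)) \<le> d))"
      using rep_degree_bound[OF rep_u] by simp
    from bchoice[OF this] obtain d where d: "\<forall>i\<in>{..r}. \<forall>y0 y1. degree (on_seg y0 y1 (RD (u i))) \<le> d i \<and> (\<forall>j<s. \<forall>l<s. degree (on_seg y0 y1 (RM (u i) j l)) \<le> d i)"
      by (elim exE)
    have "\<forall>i\<in>{..r}. \<exists>d. (\<forall>y0 y1. degree (on_seg y0 y1 (RD (u' i))) \<le> d \<and> (\<forall>j<s. \<forall>l<s. degree (on_seg y0 y1 (RM (u' i) j l)) \<le> d))"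
      using rep_degree_bound[OF rep_u'] by simp
    from bchoice[OF this] obtain d' where d': "\<forall>i\<in>{..r}. \<forall>y0 y1. degree (on_seg y0 y1 (RD (u' i))) \<le> d' i \<and> (\<forall>j<s. \<forall>l<s. degree (on_seg y0 y1 (RM (u' i) j l)) \<le> d' i)"
      by (elim exE)
    define \<delta> where "\<delta> = (\<Sum>i\<le>r. d i + d' i)"
    have "d i + d' i \<le> \<delta>" if "i \<le> r" for i
      unfolding \<delta>_def using that by (intro member_le_sum[of i "{..r}" "\<lambda>i. d i + d' i"]) auto
    then have d_le: "d i \<le> \<delta>" "d' i \<le> \<delta>" if "i \<le> r" for i using that by (meson add_leD1 add_leD2)+
    have deg_u: "degree (on_seg y0 y1 (RD (u i))) \<le> \<delta>"
      "j < s \<Longrightarrow> l < s \<Longrightarrow> degree (on_seg y0 y1 (RM (u i) j l)) \<le> \<delta>" if i: "i \<le> r" for i j l y0 y1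
      by (rule order_trans[OF _ d_le(1)[OF i]], use d i in simp)+
    have deg_u': "degree (on_seg y0 y1 (RD (u' i))) \<le> \<delta>"
      "j < s \<Longrightarrow> l < s \<Longrightarrow> degree (on_seg y0 y1 (RM (u' i) j l)) \<le> \<delta>" if i: "i \<le> r" for i j l y0 y1
      by (rule order_trans[OF _ d_le(2)[OF i]], use d' i in simp)+
    define K where "K = int (2 * E * \<delta>)"
    define box where "box = {v :: nat \<Rightarrow> int. (\<forall>i\<le>r. v i \<in> {-K..K}) \<and> (\<forall>i>r. v i = 0)}"
    have fin_box: "finite box"
    proof (rule finite_subset)
      show "box \<subseteq> (\<lambda>f i. if i \<le> r then f i else 0) ` (\<Pi>\<^sub>E i\<in>{..r}. {-K..K})"
      proof
        fix v assume "v \<in> box"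
        then have v: "v = (\<lambda>i. if i \<le> r then restrict v {..r} i else 0)" "restrict v {..r} \<in> (\<Pi>\<^sub>E i\<in>{..r}. {-K..K})"
          by (auto simp: box_def)
        show "v \<in> (\<lambda>f i. if i \<le> r then f i else 0) ` (\<Pi>\<^sub>E i\<in>{..r}. {-K..K})" by (rule image_eqI[where x = "restrict v {..r}"]) (rule v)+
      qed
    qed (intro finite_imageI finite_PiE; simp)
    \<comment> \<open>These are all sets of valuation vectors that some line may produce. Choosing
      \<open>e\<close> on all of them fixes the candidate exponents before the line.\<close>
    define ZZ where "ZZ = {Z. Z \<subseteq> box \<and> card Z \<le> r}"
    have fin_ZZ: "finite ZZ" by (rule finite_subset[of _ "Pow box"]) (use fin_box in \<open>auto simp: ZZ_def\<close>)
    have "\<forall>Z\<in>ZZ. \<exists>e. (\<exists>i\<le>r. e i \<noteq> 0) \<and> (\<forall>v\<in>Z. (\<Sum>i\<le>r. e i * v i) = 0)"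
      using integer_orthogonal finite_subset[OF _ fin_box] by (auto simp: ZZ_def)
    from bchoice[OF this] obtain e where e: "\<forall>Z\<in>ZZ. (\<exists>i\<le>r. e Z i \<noteq> 0) \<and> (\<forall>v\<in>Z. (\<Sum>i\<le>r. e Z i * v i) = 0)"
      by (elim exE)
    define U where "U Z x = (\<Prod>i\<le>r. u i x powi e Z i)" for Z x
    show ?thesis
    proof (rule ccontr)
      \<comment> \<open>Under this assumption none of the finitely many candidates
        \<open>U Z\<close> is constant on \<open>V\<close>.\<close>
      assume contra: "\<not> ?thesis"
      have nonconst: "\<exists>x\<in>V. U Z x \<noteq> a" if "Z \<in> ZZ" for Z a
        using contra e that unfolding U_def by blast
      have regU: "reg (U Z)" for Z unfolding U_def[abs_def] using u by (intro reg_prod reg_powi) auto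
      have repU: "rep (RD (U Z)) (RM (U Z)) (U Z)" for Z by (rule rep_RD[OF ok_reg[OF regU]])
      have "\<forall>i\<in>{..r}. \<exists>D p. D \<in> pf T \<and> D \<noteq> 0 \<and> p \<in> pf {..<n} \<and> (\<forall>x\<in>V. D x * u i x = p x)"
        using reg_over_T u(1) by simp
      from bchoice[OF this] obtain \<Delta> where
        "\<forall>i\<in>{..r}. \<exists>p. \<Delta> i \<in> pf T \<and> \<Delta> i \<noteq> 0 \<and> p \<in> pf {..<n} \<and> (\<forall>x\<in>V. \<Delta> i x * u i x = p x)" by (elim exE)
      from bchoice[OF this] obtain p where
        \<Delta>p: "\<forall>i\<in>{..r}. \<Delta> i \<in> pf T \<and> \<Delta> i \<noteq> 0 \<and> p i \<in> pf {..<n} \<and> (\<forall>x\<in>V. \<Delta> i x * u i x = p i x)" by (elim exE)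
      have \<Delta>: "\<And>i. i \<le> r \<Longrightarrow> \<Delta> i \<in> pf T" "\<And>i. i \<le> r \<Longrightarrow> \<Delta> i \<noteq> 0" "\<And>i. i \<le> r \<Longrightarrow> p i \<in> pf {..<n}"
        "\<And>i x. i \<le> r \<Longrightarrow> x \<in> V \<Longrightarrow> \<Delta> i x * u i x = p i x" using \<Delta>p by simp_all
      \<comment> \<open>Since \<open>y0\<close> avoids the zeros of all these denominators, they
        restrict to nonzero polynomials on every line through \<open>y0\<close>.\<close>
      define DD where "DD = (RD \<circ> X) ` {..<n} \<union> (RD \<circ> Y) ` {..<n} \<union> (RD \<circ> u) ` {..r} \<union> (RD \<circ> u') ` {..r} \<union> \<Delta> ` {..r} \<union> (RD \<circ> U) ` ZZ"
      have finDD: "finite DD" unfolding DD_def using fin_ZZ by blast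
      have DD_T: "f \<in> pf T \<and> f \<noteq> 0" if "f \<in> DD" for f
        using that \<Delta>(1,2) repD(1,2)[OF repX] repD(1,2)[OF repY] repD(1,2)[OF rep_u] repD(1,2)[OF rep_u'] repD(1,2)[OF repU]
        unfolding DD_def by auto
      obtain y0 where y0: "\<forall>f\<in>DD. f y0 \<noteq> 0"
        using nonzero_prod[OF finDD, of "\<lambda>f. f"] DD_T pf_T nonzero_on_V by blast
      have y0X: "RD (X i) y0 \<noteq> 0" "RD (Y i) y0 \<noteq> 0" if "i < n" for i
        using y0 that unfolding DD_def by auto
      have y0u: "RD (u i) y0 \<noteq> 0" "RD (u' i) y0 \<noteq> 0" "\<Delta> i y0 \<noteq> 0" if "i \<le> r" for i
        using y0 that unfolding DD_def by auto
      have y0U: "RD (U Z) y0 \<noteq> 0" if "Z \<in> ZZ" for Z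
        using y0 that unfolding DD_def by auto
      have "\<forall>Z. \<exists>D p. D \<in> pf T \<and> D \<noteq> 0 \<and> p \<in> pf {..<n} \<and> (\<forall>x\<in>V. D x * U Z x = p x)"
        using reg_over_T[OF regU] by blast
      from choice[OF this] obtain \<Gamma> where
        "\<forall>Z. \<exists>p. \<Gamma> Z \<in> pf T \<and> \<Gamma> Z \<noteq> 0 \<and> p \<in> pf {..<n} \<and> (\<forall>x\<in>V. \<Gamma> Z x * U Z x = p x)" by (elim exE)
      from choice[OF this] obtain q where
        \<Gamma>: "\<forall>Z. \<Gamma> Z \<in> pf T \<and> \<Gamma> Z \<noteq> 0 \<and> q Z \<in> pf {..<n} \<and> (\<forall>x\<in>V. \<Gamma> Z x * U Z x = q Z x)" by (elim exE)
      define Q where "Q Z = eig_poly (RD (U Z)) (RM (U Z)) y0" for Z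
      \<comment> \<open>On \<open>V\<close> this is \<open>\<Gamma> Z\<close> times the difference
        of \<open>U Z\<close> and \<open>a\<close>. A point off its zeros is one where
        \<open>U Z\<close> does not take the value \<open>a\<close>.\<close>
      define h where "h = (\<lambda>(Z, a) x. q Z x - a * \<Gamma> Z x)"
      define FF where "FF = {b 0} \<union> (RD \<circ> U) ` ZZ \<union> h ` (SIGMA Z:ZZ. {a. poly (Q Z) a = 0})"
      have finFF: "finite FF" unfolding FF_def Q_def
        using fin_ZZ poly_roots_finite[OF eig_poly_nonzero] by (intro finite_UnI finite_imageI finite_SigmaI) auto
      have h_pf: "h (Z, a) \<in> pf {..<n}" for Z a
      proof -
        have "(\<lambda>x. q Z x - a * \<Gamma> Z x) \<in> pf {..<n}"
          by (rule pf_diff[OF _ pf.mult[OF pf.const pf_T]]) (use \<Gamma> in blast)+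
        then show ?thesis by (simp add: h_def)
      qed
      have h_nz: "\<exists>x\<in>V. h (Z, a) x \<noteq> 0" if Z: "Z \<in> ZZ" for Z a
      proof (rule ccontr)
        assume "\<not> ?thesis"
        then have z: "\<And>x. x \<in> V \<Longrightarrow> q Z x - a * \<Gamma> Z x = 0" by (auto simp: h_def)
        have "U Z x - a = 0" if x: "x \<in> V" for x
        proof (rule reg_eq_0[OF reg_diff_const[OF regU] _ _ _ x])
          show "\<Gamma> Z \<in> pf {..<n}" "\<exists>x\<in>V. \<Gamma> Z x \<noteq> 0" using \<Gamma> pf_T nonzero_on_V by blast+
          show "\<Gamma> Z x * (U Z x - a) = 0" if "x \<in> V" for x
            using z[OF that] \<Gamma> that by (simp add: right_diff_distrib mult.commute[of a])
        qed
        then show False using nonconst[OF Z, of a] by auto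
      qed
      have FF_nz: "f \<in> pf {..<n} \<and> (\<exists>x\<in>V. f x \<noteq> 0)" if f: "f \<in> FF" for f
      proof -
        consider "f = b 0" | Z where "f = RD (U Z)" | Z a where "Z \<in> ZZ" "f = h (Z, a)"
          using f unfolding FF_def by auto
        then show ?thesis
        proof cases
          case 1
          then show ?thesis using b_poly[OF s_pos] b0_nonzero by simp
        next
          case 2
          then show ?thesis using pf_T[OF repD(1)[OF repU]] nonzero_on_V[OF repD(1)[OF repU] repD(2)[OF repU]] by simp
        next
          case 3
          then show ?thesis using h_pf h_nz by simp
        qed
      qed
      obtain y1 where y1: "y1 \<in> V" "\<forall>f\<in>FF. f y1 \<noteq> 0"
        using nonzero_prod[OF finFF, of "\<lambda>f. f"] FF_nz by blast
      \<comment> \<open>Outside these places every regular function has integral eigenvalues, by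
        \<open>Eg_regular_integral\<close>.\<close>
      define P where "P = insert None (Some ` {z. poly (on_seg y0 y1 G) z = 0})"
      have G0: "on_seg y0 y1 G \<noteq> 0"
      proof (rule on_seg_nonzero[OF G_pf])
        show "G y0 \<noteq> 0" using y0X by (simp add: G_def)
      qed
      have finP: "finite P" "card P \<le> B + 1"
      proof -
        have fin: "finite {z. poly (on_seg y0 y1 G) z = 0}" by (rule poly_roots_finite[OF G0])
        show "finite P" unfolding P_def using fin by simp
        have "card P \<le> Suc (card (Some ` {z. poly (on_seg y0 y1 G) z = 0}))" unfolding P_def by (simp add: card_insert_if fin)
        also have "\<dots> \<le> Suc (card {z. poly (on_seg y0 y1 G) z = 0})" using card_image_le[OF fin] by simp
        also have "\<dots> \<le> Suc B" using card_poly_roots_bound[OF G0] B[of y0 y1] by simp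
        finally show "card P \<le> B + 1" by simp
      qed
      define Zc where "Zc c = {v. \<exists>\<alpha>. witness y0 y1 c u r \<alpha> v}" for c
      have Zc: "finite (Zc c)" "card (Zc c) \<le> s ^ n" for c
        using witness_card[of y0 r \<Delta> p u y1 c] y0X(1)[unfolded X_def] \<Delta>(1,3,4) y0u(3) unfolding Zc_def by auto
      define Z where "Z = (\<Union>c\<in>P. Zc c)"
      have "card Z \<le> (\<Sum>c\<in>P. card (Zc c))" unfolding Z_def by (rule card_UN_le[OF finP(1)])
      also have "\<dots> \<le> (\<Sum>c\<in>P. s ^ n)" by (intro sum_mono Zc)
      also have "\<dots> \<le> r" unfolding r_def using mult_right_mono[OF finP(2), of "s ^ n"] by simp
      finally have cardZ: "card Z \<le> r" .
      have bound: "- K \<le> fls_subdegree \<beta> \<and> fls_subdegree \<beta> \<le> K"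
        if i: "i \<le> r" and w: "\<exists>j<s. w j \<noteq> 0" and eu: "Eg y0 y1 c w (u i) \<beta>" and eu': "Eg y0 y1 c w (u' i) \<beta>'" for i c w \<beta> \<beta>'
      proof -
        have "\<beta> * \<beta>' = fls_const 1"
          by (rule Eg_unique[OF Eg_mult[OF eu eu'] Eg_const[of y0 y1 c w 1] _ w]) (use u(2) i in \<open>simp add: u'_def\<close>)
        then have 1: "\<beta> * \<beta>' = 1" by simp
        then have nz: "\<beta> \<noteq> 0" "\<beta>' \<noteq> 0" by auto
        have "fls_subdegree \<beta> + fls_subdegree \<beta>' = 0" using arg_cong[OF 1, of fls_subdegree] nz by simp
        moreover have "- int (2 * E * \<delta>) \<le> fls_subdegree \<beta>"
          by (rule Eg_lower_bound[OF eu rep_u[OF i] y0u(1)[OF i] w nz(1) deg_u[OF i]])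
        moreover have "- int (2 * E * \<delta>) \<le> fls_subdegree \<beta>'"
          by (rule Eg_lower_bound[OF eu' rep_u'[OF i] y0u(2)[OF i] w nz(2) deg_u'[OF i]])
        ultimately show ?thesis unfolding K_def by linarith
      qed
      have "Z \<subseteq> box"
      proof
        fix v assume "v \<in> Z"
        then obtain c \<alpha> where wit: "witness y0 y1 c u r \<alpha> v" unfolding Z_def Zc_def by blast
        obtain w \<beta> where w: "\<exists>j<s. w j \<noteq> 0" "\<forall>i\<le>r. Eg y0 y1 c w (u i) (\<beta> i)"
          "\<forall>i\<le>r. \<exists>\<beta>'. Eg y0 y1 c w (u' i) \<beta>'" "v = (\<lambda>i. if i \<le> r then fls_subdegree (\<beta> i) else 0)"
          using wit unfolding u'_def by (rule witnessE)
        show "v \<in> box" unfolding box_def w(4) using bound[OF _ w(1)] w(2,3) by fastforce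
      qed
      with cardZ have ZZ: "Z \<in> ZZ" by (simp add: ZZ_def)
      have "poly (Q Z) (U Z y1) = 0"
        unfolding Q_def
      proof (rule eig_poly_root[OF repU y0U[OF ZZ] _ y1(1)])
        show "RD (U Z) y1 \<noteq> 0" "b 0 y1 \<noteq> 0" using y1(2) ZZ unfolding FF_def by auto
        fix c \<rho>
        assume root: "poly (char_poly (mat s s (\<lambda>(j, l). sp y0 y1 c (RM (U Z) j l)))) \<rho> = 0"
        define F where "F = X ` {..<n} \<union> Y ` {..<n} \<union> u ` {..r} \<union> u' ` {..r}"
        have spU: "sp y0 y1 c (RD (U Z)) \<noteq> 0" by (rule sp_nonzero[OF repD(1)[OF repU] y0U[OF ZZ]])
        have good: "\<exists>D m. rep D m g \<and> sp y0 y1 c D \<noteq> 0" if "rep (RD g) (RM g) g" "RD g y0 \<noteq> 0" for g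
          using that sp_nonzero[OF repD(1)[OF that(1)] that(2)] by blast
        have "\<exists>D m. rep D m g \<and> sp y0 y1 c D \<noteq> 0" if "g \<in> F" for g
        proof -
          have "rep (RD g) (RM g) g \<and> RD g y0 \<noteq> 0"
            using that repX repY rep_u rep_u' y0X y0u unfolding F_def by auto
          then show ?thesis using good by blast
        qed
        then obtain w where w: "\<exists>j<s. w j \<noteq> 0" "Eg y0 y1 c w (U Z) (\<rho> / sp y0 y1 c (RD (U Z)))"
          "\<forall>g\<in>F. \<exists>\<sigma>. Eg y0 y1 c w g \<sigma>"
          using Eg_common[OF sp_splits repU spU root, of F] by (auto simp: F_def)
        let ?\<sigma> = "\<rho> / sp y0 y1 c (RD (U Z))"
        have "\<forall>i\<in>{..<n}. \<exists>\<sigma>. Eg y0 y1 c w (X i) \<sigma>" using w(3) by (simp add: F_def)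
        from bchoice[OF this] obtain \<alpha> where \<alpha>: "\<forall>i\<in>{..<n}. Eg y0 y1 c w (X i) (\<alpha> i)" by (elim exE)
        have "\<forall>i\<in>{..<n}. \<exists>\<sigma>. Eg y0 y1 c w (Y i) \<sigma>" using w(3) by (simp add: F_def)
        from bchoice[OF this] obtain \<alpha>' where \<alpha>': "\<forall>i\<in>{..<n}. Eg y0 y1 c w (Y i) (\<alpha>' i)" by (elim exE)
        have "vge ?\<sigma> 0"
        proof (cases "c \<in> P")
          case False
          then obtain z where z: "c = Some z" "poly (on_seg y0 y1 G) z \<noteq> 0" by (cases c) (auto simp: P_def)
          have "G (seg y0 y1 z) \<noteq> 0" using z(2) poly_on_seg[OF G_pf] by simp
          then have nz: "RD (X i) (seg y0 y1 z) \<noteq> 0" "RD (Y i) (seg y0 y1 z) \<noteq> 0" if "i < n" for i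
            using that by (auto simp: G_def)
          show ?thesis
          proof (rule Eg_regular_integral[OF w(1), of y0 y1 z \<alpha> \<alpha>' "U Z"])
            fix i assume i: "i < n"
            show X1: "Eg y0 y1 (Some z) w (\<lambda>x. x i) (\<alpha> i)" using \<alpha> i z(1) by (simp add: X_def)
            show Y1: "Eg y0 y1 (Some z) w (\<lambda>x. inverse (x i)) (\<alpha>' i)" using \<alpha>' i z(1) by (simp add: Y_def)
            show "vge (\<alpha> i) 0"
              by (rule Eg_integral[OF X1[folded X_def] repX[OF i] _ w(1)])
                (use nz(1)[OF i] poly_on_seg[OF repD(1)[OF repX[OF i]]] in simp)
            show "vge (\<alpha>' i) 0"
              by (rule Eg_integral[OF Y1[folded Y_def] repY[OF i] _ w(1)])
                (use nz(2)[OF i] poly_on_seg[OF repD(1)[OF repY[OF i]]] in simp)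
          next
            show "reg (U Z)" by (rule regU)
            show "Eg y0 y1 (Some z) w (U Z) ?\<sigma>" using w(2) z(1) by simp
          qed
        next
          case True
          have "\<forall>i\<in>{..r}. \<exists>\<sigma>. Eg y0 y1 c w (u i) \<sigma>" using w(3) by (simp add: F_def)
          from bchoice[OF this] obtain \<beta> where \<beta>: "\<forall>i\<in>{..r}. Eg y0 y1 c w (u i) (\<beta> i)" by (elim exE)
          have "\<forall>i\<in>{..r}. \<exists>\<sigma>. Eg y0 y1 c w (u' i) \<sigma>" using w(3) by (simp add: F_def)
          from bchoice[OF this] obtain \<beta>' where \<beta>': "\<forall>i\<in>{..r}. Eg y0 y1 c w (u' i) (\<beta>' i)" by (elim exE)
          let ?v = "\<lambda>i. if i \<le> r then fls_subdegree (\<beta> i) else 0"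
          have "witness y0 y1 c u r \<alpha> ?v"
            unfolding witness_def using w(1) \<alpha> \<beta> \<beta>'
            by (intro exI[of _ w] exI[of _ \<beta>]) (auto simp: X_def u'_def)
          then have "?v \<in> Zc c" unfolding Zc_def by (intro CollectI exI)
          then have "?v \<in> Z" unfolding Z_def by (rule UN_I[OF True])
          \<comment> \<open>At a place in \<open>P\<close> integrality comes from the exponents:
            this sum is the valuation of the eigenvalue of \<open>U Z\<close>.\<close>
          have "(\<Sum>i\<le>r. e Z i * ?v i) = 0" by (rule bspec[OF conjunct2[OF bspec[OF e ZZ]] \<open>?v \<in> Z\<close>])
          then have sum0: "(\<Sum>i\<le>r. e Z i * fls_subdegree (\<beta> i)) = 0" by simp
          have pw: "Eg y0 y1 c w (\<lambda>x. u i x powi e Z i) (\<beta> i powi e Z i)" "\<beta> i \<noteq> 0" if i: "i \<le> r" for i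
          proof -
            have eu: "Eg y0 y1 c w (u i) (\<beta> i)" using \<beta> i by simp
            have eu': "Eg y0 y1 c w (\<lambda>x. inverse (u i x)) (\<beta>' i)" using \<beta>' i by (simp add: u'_def)
            show "Eg y0 y1 c w (\<lambda>x. u i x powi e Z i) (\<beta> i powi e Z i)" "\<beta> i \<noteq> 0"
              by (rule Eg_powi[OF eu eu' _ w(1)], use u(2) i in simp)+
          qed
          have "Eg y0 y1 c w (U Z) (\<Prod>i\<le>r. \<beta> i powi e Z i)"
            unfolding U_def[abs_def] by (rule Eg_prod) (use pw(1) in simp)
          then have "?\<sigma> = (\<Prod>i\<le>r. \<beta> i powi e Z i)" by (intro Eg_unique[OF w(2) _ refl w(1)])
          moreover have "fls_subdegree (\<Prod>i\<le>r. \<beta> i powi e Z i) = (\<Sum>i\<le>r. e Z i * fls_subdegree (\<beta> i))"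
            using pw(2) by (subst fls_subdegree_prod) auto
          ultimately show ?thesis using sum0 by (simp add: vge_def)
        qed
        then have "vge (?\<sigma> * sp y0 y1 c (RD (U Z))) (0 + fls_subdegree (sp y0 y1 c (RD (U Z))))"
          by (rule vge_mult) (simp add: vge_def)
        then show "vge \<rho> (fls_subdegree (sp y0 y1 c (RD (U Z))))" using spU by simp
      qed
      \<comment> \<open>The value of \<open>U Z\<close> at \<open>y1\<close> is a root of
        \<open>Q Z\<close>, which the choice of \<open>y1\<close> had excluded.\<close>
      then have "h (Z, U Z y1) \<in> FF" using ZZ unfolding FF_def by auto
      then have "h (Z, U Z y1) y1 \<noteq> 0" using y1(2) by blast
      moreover have "q Z y1 = \<Gamma> Z y1 * U Z y1" using \<Gamma> y1(1) by simp
      ultimately show False by (simp add: h_def)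
    qed
  qed
  then show ?thesis by blast
qed

end

theorem (in torus_subset) unit_rank_finite:
  "\<exists>r. \<forall>u. (\<forall>i\<le>r. reg (u i)) \<and> (\<forall>i\<le>r. \<forall>x\<in>V. u i x \<noteq> 0) \<longrightarrow>
     (\<exists>e :: nat \<Rightarrow> int. (\<exists>i\<le>r. e i \<noteq> 0) \<and> (\<exists>c. \<forall>x\<in>V. (\<Prod>i\<le>r. u i x powi e i) = c))"
proof -
  obtain T s b where basis: "torus_basis n V T s b" using torus_basis_exists by blast
  interpret torus_basis n V T s b by (rule basis)
  obtain E where "E > 0" "\<forall>c. \<forall>N :: 'k poly mat. N \<in> carrier_mat s s \<longrightarrow> splits (char_poly (map_mat (place E c) N))"
    using place_char_poly_splits by blast
  then interpret torus_places n V T s b E by unfold_locales auto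
  show ?thesis by (rule unit_relation)
qed

subsection \<open>Finite groups acting on lattices\<close>

text \<open>The values of the last coordinate form a subgroup of the integers, generated by the one
  of least positive absolute value. An element attaining it is added to generators of the sublattice
  where this coordinate vanishes.\<close>

lemma int_lattice_generators:
  fixes \<Lambda> :: "(nat \<Rightarrow> int) set"
  assumes "(\<lambda>_. 0) \<in> \<Lambda>" "\<And>u v k. u \<in> \<Lambda> \<Longrightarrow> v \<in> \<Lambda> \<Longrightarrow> (\<lambda>j. u j + k * v j) \<in> \<Lambda>"
    "\<And>v j. v \<in> \<Lambda> \<Longrightarrow> j \<ge> l \<Longrightarrow> v j = 0"
  shows "\<exists>g. (\<forall>i<l. g i \<in> \<Lambda>) \<and> (\<forall>v\<in>\<Lambda>. \<exists>e. \<forall>j. v j = (\<Sum>i<l. e i * g i j))"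
  using assms
proof (induction l arbitrary: \<Lambda>)
  case 0
  then show ?case by simp
next
  case (Suc l)
  define \<Lambda>' where "\<Lambda>' = {v \<in> \<Lambda>. v l = 0}"
  have "\<exists>g. (\<forall>i<l. g i \<in> \<Lambda>') \<and> (\<forall>v\<in>\<Lambda>'. \<exists>e. \<forall>j. v j = (\<Sum>i<l. e i * g i j))"
  proof (rule Suc.IH)
    fix v j assume "v \<in> \<Lambda>'" "l \<le> j"
    then show "v j = 0" using Suc.prems(3)[of v j] by (cases "j = l") (auto simp: \<Lambda>'_def)
  qed (use Suc.prems(1,2) in \<open>auto simp: \<Lambda>'_def\<close>)
  then obtain g where g: "\<And>i. i < l \<Longrightarrow> g i \<in> \<Lambda>'" "\<And>v. v \<in> \<Lambda>' \<Longrightarrow> \<exists>e. \<forall>j. v j = (\<Sum>i<l. e i * g i j)"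
    by blast
  obtain w where w: "w \<in> \<Lambda>" "\<And>v. v \<in> \<Lambda> \<Longrightarrow> \<exists>k. v l = k * w l"
  proof (cases "\<exists>w\<in>\<Lambda>. w l \<noteq> 0")
    case False
    then show ?thesis using that[of "\<lambda>_. 0"] Suc.prems(1) by auto
  next
    case True
    define w where "w = arg_min (\<lambda>w. nat \<bar>w l\<bar>) (\<lambda>w. w \<in> \<Lambda> \<and> w l \<noteq> 0)"
    obtain w1 where w1: "w1 \<in> \<Lambda> \<and> w1 l \<noteq> 0" using True by blast
    have w: "w \<in> \<Lambda> \<and> w l \<noteq> 0" unfolding w_def by (rule arg_min_natI[of "\<lambda>w. w \<in> \<Lambda> \<and> w l \<noteq> 0", OF w1])
    have min: "nat \<bar>w l\<bar> \<le> nat \<bar>v l\<bar>" if "v \<in> \<Lambda> \<and> v l \<noteq> 0" for v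
      unfolding w_def by (rule arg_min_nat_le[of "\<lambda>w. w \<in> \<Lambda> \<and> w l \<noteq> 0", OF that])
    have "v l = (v l div w l) * w l" if v: "v \<in> \<Lambda>" for v
    proof -
      let ?v = "\<lambda>j. v j + (- (v l div w l)) * w j"
      have "?v \<in> \<Lambda>" using v w Suc.prems(2) by blast
      moreover have "?v l = v l mod w l" by (simp add: minus_div_mult_eq_mod[symmetric])
      moreover have "\<bar>v l mod w l\<bar> < \<bar>w l\<bar>" using w by (simp add: abs_mod_less)
      ultimately have "?v l = 0" using min[of ?v] by force
      then show ?thesis by simp
    qed
    then show ?thesis using that[of w] w by blast
  qed
  define g' where "g' i = (if i = l then w else g i)" for i
  have "\<exists>e. \<forall>j. v j = (\<Sum>i<Suc l. e i * g' i j)" if v: "v \<in> \<Lambda>" for v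
  proof -
    obtain k where k: "v l = k * w l" using w(2)[OF v] by blast
    have "(\<lambda>j. v j + (- k) * w j) \<in> \<Lambda>" using Suc.prems(2)[OF v w(1)] .
    then have "(\<lambda>j. v j + (- k) * w j) \<in> \<Lambda>'" using k by (simp add: \<Lambda>'_def)
    then obtain e where e: "\<And>j. v j + (- k) * w j = (\<Sum>i<l. e i * g i j)" using g(2) by blast
    have "v j = (\<Sum>i<Suc l. (e(l := k)) i * g' i j)" for j
    proof -
      have "(\<Sum>i<l. (e(l := k)) i * g' i j) = (\<Sum>i<l. e i * g i j)"
        by (intro sum.cong) (auto simp: g'_def)
      then show ?thesis using e[of j] by (simp add: g'_def)
    qed
    then show ?thesis by blast
  qed
  moreover have "g' i \<in> \<Lambda>" if "i < Suc l" for i using g(1)[of i] w(1) that by (auto simp: g'_def \<Lambda>'_def)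
  ultimately show ?case by blast
qed

text \<open>An element \<open>f\<close> acting trivially modulo 3 satisfies \<open>f v = v + 3 w\<close>, where \<open>w\<close> is shorter
  than \<open>v\<close> for an invariant norm; by induction \<open>f w = w\<close>, and then the powers of \<open>f\<close>
  move \<open>v\<close> along an arithmetic progression, which is impossible unless \<open>w = 0\<close>.\<close>

lemma minkowski_codes:
  fixes G :: "'g monoid" and \<Lambda> :: "(nat \<Rightarrow> int) set"
  assumes "group G" "finite (carrier G)"
    and \<Lambda>: "(\<lambda>_. 0) \<in> \<Lambda>" "\<And>u v k. u \<in> \<Lambda> \<Longrightarrow> v \<in> \<Lambda> \<Longrightarrow> (\<lambda>j. u j + k * v j) \<in> \<Lambda>"
      "\<And>v j. v \<in> \<Lambda> \<Longrightarrow> j \<ge> l \<Longrightarrow> v j = 0"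
    and act: "\<And>g v. g \<in> carrier G \<Longrightarrow> v \<in> \<Lambda> \<Longrightarrow> act g v \<in> \<Lambda>"
      "\<And>g u v k. g \<in> carrier G \<Longrightarrow> u \<in> \<Lambda> \<Longrightarrow> v \<in> \<Lambda> \<Longrightarrow> act g (\<lambda>j. u j + k * v j) = (\<lambda>j. act g u j + k * act g v j)"
      "\<And>v. v \<in> \<Lambda> \<Longrightarrow> act \<one>\<^bsub>G\<^esub> v = v"
      "\<And>g h v. g \<in> carrier G \<Longrightarrow> h \<in> carrier G \<Longrightarrow> v \<in> \<Lambda> \<Longrightarrow> act (g \<otimes>\<^bsub>G\<^esub> h) v = act h (act g v)"
  shows "\<exists>(\<kappa> :: 'g \<Rightarrow> nat \<times> nat \<Rightarrow> int) C. finite C \<and> card C \<le> 3 ^ (l * l) \<and> (\<forall>g\<in>carrier G. \<kappa> g \<in> C) \<and>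
    (\<forall>g\<in>carrier G. \<forall>h\<in>carrier G. \<kappa> g = \<kappa> h \<longrightarrow> (\<forall>v\<in>\<Lambda>. act g v = act h v))"
proof -
  interpret group G by fact
  have "\<exists>gen. (\<forall>i<l. gen i \<in> \<Lambda>) \<and> (\<forall>v\<in>\<Lambda>. \<exists>e. \<forall>j. v j = (\<Sum>i<l. e i * gen i j))"
  proof (rule int_lattice_generators)
    show "(\<lambda>j. u j + k * v j) \<in> \<Lambda>" if "u \<in> \<Lambda>" "v \<in> \<Lambda>" for u v k using that by (rule \<Lambda>(2))
    show "v j = 0" if "v \<in> \<Lambda>" "l \<le> j" for v j using that by (rule \<Lambda>(3))
  qed (rule \<Lambda>(1))
  then obtain gen where gen: "\<forall>i<l. gen i \<in> \<Lambda>" "\<forall>v\<in>\<Lambda>. \<exists>e. \<forall>j. v j = (\<Sum>i<l. e i * gen i j)"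
    by (elim exE conjE)
  from bchoice[OF gen(2)] obtain co where co: "\<forall>v\<in>\<Lambda>. \<forall>j. v j = (\<Sum>i<l. co v i * gen i j)" by (elim exE)
  have lincomb: "(\<lambda>j. \<Sum>i\<in>A. e i * f i j) \<in> \<Lambda>" if "finite A" "\<And>i. i \<in> A \<Longrightarrow> f i \<in> \<Lambda>" for A :: "nat set" and e f
    using that
  proof (induction A rule: finite_induct)
    case (insert i A)
    have "(\<lambda>j. (\<Sum>i\<in>A. e i * f i j) + e i * f i j) \<in> \<Lambda>" using insert by (intro \<Lambda>(2)) auto
    then show ?case using insert.hyps by (simp add: add.commute)
  qed (simp add: \<Lambda>(1))
  have act0: "act g (\<lambda>_. 0) = (\<lambda>_. 0)" if "g \<in> carrier G" for g
    using act(2)[OF that \<Lambda>(1) \<Lambda>(1), of "- 1"] by (auto simp: fun_eq_iff)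
  have act_lincomb: "act g (\<lambda>j. \<Sum>i\<in>A. e i * f i j) = (\<lambda>j. \<Sum>i\<in>A. e i * act g (f i) j)"
    if g: "g \<in> carrier G" and "finite A" "\<And>i. i \<in> A \<Longrightarrow> f i \<in> \<Lambda>" for g e f and A :: "nat set"
    using that(2,3)
  proof (induction A rule: finite_induct)
    case (insert i A)
    have "act g (\<lambda>j. (\<Sum>i\<in>A. e i * f i j) + e i * f i j) = (\<lambda>j. act g (\<lambda>j. \<Sum>i\<in>A. e i * f i j) j + e i * act g (f i) j)"
      using insert by (intro act(2)[OF g] lincomb) auto
    then show ?case using insert by (simp add: add.commute)
  qed (simp add: act0 g)
  define C where "C = ({..<l} \<times> {..<l} \<rightarrow>\<^sub>E {0..<3 :: int})"
  \<comment> \<open>The \<open>gen i\<close> only generate, and \<open>co\<close> selects some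
    coefficients. Agreement modulo 3 still places the difference of two images in 3 times the
    lattice, which is all that is used.\<close>
  define \<kappa> where "\<kappa> g = (\<lambda>(i, k)\<in>{..<l} \<times> {..<l}. co (act g (gen i)) k mod 3)" for g
  have "finite C" unfolding C_def by (intro finite_PiE) auto
  moreover have "card C \<le> 3 ^ (l * l)" unfolding C_def by (subst card_PiE) auto
  moreover have "\<kappa> g \<in> C" for g by (auto simp: \<kappa>_def C_def)
  moreover have "act g v = act h v" if g: "g \<in> carrier G" and h: "h \<in> carrier G" and \<kappa>: "\<kappa> g = \<kappa> h" and v: "v \<in> \<Lambda>" for g h v
  proof -
    have mod3: "\<exists>y\<in>\<Lambda>. act g v = (\<lambda>j. act h v j + 3 * y j)" if v: "v \<in> \<Lambda>" for v
    proof -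
      have "\<exists>y\<in>\<Lambda>. act g (gen i) = (\<lambda>j. act h (gen i) j + 3 * y j)" if i: "i < l" for i
      proof -
        define q where "q k = (co (act g (gen i)) k - co (act h (gen i)) k) div 3" for k
        have q: "co (act g (gen i)) k = co (act h (gen i)) k + 3 * q k" if k: "k < l" for k
        proof -
          have "\<kappa> g (i, k) = \<kappa> h (i, k)" using \<kappa> by simp
          then have "co (act g (gen i)) k mod 3 = co (act h (gen i)) k mod 3" using i k by (simp add: \<kappa>_def)
          then have "3 dvd co (act g (gen i)) k - co (act h (gen i)) k" by (simp add: mod_eq_dvd_iff)
          then show ?thesis by (simp add: q_def)
        qed
        have "act g (gen i) j = act h (gen i) j + 3 * (\<Sum>k<l. q k * gen k j)" for j
        proof -
          have "act g (gen i) j = (\<Sum>k<l. co (act g (gen i)) k * gen k j)"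
            using co act(1)[OF g] gen(1) i by blast
          also have "\<dots> = (\<Sum>k<l. co (act h (gen i)) k * gen k j) + 3 * (\<Sum>k<l. q k * gen k j)"
            by (simp add: q algebra_simps sum.distrib sum_distrib_left)
          also have "(\<Sum>k<l. co (act h (gen i)) k * gen k j) = act h (gen i) j"
            using co act(1)[OF h] gen(1) i by metis
          finally show ?thesis .
        qed
        moreover have "(\<lambda>j. \<Sum>k<l. q k * gen k j) \<in> \<Lambda>" using gen(1) by (intro lincomb) auto
        ultimately show ?thesis by (intro bexI[of _ "\<lambda>j. \<Sum>k<l. q k * gen k j"]) auto
      qed
      then have "\<forall>i\<in>{..<l}. \<exists>y. y \<in> \<Lambda> \<and> act g (gen i) = (\<lambda>j. act h (gen i) j + 3 * y j)" by blast
      from bchoice[OF this] obtain y where y: "\<forall>i\<in>{..<l}. y i \<in> \<Lambda> \<and> act g (gen i) = (\<lambda>j. act h (gen i) j + 3 * y i j)" by (elim exE)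
      have v_eq: "v = (\<lambda>j. \<Sum>i<l. co v i * gen i j)" using co v by blast
      have av: "act k v = (\<lambda>j. \<Sum>i<l. co v i * act k (gen i) j)" if "k \<in> carrier G" for k
        by (subst v_eq, rule act_lincomb[OF that]) (use gen(1) in auto)
      have "act g v = (\<lambda>j. act h v j + 3 * (\<Sum>i<l. co v i * y i j))"
        unfolding av[OF g] av[OF h] using y by (auto simp: fun_eq_iff algebra_simps sum.distrib sum_distrib_left intro!: sum.cong)
      moreover have "(\<lambda>j. \<Sum>i<l. co v i * y i j) \<in> \<Lambda>" using y by (intro lincomb) auto
      ultimately show ?thesis by (intro bexI[of _ "\<lambda>j. \<Sum>i<l. co v i * y i j"])
    qed
    \<comment> \<open>Equal codes for \<open>g\<close> and \<open>h\<close> mean that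
      \<open>f\<close> acts trivially modulo 3.\<close>
    define f where "f = g \<otimes>\<^bsub>G\<^esub> inv\<^bsub>G\<^esub> h"
    have f: "f \<in> carrier G" using g h by (simp add: f_def)
    have f3: "\<exists>y\<in>\<Lambda>. act f v = (\<lambda>j. v j + 3 * y j)" if v: "v \<in> \<Lambda>" for v
    proof -
      obtain y where y: "y \<in> \<Lambda>" "act g v = (\<lambda>j. act h v j + 3 * y j)" using mod3[OF v] by blast
      have "act f v = act (inv\<^bsub>G\<^esub> h) (\<lambda>j. act h v j + 3 * y j)" using g h v y by (simp add: f_def act(4))
      also have "\<dots> = (\<lambda>j. act (inv\<^bsub>G\<^esub> h) (act h v) j + 3 * act (inv\<^bsub>G\<^esub> h) y j)"
        using h v y(1) act(1) by (intro act(2)) auto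
      also have "act (inv\<^bsub>G\<^esub> h) (act h v) = v"
        using h v act(3) by (simp flip: act(4))
      finally show ?thesis using act(1)[OF inv_closed[OF h] y(1)] by blast
    qed
    \<comment> \<open>The sum over the group makes the norm invariant.\<close>
    define N where "N v = (\<Sum>k\<in>carrier G. \<Sum>i<l. \<bar>act k v i\<bar>)" for v
    have N_nonneg: "0 \<le> N v" for v unfolding N_def by (intro sum_nonneg) auto
    have N_f: "N (act f v) = N v" if v: "v \<in> \<Lambda>" for v
    proof -
      have "N (act f v) = (\<Sum>k\<in>carrier G. \<Sum>i<l. \<bar>act (f \<otimes>\<^bsub>G\<^esub> k) v i\<bar>)"
        unfolding N_def using f v by (intro sum.cong) (simp_all add: act(4))
      also have "\<dots> = N v" unfolding N_def
        by (rule sum.reindex_bij_witness[of _ "\<lambda>k. inv\<^bsub>G\<^esub> f \<otimes>\<^bsub>G\<^esub> k" "\<lambda>k. f \<otimes>\<^bsub>G\<^esub> k"])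
          (use f in \<open>auto simp: m_assoc[symmetric]\<close>)
      finally show ?thesis .
    qed
    have trivial_f: "act f v = v" if "v \<in> \<Lambda>" for v
      using that
    proof (induction "nat (N v)" arbitrary: v rule: less_induct)
      case less
      obtain w where w: "w \<in> \<Lambda>" "act f v = (\<lambda>j. v j + 3 * w j)" using f3[OF less.prems] by blast
      have "3 * N w \<le> 2 * N v"
      proof -
        have a: "3 * \<bar>act k w i\<bar> \<le> \<bar>act k (act f v) i\<bar> + \<bar>act k v i\<bar>" if "k \<in> carrier G" for k i
        proof -
          have "act k (act f v) = (\<lambda>j. act k v j + 3 * act k w j)"
            unfolding w(2) by (rule act(2)[OF that less.prems w(1)])
          then show ?thesis by simp
        qed
        have "3 * N w = (\<Sum>k\<in>carrier G. \<Sum>i<l. 3 * \<bar>act k w i\<bar>)" by (simp add: N_def sum_distrib_left)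
        also have "\<dots> \<le> (\<Sum>k\<in>carrier G. \<Sum>i<l. \<bar>act k (act f v) i\<bar> + \<bar>act k v i\<bar>)"
          by (intro sum_mono a)
        also have "\<dots> = N (act f v) + N v" by (simp add: N_def sum.distrib)
        finally show ?thesis using N_f[OF less.prems] by simp
      qed
      show ?case
      proof (cases "N v = 0")
        case True
        have "v i = 0" for i
        proof (cases "i < l")
          case True
          have fin: "finite (carrier G)" by fact
          have "\<forall>k\<in>carrier G. (\<Sum>i<l. \<bar>act k v i\<bar>) = 0"
            using \<open>N v = 0\<close> unfolding N_def by (subst (asm) sum_nonneg_eq_0_iff[OF fin]) (auto intro: sum_nonneg)
          then have "(\<Sum>i<l. \<bar>v i\<bar>) = 0" using act(3)[OF less.prems] one_closed by metis
          then show ?thesis using True by (subst (asm) sum_nonneg_eq_0_iff) auto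
        qed (use \<Lambda>(3)[OF less.prems] in auto)
        then have "v = (\<lambda>_. 0)" by auto
        then show ?thesis using act0[OF f] by simp
      next
        case False
        then have "N w < N v" using \<open>3 * N w \<le> 2 * N v\<close> N_nonneg[of v] by linarith
        then have fw: "act f w = w" using less.hyps[of w] w(1) N_nonneg[of w] by simp
        have pow: "act (f [^]\<^bsub>G\<^esub> m) v = (\<lambda>j. v j + (3 * int m) * w j)" for m :: nat
        proof (induction m)
          case 0
          then show ?case using act(3)[OF less.prems] by simp
        next
          case (Suc m)
          have "act (f [^]\<^bsub>G\<^esub> Suc m) v = act f (act (f [^]\<^bsub>G\<^esub> m) v)"
            using f less.prems by (simp add: act(4))
          also have "\<dots> = (\<lambda>j. act f v j + (3 * int m) * act f w j)"
            unfolding Suc by (rule act(2)[OF f less.prems w(1)])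
          finally show ?case by (simp add: fw w(2) algebra_simps)
        qed
        have "\<not> inj (\<lambda>m :: nat. f [^]\<^bsub>G\<^esub> m)"
        proof
          assume "inj (\<lambda>m :: nat. f [^]\<^bsub>G\<^esub> m)"
          moreover have "range (\<lambda>m :: nat. f [^]\<^bsub>G\<^esub> m) \<subseteq> carrier G" using f by auto
          ultimately have "finite (UNIV :: nat set)" using finite_subset[OF _ assms(2)] finite_imageD by blast
          then show False by simp
        qed
        then obtain m m' :: nat where m: "f [^]\<^bsub>G\<^esub> m = f [^]\<^bsub>G\<^esub> m'" "m \<noteq> m'" by (auto simp: inj_on_def)
        then have "(\<lambda>j. v j + (3 * int m) * w j) = (\<lambda>j. v j + (3 * int m') * w j)" by (simp flip: pow)
        then have z: "(3 * int m) * w j = (3 * int m') * w j" for j by (auto dest: fun_cong[of _ _ j])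
        then have "w j = 0" for j using z[of j] m(2) by simp
        then show ?thesis using w(2) by simp
      qed
    qed
    have "act g v = act (f \<otimes>\<^bsub>G\<^esub> h) v" using g h by (simp add: f_def m_assoc)
    also have "\<dots> = act h v" using f h v trivial_f[OF v] by (simp add: act(4))
    finally show ?thesis .
  qed
  ultimately show ?thesis by blast
qed

text \<open>\<open>\<int>\<^sup>I\<close> and \<open>\<int>\<^sup>l\<close> are modelled by functions that are disregarded outside \<open>I\<close> and vanish from \<open>l\<close> on;
  \<open>rank\<close> bounds the corank of \<open>L\<close> by \<open>r\<close>.\<close>

lemma saturated_lattice_kernel:
  fixes L :: "('i \<Rightarrow> int) set"
  assumes I: "finite I"
    and L: "(\<lambda>_. 0) \<in> L" "\<And>a b k. a \<in> L \<Longrightarrow> b \<in> L \<Longrightarrow> (\<lambda>i. a i + k * b i) \<in> L"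
      "\<And>a b. a \<in> L \<Longrightarrow> (\<And>i. i \<in> I \<Longrightarrow> a i = b i) \<Longrightarrow> b \<in> L"
      "\<And>a k. k \<noteq> 0 \<Longrightarrow> (\<lambda>i. k * a i) \<in> L \<Longrightarrow> a \<in> L"
    and rank: "\<And>J. J \<subseteq> I \<Longrightarrow> (\<And>a. a \<in> L \<Longrightarrow> (\<And>i. i \<notin> J \<Longrightarrow> a i = 0) \<Longrightarrow> \<forall>i\<in>J. a i = 0) \<Longrightarrow> card J \<le> r"
  shows "\<exists>l c. l \<le> r \<and> (\<forall>a j. l \<le> j \<longrightarrow> c a j = 0) \<and>
    (\<forall>a b k. c (\<lambda>i. a i + k * b i) = (\<lambda>j. c a j + k * c b j)) \<and> (\<forall>a. c a = (\<lambda>_ :: nat. 0 :: int) \<longleftrightarrow> a \<in> L)"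
proof -
  \<comment> \<open>No nonzero element of \<open>L\<close> is supported on an independent set. A
    maximal one provides rational coordinates for the quotient by \<open>L\<close>.\<close>
  define ind where "ind J \<longleftrightarrow> (\<forall>a\<in>L. (\<forall>i. i \<notin> J \<longrightarrow> a i = 0) \<longrightarrow> (\<forall>i\<in>J. a i = 0))" for J
  have fin: "finite {J. J \<subseteq> I \<and> ind J}" by (rule finite_subset[of _ "Pow I"]) (use I in auto)
  have "ind {}" by (simp add: ind_def)
  then have "{J. J \<subseteq> I \<and> ind J} \<noteq> {}" by blast
  from finite_has_maximal[OF fin this] obtain J where J: "J \<subseteq> I" "ind J"
    "\<forall>S\<in>{J. J \<subseteq> I \<and> ind J}. J \<subseteq> S \<longrightarrow> J = S" by blast
  have finJ: "finite J" using J(1) I finite_subset by blast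
  have "\<exists>q A. q \<noteq> 0 \<and> (\<forall>j. j \<notin> J \<longrightarrow> A j = 0) \<and> (\<lambda>j. (if j = i then q else 0) + A j) \<in> L" if i: "i \<in> I" for i
  proof (cases "i \<in> J")
    case True
    have "(\<lambda>j. (if j = i then 1 else 0) + (if j = i then - 1 else 0)) = (\<lambda>_. 0 :: int)" by auto
    then have "(\<lambda>j. (if j = i then 1 else 0) + (if j = i then - 1 else 0)) \<in> L" using L(1) by (simp only:)
    then show ?thesis using True by (intro exI[of _ 1] exI[of _ "\<lambda>j. if j = i then - 1 else 0"]) auto
  next
    case False
    then have "\<not> ind (insert i J)" using J(3)[rule_format, of "insert i J"] J(1) i by blast
    then obtain a where a: "a \<in> L" "\<forall>j. j \<notin> insert i J \<longrightarrow> a j = 0" "\<not> (\<forall>j\<in>insert i J. a j = 0)"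
      unfolding ind_def by blast
    have "a i \<noteq> 0"
    proof
      assume z: "a i = 0"
      then have "\<forall>j. j \<notin> J \<longrightarrow> a j = 0" using a(2) by (metis insertE)
      then have "\<forall>j\<in>J. a j = 0" using J(2) a(1) unfolding ind_def by blast
      then show False using a(3) z by simp
    qed
    moreover have "(\<lambda>j. (if j = i then a i else 0) + (if j \<in> J then a j else 0)) = a"
      using a(2) False by (auto simp: fun_eq_iff)
    ultimately show ?thesis using a(1)
      by (intro exI[of _ "a i"] exI[of _ "\<lambda>j. if j \<in> J then a j else 0"]) auto
  qed
  then have "\<forall>i\<in>I. \<exists>q A. q \<noteq> 0 \<and> (\<forall>j. j \<notin> J \<longrightarrow> A j = 0) \<and> (\<lambda>j. (if j = i then q else 0) + A j) \<in> L" by blast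
  from bchoice[OF this] obtain q where "\<forall>i\<in>I. \<exists>A. q i \<noteq> 0 \<and> (\<forall>j. j \<notin> J \<longrightarrow> A j = 0) \<and> (\<lambda>j. (if j = i then q i else 0) + A j) \<in> L"
    by (elim exE)
  from bchoice[OF this] obtain A where A: "\<forall>i\<in>I. q i \<noteq> 0 \<and> (\<forall>j. j \<notin> J \<longrightarrow> A i j = 0) \<and> (\<lambda>j. (if j = i then q i else 0) + A i j) \<in> L"
    by (elim exE)
  define Q where "Q = (\<Prod>i\<in>I. q i)"
  have Q0: "Q \<noteq> 0" using A I by (simp add: Q_def)
  define A' where "A' i j = (\<Prod>k\<in>I - {i}. q k) * A i j" for i j
  have A': "(\<lambda>j. (if j = i then Q else 0) + A' i j) \<in> L" if "i \<in> I" for i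
  proof -
    have "(\<lambda>j. 0 + (\<Prod>k\<in>I - {i}. q k) * ((if j = i then q i else 0) + A i j)) \<in> L"
      using A that L(1) by (intro L(2)) auto
    moreover have "Q = q i * (\<Prod>k\<in>I - {i}. q k)" unfolding Q_def using I that by (rule prod.remove)
    then have "(\<lambda>j. 0 + (\<Prod>k\<in>I - {i}. q k) * ((if j = i then q i else 0) + A i j)) = (\<lambda>j. (if j = i then Q else 0) + A' i j)"
      by (auto simp: A'_def fun_eq_iff algebra_simps)
    ultimately show ?thesis by simp
  qed
  \<comment> \<open>\<open>d a\<close> is supported on \<open>J\<close> and congruent to
    \<open>- Q * a\<close> modulo \<open>L\<close>: the coordinates of \<open>a\<close> with the
    common denominator \<open>Q\<close> cleared.\<close>
  define d where "d a j = (\<Sum>i\<in>I. a i * A' i j)" for a j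
  have d_supp: "d a j = 0" if "j \<notin> J" for a j using A that by (simp add: d_def A'_def)
  have rel: "(\<lambda>j. Q * a j + d a j) \<in> L" for a
  proof -
    have sumL: "(\<lambda>j. \<Sum>i\<in>S. a i * ((if j = i then Q else 0) + A' i j)) \<in> L" if "S \<subseteq> I" for S
      using finite_subset[OF that I] that
    proof (induction S rule: finite_induct)
      case (insert i S)
      have "(\<lambda>j. (\<Sum>i\<in>S. a i * ((if j = i then Q else 0) + A' i j)) + a i * ((if j = i then Q else 0) + A' i j)) \<in> L"
        using insert A' by (intro L(2)) auto
      then show ?case using insert.hyps by (simp add: add.commute)
    qed (simp add: L(1))
    show ?thesis
    proof (rule L(3)[OF sumL[OF order_refl]])
      fix j assume "j \<in> I"
      have "(\<Sum>i\<in>I. a i * (if j = i then Q else 0)) = (\<Sum>i\<in>I. if j = i then a i * Q else 0)"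
        by (intro sum.cong) auto
      then have "(\<Sum>i\<in>I. a i * (if j = i then Q else 0)) = Q * a j" using I \<open>j \<in> I\<close> by simp
      then show "(\<Sum>i\<in>I. a i * ((if j = i then Q else 0) + A' i j)) = Q * a j + d a j"
        by (simp add: distrib_left sum.distrib d_def)
    qed
  qed
  have d_lin: "d (\<lambda>i. a i + k * b i) j = d a j + k * d b j" for a b k j
    by (simp add: d_def distrib_right sum.distrib sum_distrib_left mult.assoc)
  have ker: "(\<forall>j\<in>J. d a j = 0) \<longleftrightarrow> a \<in> L" for a
  proof
    assume "\<forall>j\<in>J. d a j = 0"
    then have "d a = (\<lambda>_. 0)" using d_supp by auto
    then have "(\<lambda>j. Q * a j) \<in> L" using rel[of a] by simp
    then show "a \<in> L" by (rule L(4)[OF Q0])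
  next
    assume "a \<in> L"
    have "(\<lambda>j. (Q * a j + d a j) + (- Q) * a j) \<in> L" by (rule L(2)[OF rel \<open>a \<in> L\<close>])
    then have "d a \<in> L" by simp
    then show "\<forall>j\<in>J. d a j = 0" using J(2) d_supp unfolding ind_def by blast
  qed
  define l where "l = card J"
  have "l \<le> r" unfolding l_def
    by (rule rank[OF J(1)]) (use J(2) in \<open>auto simp: ind_def\<close>)
  obtain h where h: "bij_betw h {..<l} J" unfolding l_def
    using ex_bij_betw_nat_finite[OF finJ] by (auto simp: atLeast0LessThan)
  define c where "c a j = (if j < l then d a (h j) else 0)" for a j
  have "c a = (\<lambda>_. 0) \<longleftrightarrow> a \<in> L" for a
  proof -
    have "c a = (\<lambda>_. 0) \<longleftrightarrow> (\<forall>j<l. d a (h j) = 0)" by (auto simp: c_def fun_eq_iff)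
    also have "\<dots> \<longleftrightarrow> (\<forall>j\<in>h ` {..<l}. d a j = 0)" by auto
    also have "h ` {..<l} = J" using h by (simp add: bij_betw_def)
    finally show ?thesis using ker by simp
  qed
  then show ?thesis using \<open>l \<le> r\<close>
    by (intro exI[of _ l] exI[of _ c]) (auto simp: c_def d_lin fun_eq_iff)
qed

section \<open>The lattice of units and the action of a finite group\<close>

context torus_subset
begin

lemma reg_irred:
  assumes "reg f" "reg g" "\<And>x. x \<in> V \<Longrightarrow> f x * g x = 0"
  shows "(\<forall>x\<in>V. f x = 0) \<or> (\<forall>x\<in>V. g x = 0)"
proof -
  obtain x0 where x0: "x0 \<in> V" using V_nonempty by blast
  obtain p q where pq: "p \<in> pf {..<n}" "q \<in> pf {..<n}" "q x0 \<noteq> 0" "\<forall>y\<in>V. q y * f y = p y"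
    by (rule regE[OF assms(1) x0])
  obtain p' q' where pq': "p' \<in> pf {..<n}" "q' \<in> pf {..<n}" "q' x0 \<noteq> 0" "\<forall>y\<in>V. q' y * g y = p' y"
    by (rule regE[OF assms(2) x0])
  have "p x * p' x = 0" if "x \<in> V" for x
  proof -
    have "p x * p' x = q x * q' x * (f x * g x)" using pq(4) pq'(4) that by (simp flip: bspec[OF pq(4)] bspec[OF pq'(4)])
    then show ?thesis using assms(3)[OF that] by simp
  qed
  then consider "\<forall>x\<in>V. p x = 0" | "\<forall>x\<in>V. p' x = 0" using V_irred[OF pq(1) pq'(1)] by blast
  then show ?thesis
  proof cases
    case 1
    have "f x = 0" if "x \<in> V" for x
      by (rule reg_eq_0[OF assms(1) pq(2) _ _ that]) (use pq(3,4) x0 1 in auto)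
    then show ?thesis by blast
  next
    case 2
    have "g x = 0" if "x \<in> V" for x
      by (rule reg_eq_0[OF assms(2) pq'(2) _ _ that]) (use pq'(3,4) x0 2 in auto)
    then show ?thesis by blast
  qed
qed

text \<open>The product of the differences of \<open>u\<close> with its possible values vanishes on
  \<open>V\<close>, and irreducibility selects a factor.\<close>

lemma reg_finite_range_constant:
  assumes "reg u" "finite R" "\<And>x. x \<in> V \<Longrightarrow> u x \<in> R"
  shows "\<exists>c. \<forall>x\<in>V. u x = c"
  using assms(2,3)
proof (induction R rule: finite_induct)
  case empty
  then show ?case using V_nonempty by blast
next
  case (insert a R)
  have "(\<forall>x\<in>V. u x - a = 0) \<or> (\<forall>x\<in>V. (\<Prod>c\<in>R. u x - c) = 0)"
  proof (rule reg_irred)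
    show "reg (\<lambda>x. u x - a)" by (rule reg_diff_const[OF assms(1)])
    show "reg (\<lambda>x. \<Prod>c\<in>R. u x - c)" by (rule reg_prod) (rule reg_diff_const[OF assms(1)])
    show "(u x - a) * (\<Prod>c\<in>R. u x - c) = 0" if "x \<in> V" for x
      using insert.prems[OF that] insert.hyps by auto
  qed
  then show ?case
  proof
    assume "\<forall>x\<in>V. (\<Prod>c\<in>R. u x - c) = 0"
    then have "u x \<in> R" if "x \<in> V" for x using insert.hyps that by auto
    then show ?thesis by (rule insert.IH)
  qed auto
qed

text \<open>The values of \<open>u\<close> are roots of one polynomial, hence finitely many. So the
  units modulo constants are torsion-free, which makes \<open>constant_exps\<close>
  saturated.\<close>

lemma root_of_constant:
  assumes "reg u" "\<And>x. x \<in> V \<Longrightarrow> u x \<noteq> 0" "k \<noteq> 0" "\<And>x. x \<in> V \<Longrightarrow> u x powi k = c"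
  shows "\<exists>c. \<forall>x\<in>V. u x = c"
proof -
  define m where "m = nat \<bar>k\<bar>"
  define c' where "c' = (if k > 0 then c else inverse c)"
  have m: "m > 0" using assms(3) by (simp add: m_def)
  have um: "u x ^ m = c'" if "x \<in> V" for x
    using assms(4)[OF that] assms(3) by (auto simp: m_def c'_def power_int_def power_inverse split: if_splits)
  let ?p = "monom 1 m - [:c':]"
  have "coeff ?p m = 1" using m by (simp add: coeff_pCons split: nat.splits)
  then have "?p \<noteq> 0" by (metis coeff_0 zero_neq_one)
  then have "finite {x. poly ?p x = 0}" by (rule poly_roots_finite)
  then show ?thesis
    by (rule reg_finite_range_constant[OF assms(1)]) (simp add: um poly_monom)
qed

text \<open>The units modulo constants have rank at most \<open>r\<close>: any \<open>r + 1\<close>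
  of them, indexed from 0, satisfy a multiplicative relation.\<close>

definition unit_rank_le :: "nat \<Rightarrow> bool" where
  "unit_rank_le r \<longleftrightarrow> (\<forall>u. (\<forall>i\<le>r. reg (u i)) \<and> (\<forall>i\<le>r. \<forall>x\<in>V. u i x \<noteq> 0) \<longrightarrow>
     (\<exists>e :: nat \<Rightarrow> int. (\<exists>i\<le>r. e i \<noteq> 0) \<and> (\<exists>c. \<forall>x\<in>V. (\<Prod>i\<le>r. u i x powi e i) = c)))"

text \<open>The kernel of the map from exponent vectors to units modulo constants.\<close>

definition constant_exps :: "'i set \<Rightarrow> ('i \<Rightarrow> (nat \<Rightarrow> 'k) \<Rightarrow> 'k) \<Rightarrow> ('i \<Rightarrow> int) set" where
  "constant_exps I X = {a. \<exists>c. \<forall>x\<in>V. (\<Prod>i\<in>I. X i x powi a i) = c}"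

text \<open>The image of \<open>c\<close> is a copy, inside the integer vectors of length
  \<open>l\<close>, of the multiplicative group generated by the \<open>X i\<close> modulo
  constants.\<close>

lemma constant_exps_lattice:
  fixes X :: "'i \<Rightarrow> (nat \<Rightarrow> 'k) \<Rightarrow> 'k"
  assumes r: "unit_rank_le r" and I: "finite I"
    and X: "\<And>i. i \<in> I \<Longrightarrow> reg (X i)" "\<And>i x. i \<in> I \<Longrightarrow> x \<in> V \<Longrightarrow> X i x \<noteq> 0"
  shows "\<exists>l c. l \<le> r \<and> (\<forall>a j. l \<le> j \<longrightarrow> c a j = 0) \<and>
    (\<forall>a b k. c (\<lambda>i. a i + k * b i) = (\<lambda>j. c a j + k * c b j)) \<and>
    (\<forall>a. c a = (\<lambda>_ :: nat. 0 :: int) \<longleftrightarrow> a \<in> constant_exps I X)"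
proof (rule saturated_lattice_kernel[OF I])
  let ?M = "\<lambda>a x. \<Prod>i\<in>I. X i x powi a i"
  show "(\<lambda>_. 0) \<in> constant_exps I X" by (simp add: constant_exps_def)
  show "(\<lambda>i. a i + k * b i) \<in> constant_exps I X" if ab: "a \<in> constant_exps I X" "b \<in> constant_exps I X" for a b k
  proof -
    obtain c d where cd: "\<forall>x\<in>V. ?M a x = c" "\<forall>x\<in>V. ?M b x = d" using ab unfolding constant_exps_def by blast
    have "?M (\<lambda>i. a i + k * b i) x = c * d powi k" if "x \<in> V" for x
    proof -
      have "?M (\<lambda>i. a i + k * b i) x = (\<Prod>i\<in>I. X i x powi a i * (X i x powi b i) powi k)"
        using X(2)[OF _ that] by (intro prod.cong) (simp_all add: power_int_add power_int_mult mult.commute[of k])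
      also have "\<dots> = ?M a x * (?M b x) powi k"
      proof -
        have "(\<Prod>i\<in>I. (X i x powi b i) powi k) = (?M b x) powi k"
          by (induction I rule: infinite_finite_induct) (simp_all add: power_int_mult_distrib)
        then show ?thesis by (simp add: prod.distrib)
      qed
      finally show ?thesis using cd that by simp
    qed
    then show ?thesis unfolding constant_exps_def by blast
  qed
  show "b \<in> constant_exps I X" if "a \<in> constant_exps I X" "\<And>i. i \<in> I \<Longrightarrow> a i = b i" for a b
  proof -
    have "?M b = ?M a" using that(2) by (intro ext prod.cong) auto
    then show ?thesis using that(1) unfolding constant_exps_def mem_Collect_eq by metis
  qed
  show "a \<in> constant_exps I X" if k: "k \<noteq> 0" and a: "(\<lambda>i. k * a i) \<in> constant_exps I X" for a k
  proof -
    obtain c where c: "\<forall>x\<in>V. ?M (\<lambda>i. k * a i) x = c" using a unfolding constant_exps_def by blast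
    have "?M a x powi k = ?M (\<lambda>i. k * a i) x" for x
    proof -
      have "(\<Prod>i\<in>I. (X i x powi a i) powi k) = (?M a x) powi k"
        by (induction I rule: infinite_finite_induct) (simp_all add: power_int_mult_distrib)
      then show ?thesis by (simp add: power_int_mult[symmetric] mult.commute[of k])
    qed
    then have "\<exists>c. \<forall>x\<in>V. ?M a x = c"
      using c X I by (intro root_of_constant[OF _ _ k] reg_prod reg_powi) auto
    then show ?thesis by (simp add: constant_exps_def)
  qed
  show "card J \<le> r" if J: "J \<subseteq> I" and ind: "\<And>a. a \<in> constant_exps I X \<Longrightarrow> (\<And>i. i \<notin> J \<Longrightarrow> a i = 0) \<Longrightarrow> \<forall>i\<in>J. a i = 0" for J
  proof (rule ccontr)
    assume "\<not> card J \<le> r"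
    then obtain J' where J': "J' \<subseteq> J" "card J' = Suc r"
      using obtain_subset_with_card_n[of "Suc r" J] by (metis not_less_eq_eq)
    then have finJ': "finite J'" using card.infinite by force
    obtain h where h: "bij_betw h {..r} J'"
      using ex_bij_betw_nat_finite[OF finJ'] J'(2) by (auto simp: atLeast0LessThan lessThan_Suc_atMost)
    have hI: "h i \<in> I" if "i \<le> r" for i using bij_betwE[OF h] that J' J by blast
    obtain e c where e: "\<exists>i\<le>r. e i \<noteq> (0 :: int)" "\<forall>x\<in>V. (\<Prod>i\<le>r. X (h i) x powi e i) = c"
      using r[unfolded unit_rank_le_def, rule_format, of "\<lambda>i. X (h i)"] X hI by blast
    define a where "a j = (if j \<in> J' then e (inv_into {..r} h j) else 0)" for j
    have ah: "a (h i) = e i" if "i \<le> r" for i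
      using h that bij_betwE[OF h] by (simp add: a_def bij_betw_def)
    have "?M a x = (\<Prod>i\<le>r. X (h i) x powi e i)" for x
    proof -
      have "?M a x = (\<Prod>j\<in>J'. X j x powi a j)"
        using J J'(1) I by (intro prod.mono_neutral_right) (auto simp: a_def)
      also have "\<dots> = (\<Prod>i\<le>r. X (h i) x powi a (h i))"
        by (rule prod.reindex_bij_betw[OF h, symmetric])
      also have "\<dots> = (\<Prod>i\<le>r. X (h i) x powi e i)" by (rule prod.cong) (simp_all add: ah)
      finally show ?thesis .
    qed
    then have "a \<in> constant_exps I X" using e(2) by (auto simp: constant_exps_def)
    moreover have "a i = 0" if "i \<notin> J" for i using that J'(1) by (auto simp: a_def)
    ultimately have "\<forall>i\<in>J. a i = 0" by (rule ind)
    then have "e i = 0" if "i \<le> r" for i using ah[OF that] bij_betwE[OF h] that J'(1) by (metis atMost_iff subsetD)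
    then show False using e(1) by blast
  qed
qed

text \<open>The coordinate functions of all \<open>\<rho> k\<close> form a finite family of units
  that the group permutes, so it acts on the lattice they generate modulo constants. Elements with
  equal Minkowski codes act equally, that is, their effects on these units differ by constant
  factors.\<close>

lemma finite_action_codes:
  fixes G :: "'g monoid"
  assumes r: "unit_rank_le r" and G: "group G" "finite (carrier G)"
    and \<rho>: "\<And>g x. g \<in> carrier G \<Longrightarrow> x \<in> V \<Longrightarrow> \<rho> g x \<in> V"
      "\<And>g h x. g \<in> carrier G \<Longrightarrow> h \<in> carrier G \<Longrightarrow> x \<in> V \<Longrightarrow> \<rho> (g \<otimes>\<^bsub>G\<^esub> h) x = \<rho> g (\<rho> h x)"
      "\<And>g j. g \<in> carrier G \<Longrightarrow> j < n \<Longrightarrow> reg (\<lambda>x. \<rho> g x j)"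
  shows "\<exists>(\<kappa> :: 'g \<Rightarrow> nat \<times> nat \<Rightarrow> int) C. finite C \<and> card C \<le> 3 ^ (r * r) \<and> (\<forall>g\<in>carrier G. \<kappa> g \<in> C) \<and>
    (\<forall>g\<in>carrier G. \<forall>h\<in>carrier G. \<kappa> g = \<kappa> h \<longrightarrow>
      (\<forall>k\<in>carrier G. \<forall>j<n. \<exists>c. \<forall>x\<in>V. \<rho> k (\<rho> g x) j = c * \<rho> k (\<rho> h x) j))"
proof -
  interpret group G by fact
  define I where "I = {..<n} \<times> carrier G"
  define X where "X i x = \<rho> (snd i) x (fst i)" for i :: "nat \<times> 'g" and x
  have finI: "finite I" using G(2) by (simp add: I_def)
  have regX: "reg (X i)" if "i \<in> I" for i using that \<rho>(3) by (auto simp: I_def X_def[abs_def])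
  have X0: "X i x \<noteq> 0" if "i \<in> I" "x \<in> V" for i x using that \<rho>(1) V_torus by (auto simp: I_def X_def)
  define M where "M a x = (\<Prod>i\<in>I. X i x powi a i)" for a x
  have L: "a \<in> constant_exps I X \<longleftrightarrow> (\<exists>c. \<forall>x\<in>V. M a x = c)" for a by (simp add: constant_exps_def M_def)
  have "\<exists>l c. l \<le> r \<and> (\<forall>a j. l \<le> j \<longrightarrow> c a j = 0) \<and>
    (\<forall>a b k. c (\<lambda>i. a i + k * b i) = (\<lambda>j. c a j + k * c b j)) \<and>
    (\<forall>a. c a = (\<lambda>_ :: nat. 0 :: int) \<longleftrightarrow> a \<in> constant_exps I X)"
    by (rule constant_exps_lattice[OF r finI]) (fact regX, fact X0)
  then obtain l c where lc: "l \<le> r" "\<And>a j. l \<le> j \<Longrightarrow> c a j = 0"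
    "\<And>a b k. c (\<lambda>i. a i + k * b i) = (\<lambda>j. c a j + k * c b j)"
    "\<And>a. c a = (\<lambda>_ :: nat. 0 :: int) \<longleftrightarrow> a \<in> constant_exps I X"
    by (elim exE conjE) blast
  \<comment> \<open>Pulling \<open>X (j, k)\<close> back along \<open>g\<close> gives the member of
    the family at \<open>j\<close> and the product of \<open>k\<close> and \<open>g\<close>, so
    exponents move by the inverse of \<open>g\<close>. The action is therefore one from the
    right.\<close>
  define shift where "shift g a = (\<lambda>i. a (fst i, snd i \<otimes>\<^bsub>G\<^esub> inv\<^bsub>G\<^esub> g))" for g and a :: "nat \<times> 'g \<Rightarrow> int"
  have shift_lin: "shift g (\<lambda>i. a i + k * b i) = (\<lambda>i. shift g a i + k * shift g b i)" for g a b k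
    by (simp add: shift_def)
  have M_shift: "M (shift g a) x = M a (\<rho> g x)" if g: "g \<in> carrier G" and x: "x \<in> V" for g a x
  proof -
    have "M a (\<rho> g x) = (\<Prod>i\<in>I. \<rho> (snd i \<otimes>\<^bsub>G\<^esub> g) x (fst i) powi a i)"
      unfolding M_def X_def using g x by (intro prod.cong) (auto simp: I_def \<rho>(2))
    also have "\<dots> = M (shift g a) x"
      unfolding M_def X_def shift_def
      by (rule prod.reindex_bij_witness[of _ "\<lambda>i. (fst i, snd i \<otimes>\<^bsub>G\<^esub> inv\<^bsub>G\<^esub> g)" "\<lambda>i. (fst i, snd i \<otimes>\<^bsub>G\<^esub> g)"])
        (use g in \<open>auto simp: I_def m_assoc\<close>)
    finally show ?thesis by simp
  qed
  have shift_L: "shift g a \<in> constant_exps I X" if "g \<in> carrier G" "a \<in> constant_exps I X" for g a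
    using that \<rho>(1) unfolding L by (metis M_shift)
  have c_eq: "c a = c b \<longleftrightarrow> (\<lambda>i. a i + (- 1) * b i) \<in> constant_exps I X" for a b
    unfolding lc(4)[symmetric] lc(3) by (auto simp: fun_eq_iff)
  have c_cong: "c a = c b" if "\<And>i. i \<in> I \<Longrightarrow> a i = b i" for a b
  proof -
    have "M (\<lambda>i. a i + (- 1) * b i) x = 1" for x using that by (simp add: M_def)
    then show ?thesis unfolding c_eq L by blast
  qed
  define \<Lambda> where "\<Lambda> = range c"
  \<comment> \<open>The preimage under \<open>c\<close> is arbitrary; the choice is harmless because
    \<open>shift g\<close> preserves the kernel of \<open>c\<close>.\<close>
  define act where "act g v = c (shift g (SOME a. c a = v))" for g v
  have act_c: "act g (c a) = c (shift g a)" if g: "g \<in> carrier G" for g a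
  proof -
    have "c (SOME b. c b = c a) = c a" by (rule someI[of "\<lambda>b. c b = c a"]) simp
    then have "(\<lambda>i. (SOME b. c b = c a) i + (- 1) * a i) \<in> constant_exps I X" by (simp only: c_eq)
    from shift_L[OF g this] show ?thesis unfolding shift_lin act_def c_eq .
  qed
  have "\<exists>(\<kappa> :: 'g \<Rightarrow> nat \<times> nat \<Rightarrow> int) C. finite C \<and> card C \<le> 3 ^ (l * l) \<and> (\<forall>g\<in>carrier G. \<kappa> g \<in> C) \<and>
    (\<forall>g\<in>carrier G. \<forall>h\<in>carrier G. \<kappa> g = \<kappa> h \<longrightarrow> (\<forall>v\<in>\<Lambda>. act g v = act h v))"
  proof (rule minkowski_codes[OF G])
    have "c (\<lambda>_. 0) = (\<lambda>_. 0)" using lc(3)[of "\<lambda>_. 0" "- 1" "\<lambda>_. 0"] by (auto simp: fun_eq_iff)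
    then show "(\<lambda>_. 0) \<in> \<Lambda>" unfolding \<Lambda>_def by (metis rangeI)
    show "(\<lambda>j. u j + k * v j) \<in> \<Lambda>" if "u \<in> \<Lambda>" "v \<in> \<Lambda>" for u v k
      using that unfolding \<Lambda>_def by (auto simp flip: lc(3))
    show "v j = 0" if "v \<in> \<Lambda>" "l \<le> j" for v j using that lc(2) by (auto simp: \<Lambda>_def)
    show "act g v \<in> \<Lambda>" for g v by (simp add: act_def \<Lambda>_def)
    show "act g (\<lambda>j. u j + k * v j) = (\<lambda>j. act g u j + k * act g v j)"
      if g: "g \<in> carrier G" and uv: "u \<in> \<Lambda>" "v \<in> \<Lambda>" for g u v k
    proof -
      obtain a b where ab: "u = c a" "v = c b" using uv by (auto simp: \<Lambda>_def)
      show ?thesis unfolding ab lc(3)[symmetric] act_c[OF g] shift_lin ..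
    qed
    show "act \<one>\<^bsub>G\<^esub> v = v" if v: "v \<in> \<Lambda>" for v
    proof -
      obtain a where a: "v = c a" using v by (auto simp: \<Lambda>_def)
      show ?thesis unfolding a act_c[OF one_closed] by (rule c_cong) (auto simp: shift_def I_def)
    qed
    show "act (g \<otimes>\<^bsub>G\<^esub> h) v = act h (act g v)" if gh: "g \<in> carrier G" "h \<in> carrier G" and v: "v \<in> \<Lambda>" for g h v
    proof -
      obtain a where a: "v = c a" using v by (auto simp: \<Lambda>_def)
      show ?thesis unfolding a act_c[OF gh(1)] act_c[OF gh(2)] act_c[OF m_closed[OF gh]]
        by (rule c_cong) (use gh in \<open>auto simp: shift_def I_def inv_mult_group m_assoc\<close>)
    qed
  qed
  then obtain \<kappa> :: "'g \<Rightarrow> nat \<times> nat \<Rightarrow> int" and C where \<kappa>: "finite C" "card C \<le> 3 ^ (l * l)" "\<forall>g\<in>carrier G. \<kappa> g \<in> C"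
    "\<forall>g\<in>carrier G. \<forall>h\<in>carrier G. \<kappa> g = \<kappa> h \<longrightarrow> (\<forall>v\<in>\<Lambda>. act g v = act h v)" by blast
  have "l * l \<le> r * r" using lc(1) by (intro mult_mono) auto
  then have "(3 :: nat) ^ (l * l) \<le> 3 ^ (r * r)" by (intro power_increasing) auto
  then have "card C \<le> 3 ^ (r * r)" by (rule le_trans[OF \<kappa>(2)])
  moreover have "\<exists>d. \<forall>x\<in>V. \<rho> k (\<rho> g x) j = d * \<rho> k (\<rho> h x) j"
    if g: "g \<in> carrier G" and h: "h \<in> carrier G" and eq: "\<kappa> g = \<kappa> h" and k: "k \<in> carrier G" and j: "j < n" for g h k j
  proof -
    \<comment> \<open>The unit vector of the index \<open>(j, k)\<close> recovers the single unit
      \<open>X (j, k)\<close>.\<close>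
    define a where "a i = (if i = (j, k) then 1 else 0 :: int)" for i
    have Ma: "M a x = \<rho> k x j" for x
    proof -
      have "M a x = (\<Prod>i\<in>I. if i = (j, k) then X i x else 1)" unfolding M_def a_def by (intro prod.cong) auto
      then show ?thesis using finI j k by (simp add: I_def X_def)
    qed
    have "c a \<in> \<Lambda>" by (simp add: \<Lambda>_def)
    then have "act g (c a) = act h (c a)" using \<kappa>(4) g h eq by blast
    then have "(\<lambda>i. shift g a i + (- 1) * shift h a i) \<in> constant_exps I X"
      unfolding act_c[OF g] act_c[OF h] c_eq .
    then obtain d where d: "\<forall>x\<in>V. M (\<lambda>i. shift g a i + (- 1) * shift h a i) x = d" unfolding L by blast
    have "M (\<lambda>i. shift g a i + (- 1) * shift h a i) x * M (shift h a) x = M (shift g a) x" if "x \<in> V" for x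
      unfolding M_def prod.distrib[symmetric]
    proof (rule prod.cong[OF refl])
      fix i assume "i \<in> I"
      have "X i x powi (shift g a i + (- 1) * shift h a i) * X i x powi shift h a i
          = X i x powi (shift g a i + (- 1) * shift h a i + shift h a i)"
        using X0[OF \<open>i \<in> I\<close> that] by (subst power_int_add) auto
      then show "X i x powi (shift g a i + (- 1) * shift h a i) * X i x powi shift h a i = X i x powi shift g a i"
        by simp
    qed
    then have "\<rho> k (\<rho> g x) j = d * \<rho> k (\<rho> h x) j" if "x \<in> V" for x
      using d that M_shift[OF g that, of a] M_shift[OF h that, of a] Ma by metis
    then show ?thesis by blast
  qed
  ultimately show ?thesis using \<kappa>(1,3) by (intro exI[of _ \<kappa>] exI[of _ C]) blast
qed

text \<open>The subgroup acting by scalars on the group of units generated by the coordinates is abelian,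
  since an automorphism is determined by its effect on the coordinates.\<close>

lemma finite_action_jordan:
  fixes G :: "'g monoid"
  assumes r: "unit_rank_le r" and G: "group G" "finite (carrier G)" and V: "V \<subseteq> affine_points n"
    and \<rho>: "\<And>g x. g \<in> carrier G \<Longrightarrow> x \<in> V \<Longrightarrow> \<rho> g x \<in> V"
      "\<And>g h x. g \<in> carrier G \<Longrightarrow> h \<in> carrier G \<Longrightarrow> x \<in> V \<Longrightarrow> \<rho> (g \<otimes>\<^bsub>G\<^esub> h) x = \<rho> g (\<rho> h x)"
      "\<And>g j. g \<in> carrier G \<Longrightarrow> j < n \<Longrightarrow> reg (\<lambda>x. \<rho> g x j)"
      "\<And>x. x \<in> V \<Longrightarrow> \<rho> \<one>\<^bsub>G\<^esub> x = x"
      "\<And>g h. g \<in> carrier G \<Longrightarrow> h \<in> carrier G \<Longrightarrow> (\<And>x. x \<in> V \<Longrightarrow> \<rho> g x = \<rho> h x) \<Longrightarrow> g = h"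
  shows "\<exists>A. A \<lhd> G \<and> comm_group (G\<lparr>carrier := A\<rparr>) \<and> card (rcosets\<^bsub>G\<^esub> A) \<le> 3 ^ (r * r)"
proof -
  interpret group G by fact
  \<comment> \<open>All \<open>k\<close> are included and not only the identity: conjugation by
    \<open>g\<close> replaces \<open>k\<close> by its product with \<open>g\<close>, so the
    condition is invariant and \<open>A\<close> is normal.\<close>
  define sc where "sc g \<longleftrightarrow> (\<forall>k\<in>carrier G. \<forall>j<n. \<exists>c. \<forall>x\<in>V. \<rho> k (\<rho> g x) j = c * \<rho> k x j)" for g
  define A where "A = {g \<in> carrier G. sc g}"
  have nz: "\<rho> k x j \<noteq> 0" if "k \<in> carrier G" "x \<in> V" "j < n" for k x j
    using V_torus \<rho>(1) that by blast
  have inv_\<rho>: "\<rho> g (\<rho> (inv\<^bsub>G\<^esub> g) x) = x" if "g \<in> carrier G" "x \<in> V" for g x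
    using that \<rho>(2)[of g "inv\<^bsub>G\<^esub> g" x] \<rho>(4) by simp
  have sub: "subgroup A G"
  proof (rule subgroupI)
    show "A \<subseteq> carrier G" by (auto simp: A_def)
    have "sc \<one>\<^bsub>G\<^esub>" unfolding sc_def using \<rho>(4) by (intro ballI allI impI exI[of _ 1]) simp
    then show "A \<noteq> {}" unfolding A_def by auto
    show "inv\<^bsub>G\<^esub> g \<in> A" if "g \<in> A" for g
    proof -
      have g: "g \<in> carrier G" "sc g" using that by (auto simp: A_def)
      have "sc (inv\<^bsub>G\<^esub> g)" unfolding sc_def
      proof (intro ballI allI impI)
        fix k j assume k: "k \<in> carrier G" and j: "j < n"
        obtain c where c: "\<forall>x\<in>V. \<rho> k (\<rho> g x) j = c * \<rho> k x j" using g(2) k j unfolding sc_def by blast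
        have "\<rho> k (\<rho> (inv\<^bsub>G\<^esub> g) x) j = inverse c * \<rho> k x j" if x: "x \<in> V" for x
        proof -
          have "\<rho> k x j = c * \<rho> k (\<rho> (inv\<^bsub>G\<^esub> g) x) j"
            using c \<rho>(1)[OF inv_closed[OF g(1)] x] inv_\<rho>[OF g(1) x] by metis
          moreover from this have "c \<noteq> 0" using nz[OF k x j] by auto
          ultimately show ?thesis by simp
        qed
        then show "\<exists>c. \<forall>x\<in>V. \<rho> k (\<rho> (inv\<^bsub>G\<^esub> g) x) j = c * \<rho> k x j" by blast
      qed
      then show ?thesis using g(1) by (simp add: A_def)
    qed
    show "g \<otimes>\<^bsub>G\<^esub> h \<in> A" if "g \<in> A" "h \<in> A" for g h
    proof -
      have gh: "g \<in> carrier G" "sc g" "h \<in> carrier G" "sc h" using that by (auto simp: A_def)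
      have "sc (g \<otimes>\<^bsub>G\<^esub> h)" unfolding sc_def
      proof (intro ballI allI impI)
        fix k j assume k: "k \<in> carrier G" and j: "j < n"
        obtain c where c: "\<forall>x\<in>V. \<rho> k (\<rho> g x) j = c * \<rho> k x j" using gh(2) k j unfolding sc_def by blast
        obtain d where d: "\<forall>x\<in>V. \<rho> k (\<rho> h x) j = d * \<rho> k x j" using gh(4) k j unfolding sc_def by blast
        have "\<rho> k (\<rho> (g \<otimes>\<^bsub>G\<^esub> h) x) j = (c * d) * \<rho> k x j" if x: "x \<in> V" for x
          using c d x gh \<rho>(1,2) by simp
        then show "\<exists>c. \<forall>x\<in>V. \<rho> k (\<rho> (g \<otimes>\<^bsub>G\<^esub> h) x) j = c * \<rho> k x j" by blast
      qed
      then show ?thesis using gh by (simp add: A_def)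
    qed
  qed
  have normal: "A \<lhd> G"
    unfolding normal_inv_iff
  proof (intro conjI ballI sub)
    fix g h assume g: "g \<in> carrier G" and "h \<in> A"
    then have h: "h \<in> carrier G" "sc h" by (auto simp: A_def)
    have "sc (g \<otimes>\<^bsub>G\<^esub> h \<otimes>\<^bsub>G\<^esub> inv\<^bsub>G\<^esub> g)" unfolding sc_def
    proof (intro ballI allI impI)
      fix k j assume k: "k \<in> carrier G" and j: "j < n"
      have kg: "k \<otimes>\<^bsub>G\<^esub> g \<in> carrier G" using k g by simp
      obtain c where c: "\<forall>x\<in>V. \<rho> (k \<otimes>\<^bsub>G\<^esub> g) (\<rho> h x) j = c * \<rho> (k \<otimes>\<^bsub>G\<^esub> g) x j"
        using h(2) kg j unfolding sc_def by blast
      have "\<rho> k (\<rho> (g \<otimes>\<^bsub>G\<^esub> h \<otimes>\<^bsub>G\<^esub> inv\<^bsub>G\<^esub> g) x) j = c * \<rho> k x j" if x: "x \<in> V" for x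
      proof -
        let ?y = "\<rho> (inv\<^bsub>G\<^esub> g) x"
        have y: "?y \<in> V" using g x \<rho>(1) by simp
        have "\<rho> k (\<rho> (g \<otimes>\<^bsub>G\<^esub> h \<otimes>\<^bsub>G\<^esub> inv\<^bsub>G\<^esub> g) x) = \<rho> k (\<rho> g (\<rho> h ?y))"
          using g h(1) x y by (simp add: \<rho>(2))
        also have "\<dots> = \<rho> (k \<otimes>\<^bsub>G\<^esub> g) (\<rho> h ?y)" using k g y h(1) \<rho>(1) by (simp add: \<rho>(2))
        finally have "\<rho> k (\<rho> (g \<otimes>\<^bsub>G\<^esub> h \<otimes>\<^bsub>G\<^esub> inv\<^bsub>G\<^esub> g) x) j = c * \<rho> (k \<otimes>\<^bsub>G\<^esub> g) ?y j" using c y by simp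
        also have "\<rho> (k \<otimes>\<^bsub>G\<^esub> g) ?y = \<rho> k x" using k g y inv_\<rho>[OF g x] by (simp add: \<rho>(2))
        finally show ?thesis .
      qed
      then show "\<exists>c. \<forall>x\<in>V. \<rho> k (\<rho> (g \<otimes>\<^bsub>G\<^esub> h \<otimes>\<^bsub>G\<^esub> inv\<^bsub>G\<^esub> g) x) j = c * \<rho> k x j" by blast
    qed
    then show "g \<otimes>\<^bsub>G\<^esub> h \<otimes>\<^bsub>G\<^esub> inv\<^bsub>G\<^esub> g \<in> A" using g h by (simp add: A_def)
  qed
  have comm: "g \<otimes>\<^bsub>G\<^esub> h = h \<otimes>\<^bsub>G\<^esub> g" if "g \<in> A" "h \<in> A" for g h
  proof -
    have gh: "g \<in> carrier G" "sc g" "h \<in> carrier G" "sc h" using that by (auto simp: A_def)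
    have scal: "\<exists>c. \<forall>x\<in>V. \<rho> g x j = c * x j" if g: "g \<in> carrier G" "sc g" and j: "j < n" for g j
    proof -
      obtain c where "\<forall>x\<in>V. \<rho> \<one>\<^bsub>G\<^esub> (\<rho> g x) j = c * \<rho> \<one>\<^bsub>G\<^esub> x j" using g(2) j one_closed unfolding sc_def by blast
      then show ?thesis using \<rho>(1)[OF g(1)] \<rho>(4) by auto
    qed
    show ?thesis
    proof (rule \<rho>(5))
      show "g \<otimes>\<^bsub>G\<^esub> h \<in> carrier G" "h \<otimes>\<^bsub>G\<^esub> g \<in> carrier G" using gh by auto
      fix x assume x: "x \<in> V"
      have in_V: "\<rho> (g \<otimes>\<^bsub>G\<^esub> h) x \<in> V" "\<rho> (h \<otimes>\<^bsub>G\<^esub> g) x \<in> V" using gh x \<rho>(1) by simp_all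
      show "\<rho> (g \<otimes>\<^bsub>G\<^esub> h) x = \<rho> (h \<otimes>\<^bsub>G\<^esub> g) x"
      proof (rule PiE_ext[of _ "{..<n}" "\<lambda>_. UNIV"])
        show "\<rho> (g \<otimes>\<^bsub>G\<^esub> h) x \<in> {..<n} \<rightarrow>\<^sub>E UNIV" "\<rho> (h \<otimes>\<^bsub>G\<^esub> g) x \<in> {..<n} \<rightarrow>\<^sub>E UNIV"
          using in_V V by (auto simp: affine_points_def)
        fix j assume "j \<in> {..<n}"
        then have j: "j < n" by simp
        obtain c where c: "\<forall>x\<in>V. \<rho> g x j = c * x j" using scal[OF gh(1,2) j] by blast
        obtain d where d: "\<forall>x\<in>V. \<rho> h x j = d * x j" using scal[OF gh(3,4) j] by blast
        show "\<rho> (g \<otimes>\<^bsub>G\<^esub> h) x j = \<rho> (h \<otimes>\<^bsub>G\<^esub> g) x j"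
          using c d x gh \<rho>(1,2) by simp
      qed
    qed
  qed
  interpret S: group "G\<lparr>carrier := A\<rparr>" by (rule subgroup.subgroup_is_group[OF sub is_group])
  have comm_A: "comm_group (G\<lparr>carrier := A\<rparr>)" by (rule S.group_comm_groupI) (simp add: comm)
  obtain \<kappa> :: "'g \<Rightarrow> nat \<times> nat \<Rightarrow> int" and C where \<kappa>: "finite C" "card C \<le> 3 ^ (r * r)" "\<forall>g\<in>carrier G. \<kappa> g \<in> C"
    "\<forall>g\<in>carrier G. \<forall>h\<in>carrier G. \<kappa> g = \<kappa> h \<longrightarrow>
      (\<forall>k\<in>carrier G. \<forall>j<n. \<exists>c. \<forall>x\<in>V. \<rho> k (\<rho> g x) j = c * \<rho> k (\<rho> h x) j)"
    using finite_action_codes[OF r G \<rho>(1-3)] by blast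
  \<comment> \<open>Equal codes put the quotient of \<open>g\<close> and \<open>h\<close> into
    \<open>A\<close>, so there are at most as many cosets as codes.\<close>
  have coset: "A #>\<^bsub>G\<^esub> g = A #>\<^bsub>G\<^esub> h" if g: "g \<in> carrier G" and h: "h \<in> carrier G" and eq: "\<kappa> g = \<kappa> h" for g h
  proof -
    have "sc (g \<otimes>\<^bsub>G\<^esub> inv\<^bsub>G\<^esub> h)" unfolding sc_def
    proof (intro ballI allI impI)
      fix k j assume k: "k \<in> carrier G" and j: "j < n"
      obtain c where c: "\<forall>x\<in>V. \<rho> k (\<rho> g x) j = c * \<rho> k (\<rho> h x) j" using \<kappa>(4) g h eq k j by blast
      have "\<rho> k (\<rho> (g \<otimes>\<^bsub>G\<^esub> inv\<^bsub>G\<^esub> h) x) j = c * \<rho> k x j" if x: "x \<in> V" for x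
        using c g h x \<rho>(1)[OF inv_closed[OF h] x] inv_\<rho>[OF h x] by (simp add: \<rho>(2))
      then show "\<exists>c. \<forall>x\<in>V. \<rho> k (\<rho> (g \<otimes>\<^bsub>G\<^esub> inv\<^bsub>G\<^esub> h) x) j = c * \<rho> k x j" by blast
    qed
    then have gh: "g \<otimes>\<^bsub>G\<^esub> inv\<^bsub>G\<^esub> h \<in> A" using g h by (simp add: A_def)
    have AG: "A \<subseteq> carrier G" by (auto simp: A_def)
    have "A #>\<^bsub>G\<^esub> h = (A #>\<^bsub>G\<^esub> (g \<otimes>\<^bsub>G\<^esub> inv\<^bsub>G\<^esub> h)) #>\<^bsub>G\<^esub> h"
      using coset_join2[OF _ sub gh] g h by simp
    also have "\<dots> = A #>\<^bsub>G\<^esub> (g \<otimes>\<^bsub>G\<^esub> inv\<^bsub>G\<^esub> h \<otimes>\<^bsub>G\<^esub> h)" using AG g h by (intro coset_mult_assoc) auto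
    also have "g \<otimes>\<^bsub>G\<^esub> inv\<^bsub>G\<^esub> h \<otimes>\<^bsub>G\<^esub> h = g" using g h by (simp add: m_assoc)
    finally show ?thesis by simp
  qed
  have "rcosets\<^bsub>G\<^esub> A \<subseteq> (\<lambda>z. A #>\<^bsub>G\<^esub> (SOME g. g \<in> carrier G \<and> \<kappa> g = z)) ` C"
  proof
    fix B assume "B \<in> rcosets\<^bsub>G\<^esub> A"
    then obtain g where g: "g \<in> carrier G" "B = A #>\<^bsub>G\<^esub> g" by (auto simp: RCOSETS_def)
    have "(SOME g'. g' \<in> carrier G \<and> \<kappa> g' = \<kappa> g) \<in> carrier G \<and> \<kappa> (SOME g'. g' \<in> carrier G \<and> \<kappa> g' = \<kappa> g) = \<kappa> g"
      by (rule someI[of "\<lambda>g'. g' \<in> carrier G \<and> \<kappa> g' = \<kappa> g" g]) (use g in simp)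
    then have "B = A #>\<^bsub>G\<^esub> (SOME g'. g' \<in> carrier G \<and> \<kappa> g' = \<kappa> g)" using coset g by metis
    then show "B \<in> (\<lambda>z. A #>\<^bsub>G\<^esub> (SOME g. g \<in> carrier G \<and> \<kappa> g = z)) ` C" using \<kappa>(3) g(1) by blast
  qed
  from surj_card_le[OF \<kappa>(1) this] have "card (rcosets\<^bsub>G\<^esub> A) \<le> 3 ^ (r * r)" using \<kappa>(2) by simp
  with normal comm_A show ?thesis by blast
qed

end

section \<open>Morphisms and the automorphism group\<close>

lemma morphism_pullback:
  assumes "morphism X Y \<phi>" "openin (space_top Y) V" "f \<in> regular Y V"
  shows "restrict (f \<circ> \<phi>) {x \<in> points X. \<phi> x \<in> V} \<in> regular X {x \<in> points X. \<phi> x \<in> V}"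
  using assms by (simp add: morphism_def)

lemma morphism_compose:
  assumes "morphism X Y \<phi>" "morphism Y Z \<psi>"
  shows "morphism X Z (\<psi> \<circ> \<phi>)"
  unfolding morphism_def
proof (intro conjI allI impI)
  have c: "continuous_map (space_top X) (space_top Y) \<phi>" "continuous_map (space_top Y) (space_top Z) \<psi>"
    using assms by (auto simp: morphism_def)
  then show "continuous_map (space_top X) (space_top Z) (\<psi> \<circ> \<phi>)" by (rule continuous_map_compose)
  fix V f assume V: "openin (space_top Z) V \<and> f \<in> regular Z V"
  let ?U = "{y \<in> points Y. \<psi> y \<in> V}"
  have "openin (space_top Y) ?U" using c(2) V by (intro openin_continuous_map_preimage) auto
  moreover have "restrict (f \<circ> \<psi>) ?U \<in> regular Y ?U" using V by (intro morphism_pullback[OF assms(2)]) auto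
  ultimately have "restrict (restrict (f \<circ> \<psi>) ?U \<circ> \<phi>) {x \<in> points X. \<phi> x \<in> ?U} \<in> regular X {x \<in> points X. \<phi> x \<in> ?U}"
    by (rule morphism_pullback[OF assms(1)])
  moreover have "{x \<in> points X. \<phi> x \<in> ?U} = {x \<in> points X. (\<psi> \<circ> \<phi>) x \<in> V}"
    using continuous_map_image_subset_topspace[OF c(1)] by auto
  moreover have "restrict (restrict (f \<circ> \<psi>) ?U \<circ> \<phi>) {x \<in> points X. \<phi> x \<in> ?U}
      = restrict (f \<circ> (\<psi> \<circ> \<phi>)) {x \<in> points X. \<phi> x \<in> ?U}"
    by (rule restrict_ext) auto
  ultimately show "restrict (f \<circ> (\<psi> \<circ> \<phi>)) {x \<in> points X. (\<psi> \<circ> \<phi>) x \<in> V} \<in> regular X {x \<in> points X. (\<psi> \<circ> \<phi>) x \<in> V}"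
    by simp
qed

lemma morphism_cong:
  assumes "morphism X Y \<phi>" and eq: "\<And>x. x \<in> points X \<Longrightarrow> \<phi> x = \<psi> x"
  shows "morphism X Y \<psi>"
  unfolding morphism_def
proof (intro conjI allI impI)
  show "continuous_map (space_top X) (space_top Y) \<psi>"
    using assms(1) eq by (auto simp: morphism_def intro: continuous_map_eq)
  fix V f assume V: "openin (space_top Y) V \<and> f \<in> regular Y V"
  have s: "{x \<in> points X. \<psi> x \<in> V} = {x \<in> points X. \<phi> x \<in> V}" using eq by auto
  have "restrict (f \<circ> \<psi>) {x \<in> points X. \<phi> x \<in> V} = restrict (f \<circ> \<phi>) {x \<in> points X. \<phi> x \<in> V}"
    by (rule restrict_ext) (simp add: eq)
  then show "restrict (f \<circ> \<psi>) {x \<in> points X. \<psi> x \<in> V} \<in> regular X {x \<in> points X. \<psi> x \<in> V}"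
    using assms(1) V unfolding s by (simp add: morphism_def)
qed

lemma morphism_id:
  fixes X :: "('a, 'k :: field) fun_space"
  assumes "space_with_functions X"
  shows "morphism X X (\<lambda>x. x)"
  unfolding morphism_def
proof (intro conjI allI impI)
  show "continuous_map (space_top X) (space_top X) (\<lambda>x. x)" by simp
  fix V f assume V: "openin (space_top X) V \<and> f \<in> regular X V"
  have "{x \<in> points X. x \<in> V} = V" using openin_subset V by fastforce
  moreover have "restrict f V \<in> regular X V"
    using assms[unfolded space_with_functions_def, THEN conjunct2, THEN conjunct1] V by (elim allE[of _ V]) simp
  ultimately show "restrict (f \<circ> (\<lambda>x. x)) {x \<in> points X. x \<in> V} \<in> regular X {x \<in> points X. x \<in> V}"
    by (simp add: comp_def)
qed

lemma morphism_maps: "morphism X Y \<phi> \<Longrightarrow> x \<in> points X \<Longrightarrow> \<phi> x \<in> points Y"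
  using continuous_map_image_subset_topspace by (fastforce simp: morphism_def)

lemma Bij_maps: "f \<in> Bij S \<Longrightarrow> x \<in> S \<Longrightarrow> f x \<in> S"
  using Bij_imp_funcset by blast

lemma isomorphism_compose:
  assumes "isomorphism X Y \<phi>" "isomorphism Y Z \<psi>"
  shows "isomorphism X Z (\<psi> \<circ> \<phi>)"
proof -
  obtain \<phi>' where \<phi>': "morphism Y X \<phi>'" "\<forall>x\<in>points X. \<phi>' (\<phi> x) = x" "\<forall>y\<in>points Y. \<phi> (\<phi>' y) = y"
    using assms(1) unfolding isomorphism_def by (elim conjE exE)
  obtain \<psi>' where \<psi>': "morphism Z Y \<psi>'" "\<forall>x\<in>points Y. \<psi>' (\<psi> x) = x" "\<forall>y\<in>points Z. \<psi> (\<psi>' y) = y"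
    using assms(2) unfolding isomorphism_def by (elim conjE exE)
  have m: "morphism X Y \<phi>" "morphism Y Z \<psi>" using assms by (auto simp: isomorphism_def)
  show ?thesis unfolding isomorphism_def
    using \<phi>' \<psi>' m morphism_maps[OF m(1)] morphism_maps[OF \<psi>'(1)]
    by (intro conjI exI[of _ "\<phi>' \<circ> \<psi>'"]) (auto intro: morphism_compose)
qed

text \<open>Elements of \<open>Bij\<close> are extensional, while plain composites and inverse
  morphisms need not be; this lemma passes between the two.\<close>

lemma isomorphism_cong:
  assumes "isomorphism X Y \<phi>" and eq: "\<And>x. x \<in> points X \<Longrightarrow> \<phi> x = \<psi> x"
  shows "isomorphism X Y \<psi>"
proof -
  obtain \<phi>' where \<phi>': "morphism Y X \<phi>'" "\<forall>x\<in>points X. \<phi>' (\<phi> x) = x" "\<forall>y\<in>points Y. \<phi> (\<phi>' y) = y"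
    using assms(1) unfolding isomorphism_def by (elim conjE exE)
  have "morphism X Y \<psi>" using assms by (auto simp: isomorphism_def intro: morphism_cong)
  then show ?thesis unfolding isomorphism_def
    using \<phi>' eq[symmetric] morphism_maps[OF \<phi>'(1)] by (intro conjI exI[of _ \<phi>']) auto
qed

lemma group_Aut:
  fixes X :: "('a, 'k :: field) fun_space"
  assumes X: "space_with_functions X"
  shows "group (Aut X)"
proof -
  let ?B = "BijGroup (points X)"
  let ?H = "{\<phi> \<in> Bij (points X). isomorphism X X \<phi>}"
  interpret B: group ?B by (rule group_BijGroup)
  have "subgroup ?H ?B"
  proof (rule B.subgroupI)
    show "?H \<subseteq> carrier ?B" by (auto simp: BijGroup_def)
    have "isomorphism X X (\<lambda>x. x)"
      using morphism_id[OF X] unfolding isomorphism_def by (intro conjI exI[of _ "\<lambda>x. x"]) auto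
    then have "isomorphism X X (\<lambda>x\<in>points X. x)" by (rule isomorphism_cong) simp
    then show "?H \<noteq> {}" using id_Bij by blast
    show "inv\<^bsub>?B\<^esub> \<phi> \<in> ?H" if "\<phi> \<in> ?H" for \<phi>
    proof -
      have \<phi>: "\<phi> \<in> Bij (points X)" "isomorphism X X \<phi>" using that by auto
      then obtain \<psi> where \<psi>: "morphism X X \<psi>" "\<forall>x\<in>points X. \<psi> (\<phi> x) = x" "\<forall>y\<in>points X. \<phi> (\<psi> y) = y"
        unfolding isomorphism_def by (elim conjE exE)
      have "isomorphism X X \<psi>" using \<psi> \<phi>(2) unfolding isomorphism_def by (intro conjI exI[of _ \<phi>]) auto
      then have "isomorphism X X (\<lambda>x\<in>points X. inv_into (points X) \<phi> x)"
      proof (rule isomorphism_cong)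
        fix x assume x: "x \<in> points X"
        have "inj_on \<phi> (points X)" using \<phi>(1) by (auto simp: Bij_def bij_betw_def)
        then have "inv_into (points X) \<phi> (\<phi> (\<psi> x)) = \<psi> x"
          by (rule inv_into_f_f) (rule morphism_maps[OF \<psi>(1) x])
        then show "\<psi> x = (\<lambda>x\<in>points X. inv_into (points X) \<phi> x) x" using \<psi>(3) x by simp
      qed
      then show ?thesis using \<phi>(1) by (simp add: inv_BijGroup restrict_inv_into_Bij)
    qed
    show "\<phi> \<otimes>\<^bsub>?B\<^esub> \<psi> \<in> ?H" if "\<phi> \<in> ?H" "\<psi> \<in> ?H" for \<phi> \<psi>
    proof -
      have "isomorphism X X (compose (points X) \<phi> \<psi>)"
        by (rule isomorphism_cong[OF isomorphism_compose[of X X \<psi> X \<phi>]]) (use that in \<open>auto simp: compose_def\<close>)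
      then show ?thesis using that by (simp add: BijGroup_def compose_Bij)
    qed
  qed
  then show ?thesis unfolding Aut_def by (rule subgroup.subgroup_is_group) (rule B.is_group)
qed

section \<open>Toral varieties as closed subsets of a torus\<close>

lemma topspace_zariski: "topspace (zariski n) = affine_points n"
proof
  show "topspace (zariski n) \<subseteq> affine_points n"
    unfolding topspace_def openin_zariski by auto
  have "openin (zariski n) (affine_points n)" unfolding openin_zariski
    by (rule exI[of _ "{\<lambda>_. 1}"]) (auto simp: zero_set_def intro: poly_funs.const)
  then show "affine_points n \<subseteq> topspace (zariski n)" by (rule openin_subset)
qed

lemma closedin_zero_set: "S \<subseteq> poly_funs n \<Longrightarrow> closedin (zariski n) (zero_set n S)"
  unfolding closedin_def topspace_zariski openin_zariski by (auto simp: zero_set_def)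

definition torus_points :: "nat \<Rightarrow> (nat \<Rightarrow> 'k :: field) set" where
  "torus_points n = {x \<in> affine_points n. \<forall>i<n. x i \<noteq> 0}"

lemma space_top_torus: "space_top (torus n) = subtopology (zariski n) (torus_points n)"
  by (simp add: torus_def subspace_on_def affine_space_def torus_points_def)

lemma points_torus: "points (torus n) = torus_points n"
  by (auto simp: space_top_torus topspace_zariski torus_points_def)

lemma closed_torus_subset:
  assumes "closedin (space_top (torus n)) Y"
  shows "Y \<subseteq> torus_points n"
  using closedin_subset[OF assms] by (simp add: points_torus)

lemma points_subspace_torus:
  assumes "closedin (space_top (torus n)) Y"
  shows "points (subspace_on (torus n) Y) = Y"
  using closedin_subset[OF assms] by (auto simp: subspace_on_def)

text \<open>Closedness in the torus is turned into the statement that \<open>Y\<close> contains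
  every torus point at which all polynomials vanishing on \<open>Y\<close> vanish. Irreducibility
  comes from \<open>X\<close>, through the closed preimages of zero sets under
  \<open>\<phi>\<close>.\<close>

lemma irreducible_toral_torus_subset:
  fixes X :: "('a, 'k :: {alg_closed_field,field_char_0}) fun_space"
  assumes X: "irreducible_variety X" and Y: "closedin (space_top (torus n)) Y"
    and iso: "isomorphism X (subspace_on (torus n) Y) \<phi>"
  shows "torus_subset n Y"
proof
  let ?S = "subspace_on (torus n) Y"
  obtain \<psi> where \<psi>: "morphism ?S X \<psi>" "\<forall>x\<in>points X. \<psi> (\<phi> x) = x" "\<forall>y\<in>points ?S. \<phi> (\<psi> y) = y"
    and \<phi>: "morphism X ?S \<phi>"
    using iso unfolding isomorphism_def by (elim conjE exE)
  note pY = points_subspace_torus[OF Y] closed_torus_subset[OF Y]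
  have "points X \<noteq> {}" using X by (simp add: irreducible_variety_def)
  then show "Y \<noteq> {}" using morphism_maps[OF \<phi>] pY(1) by blast
  show "x i \<noteq> 0" if "x \<in> Y" "i < n" for x i using that pY(2) by (auto simp: torus_points_def)
  show "x \<in> Y" if x: "x \<in> affine_points n" "\<And>i. i < n \<Longrightarrow> x i \<noteq> 0"
    and van: "\<And>f. f \<in> pf {..<n} \<Longrightarrow> (\<And>y. y \<in> Y \<Longrightarrow> f y = 0) \<Longrightarrow> f x = 0" for x
  proof (rule ccontr)
    assume "x \<notin> Y"
    have "openin (subtopology (zariski n) (torus_points n)) (torus_points n - Y)"
      using Y unfolding closedin_def points_torus space_top_torus[symmetric] by simp
    then obtain S where S: "S \<subseteq> poly_funs n" "torus_points n - Y = (affine_points n - zero_set n S) \<inter> torus_points n"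
      unfolding openin_subtopology openin_zariski by auto
    have "x \<in> torus_points n - Y" using x \<open>x \<notin> Y\<close> by (simp add: torus_points_def)
    then obtain h where h: "h \<in> S" "h x \<noteq> 0" unfolding S(2) zero_set_def by auto
    have "h y = 0" if "y \<in> Y" for y
    proof -
      have "y \<in> torus_points n" "y \<notin> torus_points n - Y" using that pY(2) by auto
      then have "y \<in> zero_set n S" unfolding S(2) by (auto simp: torus_points_def)
      then show ?thesis using h(1) by (simp add: zero_set_def)
    qed
    then show False using van[of h] h S(1) by (auto simp: poly_funs_eq_pf)
  qed
  show "(\<forall>x\<in>Y. p x = 0) \<or> (\<forall>x\<in>Y. q x = 0)"
    if pq: "p \<in> pf {..<n}" "q \<in> pf {..<n}" and z: "\<And>x. x \<in> Y \<Longrightarrow> p x * q x = 0" for p q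
  proof -
    define C where "C p = {x \<in> points X. \<phi> x \<in> zero_set n {p} \<inter> Y}" for p
    have cl: "closedin (space_top X) (C f)" if "f \<in> pf {..<n}" for f
      unfolding C_def
    proof (rule closedin_continuous_map_preimage)
      show "continuous_map (space_top X) (space_top ?S) \<phi>" using \<phi> by (simp add: morphism_def)
      have "closedin (zariski n) (zero_set n {f})" using that by (intro closedin_zero_set) (simp add: poly_funs_eq_pf)
      then have "closedin (subtopology (zariski n) Y) (zero_set n {f} \<inter> Y)" by (auto simp: closedin_subtopology)
      moreover have "space_top ?S = subtopology (zariski n) Y"
        using pY(2) by (simp add: subspace_on_def space_top_torus subtopology_subtopology Int_absorb1)
      ultimately show "closedin (space_top ?S) (zero_set n {f} \<inter> Y)" by simp
    qed
    have "C p \<union> C q = points X"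
    proof -
      have "x \<in> C p \<union> C q" if x: "x \<in> points X" for x
      proof -
        have "\<phi> x \<in> Y" using morphism_maps[OF \<phi> x] pY(1) by simp
        then show ?thesis using z[of "\<phi> x"] x pY(2) by (auto simp: C_def zero_set_def torus_points_def)
      qed
      then show ?thesis by (auto simp: C_def)
    qed
    then have "C p = points X \<or> C q = points X"
      using X cl[OF pq(1)] cl[OF pq(2)] unfolding irreducible_variety_def by (elim conjE) blast
    moreover have "\<forall>y\<in>Y. f y = 0" if C: "C f = points X" for f
    proof
      fix y assume y: "y \<in> Y"
      then have "\<psi> y \<in> C f" unfolding C using morphism_maps[OF \<psi>(1)] pY(1) by simp
      then show "f y = 0" using \<psi>(3) y pY(1) by (simp add: C_def zero_set_def)
    qed
    ultimately show ?thesis by blast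
  qed
qed

text \<open>Unfolding the two subspace structures and the structure of affine space gives a fraction
  of polynomials near \<open>x\<close>. A polynomial \<open>h\<close> with \<open>h x\<close>
  nonzero that vanishes off the neighbourhood makes the relation between numerator and denominator
  global.\<close>

lemma reg_of_regular:
  assumes Y: "torus_subset n Y" "Y \<subseteq> torus_points n"
    and f: "f \<in> regular (subspace_on (torus n) Y) Y"
  shows "torus_subset.reg n Y f"
proof (rule torus_subset.regI[OF Y(1)])
  fix x assume x: "x \<in> Y"
  obtain W g where W: "openin (space_top (torus n)) W" "x \<in> W" "g \<in> regular (torus n) W" "\<forall>y\<in>W \<inter> Y. f y = g y"
    using f x unfolding subspace_on_def by auto
  have "\<exists>W' g'. openin (zariski n) W' \<and> x \<in> W' \<and> W' \<inter> torus_points n \<subseteq> W \<and> g' \<in> regular (affine_space n) W' \<and>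
      (\<forall>y\<in>W' \<inter> torus_points n. g y = g' y)"
    using W(2,3) unfolding torus_def torus_points_def[symmetric] subspace_on_def by (auto simp: affine_space_def)
  then obtain W' g' where W': "openin (zariski n) W'" "x \<in> W'" "W' \<inter> torus_points n \<subseteq> W"
    "g' \<in> regular (affine_space n) W'" "\<forall>y\<in>W' \<inter> torus_points n. g y = g' y" by (elim exE conjE)
  have "\<exists>W p q. openin (zariski n) W \<and> x \<in> W \<and> W \<subseteq> W' \<and> p \<in> poly_funs n \<and> q \<in> poly_funs n \<and>
        (\<forall>y\<in>W. q y \<noteq> 0 \<and> g' y = p y / q y)"
    using W'(2,4) unfolding affine_space_def by auto
  then obtain U p q where U: "openin (zariski n) U" "x \<in> U" "U \<subseteq> W'" "p \<in> poly_funs n" "q \<in> poly_funs n"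
    "\<forall>y\<in>U. q y \<noteq> 0 \<and> g' y = p y / q y" by (elim exE conjE)
  obtain S where S: "S \<subseteq> poly_funs n" "U = affine_points n - zero_set n S"
    using U(1) unfolding openin_zariski by (elim exE conjE)
  obtain h where h: "h \<in> S" "h x \<noteq> 0" using U(2) unfolding S(2) zero_set_def by auto
  have "h y * q y * f y = h y * p y" if y: "y \<in> Y" for y
  proof (cases "y \<in> U")
    case True
    have yT: "y \<in> torus_points n" using Y(2) y by blast
    then have "y \<in> W" using True U(3) W'(3) by blast
    then have "f y = p y / q y" using W(4) W'(5) U(3,6) True y yT by auto
    then show ?thesis using U(6) True by simp
  next
    case False
    then have "y \<in> zero_set n S" using Y(2) y unfolding S(2) by (auto simp: torus_points_def)
    then show ?thesis using h(1) by (simp add: zero_set_def)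
  qed
  moreover have "(\<lambda>y. h y * p y) \<in> pf {..<n}" "(\<lambda>y. h y * q y) \<in> pf {..<n}"
    using h(1) S(1) U(4,5) by (auto simp: poly_funs_eq_pf[symmetric] intro!: poly_funs.mult)
  moreover have "h x * q x \<noteq> 0" using h U(2,6) by simp
  ultimately show "\<exists>p q. p \<in> pf {..<n} \<and> q \<in> pf {..<n} \<and> q x \<noteq> 0 \<and> (\<forall>y\<in>Y. q y * f y = p y)"
    by (intro exI[of _ "\<lambda>y. h y * p y"] exI[of _ "\<lambda>y. h y * q y"]) auto
qed

lemma coordinate_regular:
  assumes j: "j < n" and Y: "Y \<subseteq> torus_points n"
  shows "(\<lambda>y\<in>Y. y j) \<in> regular (subspace_on (torus n) Y) Y"
proof -
  have a: "openin (zariski n) (affine_points n)" by (metis openin_topspace topspace_zariski)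
  have "\<exists>W p q. openin (zariski n) W \<and> x \<in> W \<and> W \<subseteq> affine_points n \<and> p \<in> poly_funs n \<and> q \<in> poly_funs n \<and>
      (\<forall>y\<in>W. q y \<noteq> 0 \<and> (\<lambda>y\<in>affine_points n. y j) y = p y / q y)"
    if "x \<in> affine_points n" for x :: "nat \<Rightarrow> 'a"
    by (rule exI[of _ "affine_points n"], rule exI[of _ "\<lambda>y. y j"], rule exI[of _ "\<lambda>_. 1"])
      (use a that j in \<open>auto intro: poly_funs.intros\<close>)
  then have 1: "(\<lambda>y\<in>affine_points n. y j) \<in> regular (affine_space n) (affine_points n :: (nat \<Rightarrow> 'a) set)"
    unfolding affine_space_def by simp
  have "\<exists>W g. openin (zariski n) W \<and> x \<in> W \<and> W \<inter> torus_points n \<subseteq> torus_points n \<and> g \<in> regular (affine_space n) W \<and>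
      (\<forall>y\<in>W \<inter> torus_points n. (\<lambda>y\<in>torus_points n. y j) y = g y)"
    if "x \<in> torus_points n" for x :: "nat \<Rightarrow> 'a"
    by (rule exI[of _ "affine_points n"], rule exI[of _ "\<lambda>y\<in>affine_points n. y j"])
      (use a that 1 in \<open>auto simp: torus_points_def\<close>)
  then have 2: "(\<lambda>y\<in>torus_points n. y j) \<in> regular (torus n) (torus_points n :: (nat \<Rightarrow> 'a) set)"
    unfolding torus_def torus_points_def[symmetric] subspace_on_def by (simp add: affine_space_def)
  have 3: "openin (space_top (torus n)) (torus_points n :: (nat \<Rightarrow> 'a) set)" by (metis openin_topspace points_torus)
  have "\<exists>W g. openin (space_top (torus n)) W \<and> x \<in> W \<and> W \<inter> Y \<subseteq> Y \<and> g \<in> regular (torus n) W \<and>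
      (\<forall>y\<in>W \<inter> Y. (\<lambda>y\<in>Y. y j) y = g y)"
    if "x \<in> Y" for x
    by (rule exI[of _ "torus_points n"], rule exI[of _ "\<lambda>y\<in>torus_points n. y j"])
      (use 2 3 that Y in auto)
  then show ?thesis unfolding subspace_on_def by simp
qed

lemma reg_coordinate_of_morphism:
  assumes Y: "torus_subset n Y" "closedin (space_top (torus n)) Y"
    and \<theta>: "morphism (subspace_on (torus n) Y) (subspace_on (torus n) Y) \<theta>" and j: "j < n"
  shows "torus_subset.reg n Y (\<lambda>y. \<theta> y j)"
proof -
  let ?S = "subspace_on (torus n) Y"
  note pY = points_subspace_torus[OF Y(2)] closed_torus_subset[OF Y(2)]
  have "openin (space_top ?S) Y" by (metis openin_topspace pY(1))
  then have "restrict ((\<lambda>y\<in>Y. y j) \<circ> \<theta>) {x \<in> points ?S. \<theta> x \<in> Y} \<in> regular ?S {x \<in> points ?S. \<theta> x \<in> Y}"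
    using \<theta> coordinate_regular[OF j pY(2)] by (simp add: morphism_def)
  moreover have \<theta>Y: "\<theta> x \<in> Y" if "x \<in> Y" for x using morphism_maps[OF \<theta>] that pY(1) by simp
  then have "{x \<in> points ?S. \<theta> x \<in> Y} = Y" using pY(1) by auto
  ultimately have "torus_subset.reg n Y (restrict ((\<lambda>y\<in>Y. y j) \<circ> \<theta>) Y)"
    by (intro reg_of_regular[OF Y(1) pY(2)]) simp
  then show ?thesis using \<theta>Y unfolding torus_subset.reg_def[OF Y(1)] by simp
qed

theorem theorem2p16:
  fixes X :: "('a, 'k :: {alg_closed_field, field_char_0}) fun_space"
  assumes "irreducible_variety X" and "toral X"
  shows "Jordan_group (Aut X)"
proof -
  obtain n Y \<phi> where Y: "closedin (space_top (torus n)) Y" and iso: "isomorphism X (subspace_on (torus n) Y) \<phi>"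
    using assms(2) unfolding toral_def isomorphic_def by (elim conjE exE)
  let ?S = "subspace_on (torus n) Y"
  obtain \<psi> where \<psi>: "morphism ?S X \<psi>" "\<forall>x\<in>points X. \<psi> (\<phi> x) = x" "\<forall>y\<in>points ?S. \<phi> (\<psi> y) = y"
    and \<phi>: "morphism X ?S \<phi>"
    using iso unfolding isomorphism_def by (elim conjE exE)
  interpret torus_subset n Y by (rule irreducible_toral_torus_subset[OF assms(1) Y iso])
  note pY = points_subspace_torus[OF Y] closed_torus_subset[OF Y]
  have \<psi>X: "\<psi> y \<in> points X" if "y \<in> Y" for y using morphism_maps[OF \<psi>(1)] that pY(1) by simp
  have \<phi>Y: "\<phi> x \<in> Y" if "x \<in> points X" for x using morphism_maps[OF \<phi> that] pY(1) by simp
  have \<psi>\<phi>: "\<psi> (\<phi> x) = x" if "x \<in> points X" for x using \<psi>(2) that by blast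
  have \<phi>\<psi>: "\<phi> (\<psi> y) = y" if "y \<in> Y" for y using \<psi>(3) that pY(1) by simp
  \<comment> \<open>The bound \<open>r\<close> belongs to \<open>Y\<close> and is fixed before any
    finite subgroup is considered.\<close>
  obtain r where r: "unit_rank_le r" using unit_rank_finite unfolding unit_rank_le_def by (elim exE)
  have "space_with_functions X"
    using assms(1) by (simp add: irreducible_variety_def variety_def prevariety_def)
  then have gA: "group (Aut X)" by (rule group_Aut)
  have "\<exists>A. A \<lhd> (Aut X\<lparr>carrier := K\<rparr>) \<and> comm_group (Aut X\<lparr>carrier := A\<rparr>) \<and>
      card (rcosets\<^bsub>Aut X\<lparr>carrier := K\<rparr>\<^esub> A) \<le> 3 ^ (r * r)"
    if sub: "subgroup K (Aut X)" and fin: "finite K" for K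
  proof -
    let ?G = "Aut X\<lparr>carrier := K\<rparr>"
    have K: "g \<in> Bij (points X)" "morphism X X g" if "g \<in> K" for g
      using subgroup.mem_carrier[OF sub that] by (auto simp: Aut_def isomorphism_def)
    have mult: "(g \<otimes>\<^bsub>?G\<^esub> h) x = g (h x)" if "g \<in> K" "h \<in> K" "x \<in> points X" for g h x
      using that K(1) by (simp add: Aut_def BijGroup_def compose_eq)
    \<comment> \<open>The action of \<open>K\<close> is transported from \<open>X\<close> to the
      closed subset \<open>Y\<close> of the torus, where coordinates are available.\<close>
    define \<rho> where "\<rho> g y = \<phi> (g (\<psi> y))" for g y
    have "\<exists>A. A \<lhd> ?G \<and> comm_group (?G\<lparr>carrier := A\<rparr>) \<and> card (rcosets\<^bsub>?G\<^esub> A) \<le> 3 ^ (r * r)"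
    proof (rule finite_action_jordan[OF r, of _ \<rho>])
      show "group ?G" by (rule subgroup.subgroup_is_group[OF sub gA])
      show "finite (carrier ?G)" using fin by simp
      show "Y \<subseteq> affine_points n" using pY(2) by (auto simp: torus_points_def)
      show "\<rho> g y \<in> Y" if "g \<in> carrier ?G" "y \<in> Y" for g y
        using that K(1) by (simp add: \<rho>_def \<phi>Y \<psi>X Bij_maps)
      show "\<rho> (g \<otimes>\<^bsub>?G\<^esub> h) y = \<rho> g (\<rho> h y)" if "g \<in> carrier ?G" "h \<in> carrier ?G" "y \<in> Y" for g h y
      proof -
        have "h (\<psi> y) \<in> points X" using that K(1) by (simp add: \<psi>X Bij_maps)
        then show ?thesis using that mult[of g h "\<psi> y"] by (simp add: \<rho>_def \<psi>\<phi> \<psi>X)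
      qed
      show "reg (\<lambda>y. \<rho> g y j)" if "g \<in> carrier ?G" "j < n" for g j
      proof (rule reg_coordinate_of_morphism[OF _ Y _ that(2)])
        show "torus_subset n Y" by unfold_locales
        have "morphism ?S ?S (\<phi> \<circ> (g \<circ> \<psi>))"
          using morphism_compose[OF morphism_compose[OF \<psi>(1) K(2)] \<phi>] that(1) by simp
        then show "morphism ?S ?S (\<rho> g)" by (simp add: \<rho>_def[abs_def] comp_def)
      qed
      show "\<rho> \<one>\<^bsub>?G\<^esub> y = y" if "y \<in> Y" for y
        using that by (simp add: \<rho>_def Aut_def BijGroup_def \<psi>X \<phi>\<psi>)
      show "g = h" if g: "g \<in> carrier ?G" and h: "h \<in> carrier ?G" and eq: "\<And>y. y \<in> Y \<Longrightarrow> \<rho> g y = \<rho> h y" for g h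
      proof (rule extensionalityI[of _ "points X"])
        show "g \<in> extensional (points X)" "h \<in> extensional (points X)"
          using K(1) g h by (auto simp: Bij_def)
        fix x assume x: "x \<in> points X"
        have "\<phi> (g x) = \<phi> (h x)" using eq[OF \<phi>Y[OF x]] by (simp add: \<rho>_def \<psi>\<phi> x)
        moreover have "g x \<in> points X" "h x \<in> points X" using K(1) g h x by (simp_all add: Bij_maps)
        ultimately show "g x = h x" using \<psi>\<phi> by metis
      qed
    qed
    then show ?thesis by simp
  qed
  then show ?thesis unfolding Jordan_group_def
    using gA by (intro conjI exI[of _ "3 ^ (r * r)"] allI impI) auto
qed

end
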